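(* The moduli space $TM_{2,2}$ of tropical curves of genus $2$ with two marked points is contractible.
   Context: Graphs are finite, undirected and connected; loops and multiple edges are allowed. The genus of $G$ is $|E(G)|-|V(G)|+1$; $[n]=\{1,\dots,n\}$. The space $TM_{g,n}$ (for $g\ge2$, $n\ge0$): its points are the isomorphism classes of triples $(G,l,p)$, where $G$ is a graph of genus $g$ (bridges are allowed), $l:E(G)\to(0,\infty)$ is a length function, and $p:[n]\to V(G)$ is a marking function, such that $\mathrm{val}(v)+|p^{-1}(v)|\ge 3$ for every vertex $v$ of $G$ (a loop contributes $2$ to the valency of its vertex). An isomorphism of triples is a graph isomorphism preserving lengths and markings. The topology is the quotient topology with respect to the surjection $\coprod_{(G,p)}\{l:E(G)\to[0,\infty): l^{-1}(0)\text{ contains no cycle}\}\to TM_{g,n}$ (disjoint union over combinatorial types $(G,p)$, where $G$ is a graph of genus $g$ and $p:[n]\to V(G)$ is a marking function such that $\mathrm{val}(v)+|p^{-1}(v)|\ge 3$ for every vertex $v$ of $G$), which contracts all edges of length $0$ and carries the marking along. *)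

theory Defs
  imports "HOL-Analysis.Analysis"
begin

section \<open>Multigraphs\<close>

text \<open>The two ends of an edge form a set: a doubleton, or a singleton for a loop.\<close>

record ('v, 'e) multigraph =
  verts :: "'v set"
  edges :: "'e set"
  ends :: "'e \<Rightarrow> 'v set"

definition finite_multigraph :: "('v, 'e) multigraph \<Rightarrow> bool" where
  "finite_multigraph G \<longleftrightarrow> finite (verts G) \<and> finite (edges G) \<and>
     ends G \<in> edges G \<rightarrow>\<^sub>E {s. s \<subseteq> verts G \<and> (card s = 1 \<or> card s = 2)}"

definition adj :: "('v, 'e) multigraph \<Rightarrow> 'e set \<Rightarrow> ('v \<times> 'v) set" where
  "adj G F = {(u, v). \<exists>e\<in>F. ends G e = {u, v}}"

definition reach :: "('v, 'e) multigraph \<Rightarrow> 'e set \<Rightarrow> ('v \<times> 'v) set" where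
  "reach G F = (adj G F)\<^sup>* \<inter> verts G \<times> verts G"

definition connected_multigraph :: "('v, 'e) multigraph \<Rightarrow> bool" where
  "connected_multigraph G \<longleftrightarrow>
     verts G \<noteq> {} \<and> (\<forall>u\<in>verts G. \<forall>v\<in>verts G. (u, v) \<in> reach G (edges G))"

definition genus :: "('v, 'e) multigraph \<Rightarrow> int" where
  "genus G = int (card (edges G)) - int (card (verts G)) + 1"

definition valency :: "('v, 'e) multigraph \<Rightarrow> 'v \<Rightarrow> nat" where
  "valency G v = (\<Sum>e\<in>{e \<in> edges G. v \<in> ends G e}. if ends G e = {v} then 2 else 1)"

text \<open>A cycle \<open>vs ! 0, es ! 0, vs ! 1, es ! 1, \<dots>, vs ! 0\<close>; length 1 is a loop and
  length 2 a pair of parallel edges.\<close>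

definition is_cycle :: "('v, 'e) multigraph \<Rightarrow> 'v list \<Rightarrow> 'e list \<Rightarrow> bool" where
  "is_cycle G vs es \<longleftrightarrow> es \<noteq> [] \<and> length vs = length es \<and> distinct vs \<and> distinct es \<and>
     set vs \<subseteq> verts G \<and> set es \<subseteq> edges G \<and>
     (\<forall>i<length es. ends G (es ! i) = {vs ! i, vs ! (Suc i mod length es)})"

definition contains_cycle :: "('v, 'e) multigraph \<Rightarrow> 'e set \<Rightarrow> bool" where
  "contains_cycle G F \<longleftrightarrow> (\<exists>vs es. is_cycle G vs es \<and> set es \<subseteq> F)"

section \<open>Tropical curves\<close>

definition combinatorial_type ::
    "nat \<Rightarrow> nat \<Rightarrow> ('v, 'e) multigraph \<Rightarrow> (nat \<Rightarrow> 'v) \<Rightarrow> bool" where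
  "combinatorial_type g n G p \<longleftrightarrow>
     finite_multigraph G \<and> connected_multigraph G \<and> genus G = int g \<and>
     p \<in> {1..n} \<rightarrow>\<^sub>E verts G \<and>
     (\<forall>v\<in>verts G. valency G v + card {i \<in> {1..n}. p i = v} \<ge> 3)"

type_synonym ('v, 'e) curve = "('v, 'e) multigraph \<times> ('e \<Rightarrow> real) \<times> (nat \<Rightarrow> 'v)"

definition tropical_curve :: "nat \<Rightarrow> nat \<Rightarrow> ('v, 'e) curve \<Rightarrow> bool" where
  "tropical_curve g n = (\<lambda>(G, l, p).
     combinatorial_type g n G p \<and> l \<in> edges G \<rightarrow>\<^sub>E {0<..})"

definition curve_iso :: "nat \<Rightarrow> ('v, 'e) curve \<Rightarrow> ('w, 'f) curve \<Rightarrow> bool" where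
  "curve_iso n = (\<lambda>(G, l, p) (G', l', p'). \<exists>\<phi> \<psi>.
     bij_betw \<phi> (verts G) (verts G') \<and> bij_betw \<psi> (edges G) (edges G') \<and>
     (\<forall>e\<in>edges G. ends G' (\<psi> e) = \<phi> ` ends G e \<and> l' (\<psi> e) = l e) \<and>
     (\<forall>i\<in>{1..n}. p' i = \<phi> (p i)))"

text \<open>Every curve, whatever its types of vertices and edges, is isomorphic to one whose
  vertices and edges are natural numbers; these represent the isomorphism class.\<close>

definition curve_class :: "nat \<Rightarrow> nat \<Rightarrow> ('v, 'e) curve \<Rightarrow> (nat, nat) curve set" where
  "curve_class g n C = {D. tropical_curve g n D \<and> curve_iso n C D}"

definition TM_points :: "nat \<Rightarrow> nat \<Rightarrow> (nat, nat) curve set set" where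
  "TM_points g n = curve_class g n ` {C :: (nat, nat) curve. tropical_curve g n C}"

section \<open>The topology\<close>

definition zero_edges :: "('v, 'e) multigraph \<Rightarrow> ('e \<Rightarrow> real) \<Rightarrow> 'e set" where
  "zero_edges G l = {e \<in> edges G. l e = 0}"

definition cell :: "('v, 'e) multigraph \<Rightarrow> ('e \<Rightarrow> real) topology" where
  "cell G = subtopology (product_topology (\<lambda>_. euclideanreal) (edges G))
     {l \<in> edges G \<rightarrow>\<^sub>E {0..}. \<not> contains_cycle G (zero_edges G l)}"

text \<open>Contraction of the edges of length 0: the vertices of the result are the connected
  components of the subgraph they span.\<close>

definition contract :: "nat \<Rightarrow> ('v, 'e) curve \<Rightarrow> ('v set, 'e) curve" where
  "contract n = (\<lambda>(G, l, p).
     let Z = zero_edges G l; E = edges G - Z; q = (\<lambda>v. reach G Z `` {v})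
     in (\<lparr>verts = verts G // reach G Z, edges = E, ends = (\<lambda>e\<in>E. q ` ends G e)\<rparr>,
         restrict l E, \<lambda>i\<in>{1..n}. q (p i)))"

text \<open>The disjoint union is indexed by all pairs with vertices and edges in \<open>nat\<close>, i.e. by
  all such representatives of each combinatorial type. Isomorphic pairs have
  homeomorphic cells with the same contractions, so the quotient topology is the same as
  for one representative per type.\<close>

definition cells ::
    "nat \<Rightarrow> nat \<Rightarrow> (((nat, nat) multigraph \<times> (nat \<Rightarrow> nat)) \<times> (nat \<Rightarrow> real)) topology" where
  "cells g n = sum_topology (\<lambda>(G, p). cell G) {(G, p). combinatorial_type g n G p}"

definition TM_map ::
    "nat \<Rightarrow> nat \<Rightarrow> ((nat, nat) multigraph \<times> (nat \<Rightarrow> nat)) \<times> (nat \<Rightarrow> real)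
      \<Rightarrow> (nat, nat) curve set" where
  "TM_map g n = (\<lambda>((G, p), l). curve_class g n (contract n (G, l, p)))"

definition TM :: "nat \<Rightarrow> nat \<Rightarrow> (nat, nat) curve set topology" where
  "TM g n = topology (\<lambda>U. U \<subseteq> TM_points g n \<and>
     openin (cells g n) {x \<in> topspace (cells g n). TM_map g n x \<in> U})"

lemma openin_TM:
  "openin (TM g n) U \<longleftrightarrow>
     U \<subseteq> TM_points g n \<and> openin (cells g n) {x \<in> topspace (cells g n). TM_map g n x \<in> U}"
proof -
  have "istopology (\<lambda>U. U \<subseteq> TM_points g n \<and>
     openin (cells g n) {x \<in> topspace (cells g n). TM_map g n x \<in> U})"
    unfolding istopology_def
  proof (intro conjI allI impI; (elim conjE)?)
    fix S T
    assume "openin (cells g n) {x \<in> topspace (cells g n). TM_map g n x \<in> S}"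
      "openin (cells g n) {x \<in> topspace (cells g n). TM_map g n x \<in> T}"
    then have "openin (cells g n) ({x \<in> topspace (cells g n). TM_map g n x \<in> S} \<inter>
      {x \<in> topspace (cells g n). TM_map g n x \<in> T})"
      by (rule openin_Int)
    then show "openin (cells g n) {x \<in> topspace (cells g n). TM_map g n x \<in> S \<inter> T}"
      by (rule back_subst[of "openin (cells g n)"]) auto
  next
    fix K
    assume K: "\<forall>U\<in>K. U \<subseteq> TM_points g n \<and>
      openin (cells g n) {x \<in> topspace (cells g n). TM_map g n x \<in> U}"
    then have "openin (cells g n) (\<Union>U\<in>K. {x \<in> topspace (cells g n). TM_map g n x \<in> U})"
      by auto
    then show "openin (cells g n) {x \<in> topspace (cells g n). TM_map g n x \<in> \<Union>K}"
      by (rule back_subst[of "openin (cells g n)"]) auto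
    from K show "\<Union>K \<subseteq> TM_points g n" by auto
  qed auto
  then show ?thesis
    by (simp add: TM_def)
qed

end

theory Submission imports Defs
begin

text \<open>
  Shrinking all bridges to length zero is a deformation of the moduli space that ends in bridgeless
  curves (\<open>bridge_homotopy\<close>). A bridgeless curve of genus 2 consists of three arcs \<open>a\<close>, \<open>b\<close>, \<open>c\<close> between
  two branch vertices \<open>u\<close> and \<open>v\<close>, at most one of the arcs having length zero. Its two marks \<open>x\<close>, \<open>y\<close> lie
  on the arcs. So there are two models: \<open>graph_A\<close>, where both marks lie on \<open>a\<close>, and \<open>graph_B\<close>, where \<open>x\<close>
  lies on \<open>a\<close> and \<open>y\<close> on \<open>b\<close>. Subdividing the arcs at the marks gives five edges, and a curve is
  described by the five lengths. By \<open>model_of_type\<close>, for every combinatorial type the curve with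
  shrunken bridges is one of these, with lengths that depend continuously on the original lengths.

  Different lengths give the same curve only because of a few evident moves: exchanging \<open>u\<close> and \<open>v\<close>;
  reflecting one of the two loops that arise for \<open>c = 0\<close>; exchanging two arcs without
  marks in their interior; and passing from one model to the other when a mark sits at a branch vertex. The
  theorem \<open>curve_invariance\<close> says that these generate all coincidences. Together with the fact that
  the moduli space carries a final topology, and that final topologies are compatible with products
  by the unit interval, this reduces the construction of homotopies to formulas in five real
  variables: one has to check continuity on finitely many closed pieces and compatibility with
  the moves.

  Four such homotopies contract the space of bridgeless curves.
  If both marks lie on the same arc, they are pushed apart until one of them meets a branch vertex,
  and then the marks lie on different arcs (\<open>push_apart\<close>).
  Rescaling every arc by itself gives the two longest arcs length 1 and the third one length at
  most 1 (\<open>equalize\<close>).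
  If the short arc carries a mark, then, depending on its length, the arc is contracted, the mark
  slides into a branch vertex, or the arc is stretched to length 1 (\<open>slide\<close>). Afterwards every curve
  can be described with both marks on arcs of length 1.
  Finally the short arc shrinks to a point (\<open>shrink_end\<close>). What remains are two loops of length 1
  with a common vertex and one mark on each. Such a curve is determined by the two distances from
  the common vertex to the marks, so these curves form the square with side 1/2, which is
  contractible.
\<close>

section \<open>Components and forests in a multigraph\<close>

definition edges_within :: "('v, 'e) multigraph \<Rightarrow> 'e set \<Rightarrow> bool" where
  "edges_within G F \<longleftrightarrow> finite (verts G) \<and> finite F \<and>
     (\<forall>e\<in>F. \<exists>u\<in>verts G. \<exists>v\<in>verts G. ends G e = {u, v})"

text \<open>Each edge is a bridge of the subgraph formed by the set. This agrees with the absence of cycles by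
  \<open>contains_cycle_iff_not_forest\<close>, and unlike cycles it is transported directly by \<open>reach\<close>.\<close>

definition forest :: "('v, 'e) multigraph \<Rightarrow> 'e set \<Rightarrow> bool" where
  "forest G F \<longleftrightarrow> (\<forall>e\<in>F. \<forall>u v. ends G e = {u, v} \<longrightarrow> (u, v) \<notin> reach G (F - {e}))"

lemma finite_multigraph_ends:
  assumes "finite_multigraph G" "e \<in> edges G"
  obtains u v where "u \<in> verts G" "v \<in> verts G" "ends G e = {u, v}"
proof -
  have "ends G e \<subseteq> verts G" "card (ends G e) = 1 \<or> card (ends G e) = 2"
    using assms unfolding finite_multigraph_def by auto
  then show thesis
    using that by (metis card_1_singletonE card_2_iff insertI1 insert_absorb2 insert_subset)
qed

lemma edges_within_multigraph:
  assumes "finite_multigraph G" "F \<subseteq> edges G"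
  shows "edges_within G F"
  unfolding edges_within_def
proof (intro conjI ballI)
  show "finite (verts G)" "finite F"
    using assms by (auto simp: finite_multigraph_def intro: finite_subset)
  fix e assume "e \<in> F"
  then have "e \<in> edges G"
    using assms(2) by auto
  then show "\<exists>u\<in>verts G. \<exists>v\<in>verts G. ends G e = {u, v}"
    using finite_multigraph_ends[OF assms(1)] by metis
qed

lemma edges_within_subset: "edges_within G F \<Longrightarrow> F' \<subseteq> F \<Longrightarrow> edges_within G F'"
  unfolding edges_within_def using finite_subset by blast

lemma sym_adj: "sym (adj G F)"
  unfolding adj_def sym_def by (auto simp: insert_commute)

lemma reach_refl: "v \<in> verts G \<Longrightarrow> (v, v) \<in> reach G F"
  by (simp add: reach_def)

lemma reach_sym: "(u, v) \<in> reach G F \<Longrightarrow> (v, u) \<in> reach G F"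
  unfolding reach_def using symD[OF sym_rtrancl[OF sym_adj], of u v G F] by auto

lemma reach_trans: "(u, v) \<in> reach G F \<Longrightarrow> (v, w) \<in> reach G F \<Longrightarrow> (u, w) \<in> reach G F"
  unfolding reach_def by auto

lemma reach_mono: "F \<subseteq> F' \<Longrightarrow> (u, v) \<in> reach G F \<Longrightarrow> (u, v) \<in> reach G F'"
proof -
  assume "F \<subseteq> F'" "(u, v) \<in> reach G F"
  moreover have "(adj G F)\<^sup>* \<subseteq> (adj G F')\<^sup>*"
    using \<open>F \<subseteq> F'\<close> by (intro rtrancl_mono) (auto simp: adj_def)
  ultimately show ?thesis
    unfolding reach_def by auto
qed

lemma reach_verts: "(u, v) \<in> reach G F \<Longrightarrow> u \<in> verts G \<and> v \<in> verts G"
  by (simp add: reach_def)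

lemma reach_edge:
  "e \<in> F \<Longrightarrow> ends G e = {u, v} \<Longrightarrow> u \<in> verts G \<Longrightarrow> v \<in> verts G \<Longrightarrow> (u, v) \<in> reach G F"
  unfolding reach_def adj_def by auto

lemma equiv_reach: "equiv (verts G) (reach G F)"
  by (intro equivI refl_onI symI transI)
    (auto intro: reach_refl reach_sym dest: reach_verts, blast intro: reach_trans)

lemma reach_induct [consumes 1, case_names start step]:
  assumes "(u, v) \<in> reach G F" "P u"
    and "\<And>e a b. e \<in> F \<Longrightarrow> ends G e = {a, b} \<Longrightarrow> P a \<Longrightarrow> P b"
  shows "P v"
proof -
  have "(u, v) \<in> (adj G F)\<^sup>*"
    using assms(1) by (simp add: reach_def)
  then show ?thesis
    by (induction rule: rtrancl_induct) (use assms(2,3) in \<open>auto simp: adj_def\<close>)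
qed

lemma reach_insert:
  assumes "edges_within G (insert e F)" "ends G e = {u, v}"
  shows "(a, b) \<in> reach G (insert e F) \<longleftrightarrow>
    (a, b) \<in> reach G F \<or> (a, u) \<in> reach G F \<and> (v, b) \<in> reach G F \<or>
      (a, v) \<in> reach G F \<and> (u, b) \<in> reach G F" (is "?L \<longleftrightarrow> ?R b")
proof
  have uv: "u \<in> verts G" "v \<in> verts G"
    using assms unfolding edges_within_def by (auto simp: doubleton_eq_iff)
  assume ?L
  then have a: "a \<in> verts G"
    by (simp add: reach_def)
  from \<open>?L\<close> show "?R b"
  proof (induction rule: reach_induct)
    case start
    show ?case using a by (simp add: reach_refl)
  next
    case (step f x y)
    have xy: "x \<in> verts G" "y \<in> verts G"
      using assms(1) step(1,2) unfolding edges_within_def by (auto simp: doubleton_eq_iff)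
    show ?case
    proof (cases "f = e")
      case True
      then have "x = u \<and> y = v \<or> x = v \<and> y = u"
        using step(2) assms(2) by (auto simp: doubleton_eq_iff)
      then show ?thesis
        using step(3) uv by (auto intro: reach_refl reach_trans reach_sym)
    next
      case False
      then have "(x, y) \<in> reach G F"
        using step xy by (auto intro: reach_edge)
      then show ?thesis
        using step(3) by (auto intro: reach_trans)
    qed
  qed
next
  have uv: "u \<in> verts G" "v \<in> verts G"
    using assms unfolding edges_within_def by (auto simp: doubleton_eq_iff)
  have 1: "(u, v) \<in> reach G (insert e F)"
    using assms(2) uv by (auto intro: reach_edge)
  have 2: "(x, y) \<in> reach G (insert e F)" if "(x, y) \<in> reach G F" for x y
    using that by (rule reach_mono[rotated]) auto
  assume "?R b"
  then show ?L
    using 1 2 reach_sym[OF 1] by (meson reach_trans)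
qed

lemma card_components_insert:
  assumes "edges_within G (insert e F)" "ends G e = {u, v}"
  shows "(u, v) \<in> reach G F \<Longrightarrow> verts G // reach G (insert e F) = verts G // reach G F"
    and "(u, v) \<notin> reach G F \<Longrightarrow>
      Suc (card (verts G // reach G (insert e F))) = card (verts G // reach G F)"
proof -
  assume "(u, v) \<in> reach G F"
  then have "reach G (insert e F) = reach G F"
    unfolding set_eq_iff using reach_insert[OF assms]
    by (auto intro: reach_trans) (meson reach_sym reach_trans)+
  then show "verts G // reach G (insert e F) = verts G // reach G F"
    by simp
next
  assume nr: "(u, v) \<notin> reach G F"
  have uv: "u \<in> verts G" "v \<in> verts G"
    using assms unfolding edges_within_def by (auto simp: doubleton_eq_iff)
  let ?R = "reach G F" and ?R' = "reach G (insert e F)" and ?V = "verts G"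
  have fin: "finite (?V // ?R)"
    using assms(1) by (auto simp: edges_within_def reach_def intro!: finite_quotient)
  have cls: "?R' `` {a} = (if (a, u) \<in> ?R \<or> (a, v) \<in> ?R then ?R `` {u} \<union> ?R `` {v} else ?R `` {a})" for a
  proof -
    have move: "(a, c) \<in> ?R \<Longrightarrow> (a, b) \<in> ?R \<longleftrightarrow> (c, b) \<in> ?R" for b c
      by (meson reach_sym reach_trans)
    have "(a, u) \<notin> ?R \<or> (a, v) \<notin> ?R"
      using nr by (meson reach_sym reach_trans)
    then have "(a, b) \<in> ?R' \<longleftrightarrow>
        (if (a, u) \<in> ?R \<or> (a, v) \<in> ?R then (u, b) \<in> ?R \<or> (v, b) \<in> ?R else (a, b) \<in> ?R)" for b
      using reach_insert[OF assms, of a b] move[of u b] move[of v b] by argo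
    then show ?thesis
      by (simp add: set_eq_iff)
  qed
  have eqc: "?R `` {a} = ?R `` {b} \<longleftrightarrow> (a, b) \<in> ?R" if "a \<in> ?V" "b \<in> ?V" for a b
    using that by (rule eq_equiv_class_iff[OF equiv_reach])
  have "?V // ?R' = insert (?R `` {u} \<union> ?R `` {v}) (?V // ?R - {?R `` {u}, ?R `` {v}})" (is "_ = ?S")
  proof (intro equalityI subsetI)
    fix X assume "X \<in> ?V // ?R'"
    then obtain a where a: "a \<in> ?V" "X = ?R' `` {a}"
      by (auto simp: quotient_def)
    then show "X \<in> ?S"
      using cls[of a] eqc[OF a(1)] uv by (auto simp: quotient_def)
  next
    fix X assume "X \<in> ?S"
    then consider "X = ?R `` {u} \<union> ?R `` {v}" | a where "a \<in> ?V" "X = ?R `` {a}" "(a, u) \<notin> ?R" "(a, v) \<notin> ?R"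
      using eqc uv by (auto simp: quotient_def)
    then show "X \<in> ?V // ?R'"
    proof cases
      case 1
      then have "X = ?R' `` {u}"
        using cls[of u] uv by (simp add: reach_refl)
      then show ?thesis
        using uv by (auto simp: quotient_def)
    next
      case 2
      then show ?thesis
        using cls[of a] by (auto simp: quotient_def)
    qed
  qed
  moreover have "?R `` {u} \<union> ?R `` {v} \<notin> ?V // ?R - {?R `` {u}, ?R `` {v}}"
  proof
    assume "?R `` {u} \<union> ?R `` {v} \<in> ?V // ?R - {?R `` {u}, ?R `` {v}}"
    then obtain a where "a \<in> ?V" "?R `` {u} \<union> ?R `` {v} = ?R `` {a}"
      by (auto simp: quotient_def)
    then have "(a, u) \<in> ?R" "(a, v) \<in> ?R"
      using uv by (auto intro: reach_refl)
    then show False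
      using nr by (meson reach_sym reach_trans)
  qed
  moreover have "?R `` {u} \<in> ?V // ?R" "?R `` {v} \<in> ?V // ?R" "?R `` {u} \<noteq> ?R `` {v}"
    using uv nr eqc[OF uv] by (auto simp: quotient_def)
  then have "card (?V // ?R - {?R `` {u}, ?R `` {v}}) + 2 = card (?V // ?R)"
    using fin card_mono[OF fin, of "{?R `` {u}, ?R `` {v}}"] by (simp add: card_Diff_subset)
  ultimately show "Suc (card (?V // ?R')) = card (?V // ?R)"
    using fin by simp
qed

lemma quotient_reach_empty: "verts G // reach G {} = (\<lambda>v. {v}) ` verts G"
  by (auto simp: reach_def adj_def quotient_def)

lemma card_components_ge:
  assumes "edges_within G F"
  shows "card (verts G) \<le> card (verts G // reach G F) + card F"
proof -
  have "finite F" using assms by (simp add: edges_within_def)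
  then show ?thesis
    using assms
  proof (induction F)
    case empty
    then show ?case by (simp add: quotient_reach_empty card_image)
  next
    case (insert e F)
    obtain u v where "ends G e = {u, v}"
      using insert.prems by (auto simp: edges_within_def)
    moreover have "edges_within G F"
      using insert.prems by (rule edges_within_subset) auto
    ultimately show ?case
      using card_components_insert[OF insert.prems \<open>ends G e = {u, v}\<close>] insert.IH insert.hyps
      by (cases "(u, v) \<in> reach G F") auto
  qed
qed

lemma forest_subset:
  assumes "forest G F" "F' \<subseteq> F"
  shows "forest G F'"
  unfolding forest_def
proof (intro ballI allI impI notI)
  fix e u v assume e: "e \<in> F'" "ends G e = {u, v}" "(u, v) \<in> reach G (F' - {e})"
  then have "(u, v) \<in> reach G (F - {e})"
    using assms(2) by (intro reach_mono[of "F' - {e}" "F - {e}"]) auto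
  then show False
    using assms e unfolding forest_def by blast
qed

text \<open>Starting from isolated vertices, each added edge lowers the number of components by at most one, and
  by exactly one when it closes no cycle.\<close>

lemma forest_iff_card_components:
  assumes "edges_within G F"
  shows "forest G F \<longleftrightarrow> card (verts G) = card (verts G // reach G F) + card F"
proof
  have "finite F" using assms by (simp add: edges_within_def)
  moreover assume "forest G F"
  ultimately show "card (verts G) = card (verts G // reach G F) + card F"
    using assms
  proof (induction F)
    case empty
    then show ?case by (simp add: quotient_reach_empty card_image)
  next
    case (insert e F)
    obtain u v where uv: "ends G e = {u, v}"
      using insert.prems by (auto simp: edges_within_def)
    have "(u, v) \<notin> reach G F"
      using insert.prems(1) uv insert.hyps by (auto simp: forest_def)
    moreover have "edges_within G F" "forest G F"
      using insert.prems by (auto intro: edges_within_subset forest_subset)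
    ultimately show ?case
      using card_components_insert(2)[OF insert.prems(2) uv] insert.IH insert.hyps by simp
  qed
next
  assume eq: "card (verts G) = card (verts G // reach G F) + card F"
  show "forest G F"
    unfolding forest_def
  proof (intro ballI allI impI notI)
    fix e u v assume e: "e \<in> F" "ends G e = {u, v}" "(u, v) \<in> reach G (F - {e})"
    then have F: "insert e (F - {e}) = F" by auto
    have "card (verts G) \<le> card (verts G // reach G (F - {e})) + card (F - {e})"
      by (rule card_components_ge[OF edges_within_subset[OF assms]]) auto
    also have "verts G // reach G (F - {e}) = verts G // reach G F"
      using card_components_insert(1)[of G e "F - {e}", unfolded F, OF assms e(2,3)] by simp
    also have "card (F - {e}) < card F"
      using e(1) assms card_Diff1_less[of F e] by (simp add: edges_within_def)
    finally show False
      using eq by simp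
  qed
qed

text \<open>The edges of a forest inside one of its components form a tree. This is what makes valencies
  behave well under contraction.\<close>

lemma forest_component_card:
  assumes F: "edges_within G F" "forest G F" and w: "w \<in> verts G"
  defines "W \<equiv> reach G F `` {w}"
  shows "card {e \<in> F. ends G e \<subseteq> W} + 1 = card W"
proof -
  let ?F = "{e \<in> F. ends G e \<subseteq> W}" and ?G = "\<lparr>verts = W, edges = edges G, ends = ends G\<rparr>"
  have WV: "W \<subseteq> verts G"
    by (auto simp: W_def reach_def)
  have wW: "w \<in> W"
    using w by (simp add: W_def reach_refl)
  have within: "edges_within ?G ?F"
    using F(1) finite_subset[OF WV] by (fastforce simp: edges_within_def)
  have sub: "reach ?G F' \<subseteq> reach G F'" for F'
    using WV by (auto simp: reach_def adj_def)
  have "forest ?G ?F"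
    unfolding forest_def
  proof (intro ballI allI impI)
    fix e u v assume e: "e \<in> ?F" "ends ?G e = {u, v}"
    have "forest G ?F"
      by (rule forest_subset[OF F(2)]) auto
    then have "(u, v) \<notin> reach G (?F - {e})"
      using e by (simp add: forest_def)
    then show "(u, v) \<notin> reach ?G (?F - {e})"
      using sub[of "?F - {e}"] by blast
  qed
  moreover have "W // reach ?G ?F = {W}"
  proof -
    have "(w, x) \<in> reach ?G ?F" if "x \<in> W" for x
    proof -
      have "(w, x) \<in> reach G F"
        using that by (simp add: W_def)
      then have "(w, x) \<in> reach G F \<and> (w, x) \<in> reach ?G ?F"
      proof (induction rule: reach_induct)
        case start
        then show ?case using w wW by (simp add: reach_refl)
      next
        case (step e a b)
        have ab: "a \<in> verts G" "b \<in> verts G"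
          using step(1,2) F(1) unfolding edges_within_def by (auto simp: doubleton_eq_iff)
        then have b: "(w, b) \<in> reach G F"
          using step by (meson reach_edge reach_trans)
        then have "a \<in> W" "b \<in> W"
          using step(3) by (auto simp: W_def)
        then have "(a, b) \<in> reach ?G ?F"
          using step by (intro reach_edge[of e]) auto
        then show ?case
          using b step(3) by (meson reach_trans)
      qed
      then show ?thesis by simp
    qed
    then have "(x, y) \<in> reach ?G ?F" if "x \<in> W" "y \<in> W" for x y
      using that by (meson reach_sym reach_trans)
    moreover have "reach ?G ?F \<subseteq> W \<times> W"
      by (auto simp: reach_def)
    ultimately have "reach ?G ?F = W \<times> W"
      by auto
    then show ?thesis
      using wW by (auto simp: quotient_def)
  qed
  ultimately show ?thesis
    using forest_iff_card_components[OF within] by simp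
qed

text \<open>A walk becomes a path when it is cut back to the earlier visit each time it returns to a vertex.\<close>

lemma rtrancl_adj_simple_path:
  assumes "(u, v) \<in> (adj G F)\<^sup>*"
  shows "\<exists>vs es. hd vs = u \<and> last vs = v \<and> distinct vs \<and> length vs = Suc (length es) \<and>
    set es \<subseteq> F \<and> (\<forall>i<length es. ends G (es ! i) = {vs ! i, vs ! Suc i}) \<and>
    set vs \<subseteq> insert u (\<Union>e\<in>F. ends G e)"
  using assms
proof (induction rule: rtrancl_induct)
  case base
  show ?case
    by (intro exI[of _ "[u]"] exI[of _ "[]"]) auto
next
  case (step w x)
  then obtain vs es where p: "hd vs = u" "last vs = w" "distinct vs" "length vs = Suc (length es)"
    "set es \<subseteq> F" "\<And>i. i < length es \<Longrightarrow> ends G (es ! i) = {vs ! i, vs ! Suc i}"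
    "set vs \<subseteq> insert u (\<Union>e\<in>F. ends G e)"
    by auto
  obtain e where e: "e \<in> F" "ends G e = {w, x}"
    using step by (auto simp: adj_def)
  have ne: "vs \<noteq> []" using p(4) by auto
  show ?case
  proof (cases "x \<in> set vs")
    case True
    then obtain k where k: "k < length vs" "vs ! k = x"
      by (auto simp: in_set_conv_nth)
    show ?thesis
    proof (intro exI[of _ "take (Suc k) vs"] exI[of _ "take k es"] conjI)
      show "last (take (Suc k) vs) = x"
        using k ne by (simp add: take_Suc_conv_app_nth)
      show "set (take k es) \<subseteq> F"
        by (rule order_trans[OF set_take_subset p(5)])
      show "set (take (Suc k) vs) \<subseteq> insert u (\<Union>e\<in>F. ends G e)"
        by (rule order_trans[OF set_take_subset p(7)])
      show "\<forall>i<length (take k es). ends G (take k es ! i) = {take (Suc k) vs ! i, take (Suc k) vs ! Suc i}"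
        using p(6) by simp
    qed (use p(1,3,4) k ne in \<open>simp_all add: hd_take\<close>)
  next
    case False
    show ?thesis
    proof (intro exI[of _ "vs @ [x]"] exI[of _ "es @ [e]"] conjI allI impI)
      fix i assume i: "i < length (es @ [e])"
      show "ends G ((es @ [e]) ! i) = {(vs @ [x]) ! i, (vs @ [x]) ! Suc i}"
      proof (cases "i < length es")
        case True
        then show ?thesis using p(4,6) by (auto simp: nth_append)
      next
        case False
        then have "i = length es" using i by simp
        then show ?thesis
          using p(2,4) e(2) ne by (auto simp: nth_append last_conv_nth)
      qed
    next
      show "set (vs @ [x]) \<subseteq> insert u (\<Union>e\<in>F. ends G e)"
        using p(7) e by auto
    qed (use p(1,3,4,5) e False ne in simp_all)
  qed
qed

lemma contains_cycleI:
  assumes "F \<subseteq> edges G" "e \<in> F" "ends G e = {u, v}" "(u, v) \<in> reach G (F - {e})"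
    and within: "edges_within G F"
  shows "contains_cycle G F"
proof -
  have uv: "u \<in> verts G" "v \<in> verts G"
    using assms(4) by (auto simp: reach_def)
  obtain vs es where p: "hd vs = u" "last vs = v" "distinct vs" "length vs = Suc (length es)"
    "set es \<subseteq> F - {e}" "\<And>i. i < length es \<Longrightarrow> ends G (es ! i) = {vs ! i, vs ! Suc i}"
    "set vs \<subseteq> insert u (\<Union>e\<in>F - {e}. ends G e)"
    using rtrancl_adj_simple_path[of u v G "F - {e}"] assms(4) by (auto simp: reach_def)
  have ne: "vs \<noteq> []" using p(4) by auto
  have "distinct es"
    unfolding distinct_conv_nth
  proof (intro allI impI)
    fix i j assume ij: "i < length es" "j < length es" "i \<noteq> j"
    have neq: "vs ! i \<noteq> vs ! j" "vs ! Suc i \<noteq> vs ! Suc j" "vs ! i = vs ! Suc j \<longleftrightarrow> i = Suc j" "vs ! j = vs ! Suc i \<longleftrightarrow> j = Suc i"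
      using ij p(3,4) by (simp_all add: nth_eq_iff_index_eq)
    have "{vs ! i, vs ! Suc i} \<noteq> {vs ! j, vs ! Suc j}"
    proof
      assume "{vs ! i, vs ! Suc i} = {vs ! j, vs ! Suc j}"
      then have "vs ! i = vs ! Suc j" "vs ! Suc i = vs ! j"
        using neq(1) unfolding doubleton_eq_iff by blast+
      then have "i = Suc j" "j = Suc i"
        using neq(3) neq(4) by metis+
      then show False by simp
    qed
    then show "es ! i \<noteq> es ! j"
      using p(6)[OF ij(1)] p(6)[OF ij(2)] by auto
  qed
  have "is_cycle G vs (es @ [e])"
    unfolding is_cycle_def
  proof (intro conjI allI impI)
    show "set vs \<subseteq> verts G"
      using p(7) within uv by (fastforce simp: edges_within_def)
    fix i assume i: "i < length (es @ [e])"
    show "ends G ((es @ [e]) ! i) = {vs ! i, vs ! (Suc i mod length (es @ [e]))}"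
    proof (cases "i < length es")
      case True
      then show ?thesis using p(4,6) by (auto simp: nth_append)
    next
      case False
      then have "i = length es" using i by simp
      then show ?thesis
        using p(1,2,4) assms(3) ne by (auto simp: last_conv_nth hd_conv_nth)
    qed
  qed (use p assms(1,2) \<open>distinct es\<close> in auto)
  then show ?thesis
    unfolding contains_cycle_def using p(5) assms(2) by (intro exI[of _ vs] exI[of _ "es @ [e]"]) auto
qed

lemma cycle_edge_reach:
  assumes "is_cycle G vs es" "e \<in> set es" "ends G e = {u, v}"
  shows "(u, v) \<in> reach G (set es - {e})"
proof -
  let ?n = "length es"
  have c: "es \<noteq> []" "length vs = ?n" "distinct vs" "distinct es" "set vs \<subseteq> verts G"
    "\<And>i. i < ?n \<Longrightarrow> ends G (es ! i) = {vs ! i, vs ! (Suc i mod ?n)}"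
    using assms(1) by (auto simp: is_cycle_def)
  have n: "?n > 0" using c(1) by simp
  have vV: "vs ! (i mod ?n) \<in> verts G" for i
    using c(2,5) n by (metis mod_less_divisor nth_mem subsetD)
  obtain k where k: "k < ?n" "es ! k = e"
    using assms(2) by (auto simp: in_set_conv_nth)
  have "j < ?n \<Longrightarrow> (vs ! (Suc k mod ?n), vs ! ((Suc k + j) mod ?n)) \<in> reach G (set es - {e})" for j
  proof (induction j)
    case 0
    then show ?case by (simp only: add_0_right reach_refl[OF vV])
  next
    case (Suc j)
    let ?i = "(Suc k + j) mod ?n"
    have i: "?i < ?n" using n by simp
    have "?i \<noteq> k"
    proof
      assume "?i = k"
      show False
      proof (cases "Suc k + j < ?n")
        case True
        then show ?thesis using \<open>?i = k\<close> by simp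
      next
        case False
        then have "?i = Suc k + j - ?n"
          using Suc.prems k(1) by (simp add: mod_if)
        then show ?thesis using \<open>?i = k\<close> Suc.prems False by simp
      qed
    qed
    then have "es ! ?i \<noteq> e"
      using k i c(4) by (auto simp: nth_eq_iff_index_eq)
    then have "(vs ! ?i, vs ! (Suc ?i mod ?n)) \<in> reach G (set es - {e})"
      using i c(6)[OF i] vV[of ?i] vV[of "Suc ?i"] by (intro reach_edge[of "es ! ?i"]) auto
    moreover have "Suc ?i mod ?n = (Suc k + Suc j) mod ?n"
      by (simp add: mod_Suc_eq)
    ultimately show ?case
      using Suc by (metis reach_trans Suc_lessD)
  qed
  from this[of "?n - 1"] have "(vs ! (Suc k mod ?n), vs ! k) \<in> reach G (set es - {e})"
    using n k(1) by simp
  moreover have "{u, v} = {vs ! k, vs ! (Suc k mod ?n)}"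
    using c(6)[OF k(1)] k(2) assms(3) by simp
  ultimately show ?thesis
    by (auto simp: doubleton_eq_iff intro: reach_sym)
qed

lemma contains_cycle_iff_not_forest:
  assumes "finite_multigraph G" "F \<subseteq> edges G"
  shows "contains_cycle G F \<longleftrightarrow> \<not> forest G F"
proof
  assume "contains_cycle G F"
  then obtain vs es where c: "is_cycle G vs es" "set es \<subseteq> F"
    by (auto simp: contains_cycle_def)
  then obtain e where e: "e \<in> set es"
    by (cases es) (auto simp: is_cycle_def)
  have "e \<in> edges G"
    using e c(2) assms(2) by auto
  then obtain u v where uv: "ends G e = {u, v}"
    by (rule finite_multigraph_ends[OF assms(1)])
  have "(u, v) \<in> reach G (F - {e})"
    using cycle_edge_reach[OF c(1) e uv] by (rule reach_mono[rotated]) (use c(2) in auto)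
  then show "\<not> forest G F"
    using e c(2) uv by (auto simp: forest_def)
next
  assume "\<not> forest G F"
  then obtain e u v where "e \<in> F" "ends G e = {u, v}" "(u, v) \<in> reach G (F - {e})"
    by (auto simp: forest_def)
  then show "contains_cycle G F"
    by (rule contains_cycleI[OF assms(2) _ _ _ edges_within_multigraph[OF assms]])
qed

section \<open>Contracting a forest\<close>

definition incidence :: "('v, 'e) multigraph \<Rightarrow> 'e \<Rightarrow> 'v \<Rightarrow> nat" where
  "incidence G e v = (if v \<in> ends G e then if ends G e = {v} then 2 else 1 else 0)"

lemma incidence_ends: "ends G e = {a, b} \<Longrightarrow> incidence G e v = of_bool (v = a) + of_bool (v = b)"
  by (auto simp: incidence_def)

lemma valency_incidence:
  "finite (edges G) \<Longrightarrow> valency G v = (\<Sum>e\<in>edges G. incidence G e v)"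
  unfolding valency_def incidence_def by (simp add: sum.inter_filter)

lemma sum_incidence:
  assumes "finite W" "ends G e = {a, b}"
  shows "(\<Sum>v\<in>W. incidence G e v) = of_bool (a \<in> W) + of_bool (b \<in> W)"
  using assms(1) by (simp add: incidence_ends[OF assms(2)] sum.distrib of_bool_def)

lemma sum_valency:
  assumes "finite_multigraph G"
  shows "(\<Sum>v\<in>verts G. valency G v) = 2 * card (edges G)"
proof -
  have fin: "finite (edges G)" "finite (verts G)"
    using assms by (auto simp: finite_multigraph_def)
  have "(\<Sum>v\<in>verts G. valency G v) = (\<Sum>e\<in>edges G. \<Sum>v\<in>verts G. incidence G e v)"
    by (simp add: valency_incidence[OF fin(1)] sum.swap[of _ "edges G"])
  also have "\<dots> = (\<Sum>e\<in>edges G. 2)"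
  proof (rule sum.cong)
    fix e assume "e \<in> edges G"
    then obtain a b where "a \<in> verts G" "b \<in> verts G" "ends G e = {a, b}"
      by (rule finite_multigraph_ends[OF assms])
    then show "(\<Sum>v\<in>verts G. incidence G e v) = 2"
      using sum_incidence[OF fin(2), of G e a b] by simp
  qed simp
  finally show ?thesis by simp
qed

text \<open>A surjection that respects and reflects two equivalence relations induces a bijection of the
  quotients.\<close>

lemma card_quotient_image:
  assumes h: "h ` V = W" and R: "equiv V R" and S: "equiv W S"
    and rel: "\<And>u v. u \<in> V \<Longrightarrow> v \<in> V \<Longrightarrow> (h u, h v) \<in> S \<longleftrightarrow> (u, v) \<in> R"
  shows "card (W // S) = card (V // R)"
proof -
  have eqR: "R `` {u} = R `` {v} \<longleftrightarrow> (u, v) \<in> R" if "u \<in> V" "v \<in> V" for u v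
    using eq_equiv_class_iff[OF R that] .
  have eqS: "S `` {u} = S `` {v} \<longleftrightarrow> (u, v) \<in> S" if "u \<in> W" "v \<in> W" for u v
    using eq_equiv_class_iff[OF S that] .
  have hW: "h u \<in> W" if "u \<in> V" for u
    using that h by auto
  have img: "(`) h (R `` {u}) = S `` {h u}" if u: "u \<in> V" for u
  proof (intro equalityI subsetI)
    fix w assume "w \<in> h ` (R `` {u})"
    then obtain v where v: "(u, v) \<in> R" "w = h v" by auto
    then have "v \<in> V" using R by (auto simp: equiv_def refl_on_def)
    then show "w \<in> S `` {h u}" using rel[OF u, of v] v by auto
  next
    fix w assume w: "w \<in> S `` {h u}"
    then have "w \<in> W" using S by (auto simp: equiv_def refl_on_def)
    then obtain v where v: "v \<in> V" "w = h v" using h by auto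
    then show "w \<in> h ` (R `` {u})" using rel[OF u v(1)] w by auto
  qed
  have "bij_betw ((`) h) (V // R) (W // S)"
    unfolding bij_betw_def
  proof
    show "inj_on ((`) h) (V // R)"
    proof (rule inj_onI)
      fix X Y assume X: "X \<in> V // R" "Y \<in> V // R" "h ` X = h ` Y"
      then obtain u v where uv: "u \<in> V" "v \<in> V" "X = R `` {u}" "Y = R `` {v}"
        by (auto elim!: quotientE)
      then have "S `` {h u} = S `` {h v}"
        using X(3) img by simp
      then show "X = Y"
        using eqS[OF hW hW] eqR rel uv by metis
    qed
    show "(`) h ` (V // R) = W // S"
    proof (intro equalityI subsetI)
      fix X assume "X \<in> (`) h ` (V // R)"
      then obtain u where "u \<in> V" "X = h ` (R `` {u})" by (auto elim!: quotientE)
      then show "X \<in> W // S" using img hW by (auto intro!: quotientI)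
    next
      fix X assume "X \<in> W // S"
      then obtain w where w: "w \<in> W" "X = S `` {w}" by (auto elim!: quotientE)
      then obtain u where u: "u \<in> V" "w = h u" using h by auto
      have "X = h ` (R `` {u})"
        using img[OF u(1)] w(2) u(2) by simp
      then show "X \<in> (`) h ` (V // R)"
        using quotientI[OF u(1), of R] by blast
    qed
  qed
  then show ?thesis
    using bij_betw_same_card by metis
qed

text \<open>The effect of contracting \<open>Z\<close>: the map \<open>h\<close> on vertices collapses the components of \<open>Z\<close> and the
  remaining edges are carried over bijectively by \<open>\<epsilon>\<close>.\<close>

locale contraction_of =
  fixes G :: "('v, 'e) multigraph" and H :: "('w, 'f) multigraph"
    and Z :: "'e set" and h :: "'v \<Rightarrow> 'w" and \<epsilon> :: "'e \<Rightarrow> 'f"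
  assumes fG: "finite_multigraph G" and fH: "finite_multigraph H"
    and Z: "Z \<subseteq> edges G"
    and verts: "h ` verts G = verts H"
    and bij: "bij_betw \<epsilon> (edges G - Z) (edges H)"
    and ends: "\<And>e. e \<in> edges G - Z \<Longrightarrow> ends H (\<epsilon> e) = h ` ends G e"
    and fibres: "\<And>u v. u \<in> verts G \<Longrightarrow> v \<in> verts G \<Longrightarrow> h u = h v \<longleftrightarrow> (u, v) \<in> reach G Z"
begin

lemma reach_iff:
  assumes F: "Z \<subseteq> F" "F \<subseteq> edges G" and uv: "u \<in> verts G" "v \<in> verts G"
  shows "(h u, h v) \<in> reach H (\<epsilon> ` (F - Z)) \<longleftrightarrow> (u, v) \<in> reach G F"
proof
  assume "(u, v) \<in> reach G F"
  then have "v \<in> verts G \<and> (h u, h v) \<in> reach H (\<epsilon> ` (F - Z))"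
  proof (induction rule: reach_induct)
    case start
    show ?case using uv verts by (auto intro!: reach_refl)
  next
    case (step e a b)
    have e: "e \<in> edges G" using step(1) F by auto
    obtain a' b' where "a' \<in> verts G" "b' \<in> verts G" "ends G e = {a', b'}"
      using e by (rule finite_multigraph_ends[OF fG])
    then have ab: "a \<in> verts G" "b \<in> verts G"
      using step(2) by (auto simp: doubleton_eq_iff)
    show ?case
    proof (cases "e \<in> Z")
      case True
      then have "h a = h b"
        using fibres[OF ab] reach_edge[OF True step(2) ab] by simp
      then show ?thesis using step(3) ab by simp
    next
      case False
      then have "ends H (\<epsilon> e) = {h a, h b}" "\<epsilon> e \<in> \<epsilon> ` (F - Z)"
        using ends[of e] e step by auto
      then have "(h a, h b) \<in> reach H (\<epsilon> ` (F - Z))"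
        using ab verts by (intro reach_edge[of "\<epsilon> e"]) auto
      then show ?thesis
        using step(3) ab by (meson reach_trans)
    qed
  qed
  then show "(h u, h v) \<in> reach H (\<epsilon> ` (F - Z))" by simp
next
  assume "(h u, h v) \<in> reach H (\<epsilon> ` (F - Z))"
  then have "\<forall>x\<in>verts G. h x = h v \<longrightarrow> (u, x) \<in> reach G F"
  proof (induction rule: reach_induct)
    case start
    show ?case
      using fibres[OF uv(1)] reach_mono[OF F(1)] by metis
  next
    case (step f a b)
    then obtain e where e: "e \<in> F" "e \<notin> Z" "f = \<epsilon> e" by auto
    have eG: "e \<in> edges G" using e F by auto
    obtain x y where xy: "x \<in> verts G" "y \<in> verts G" "ends G e = {x, y}"
      using eG by (rule finite_multigraph_ends[OF fG])
    have "{h x, h y} = {a, b}"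
      using step(2) ends[of e] eG e xy by simp
    then obtain x' y' where xy': "x' \<in> verts G" "y' \<in> verts G" "ends G e = {x', y'}"
      "h x' = a" "h y' = b"
      using xy by (metis doubleton_eq_iff)
    have "(u, x') \<in> reach G F"
      using step(3) xy'(1,4) uv(1) by simp
    then have "(u, y') \<in> reach G F"
      using reach_edge[OF e(1) xy'(3,1,2)] by (rule reach_trans)
    moreover have "(y', x) \<in> reach G F" if "x \<in> verts G" "h x = b" for x
      using fibres[OF xy'(2) that(1)] reach_mono[OF F(1)] that xy'(5) by simp
    ultimately show ?case
      by (meson reach_trans)
  qed
  then show "(u, v) \<in> reach G F"
    using uv by simp
qed

lemma image_edges: "\<epsilon> ` (edges G - Z) = edges H"
  using bij by (simp add: bij_betw_def)

lemma connected_iff: "connected_multigraph H \<longleftrightarrow> connected_multigraph G"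
  using reach_iff[OF Z order_refl] unfolding image_edges
  unfolding connected_multigraph_def verts[symmetric] by simp

lemma card_components:
  assumes "Z \<subseteq> F" "F \<subseteq> edges G"
  shows "card (verts H // reach H (\<epsilon> ` (F - Z))) = card (verts G // reach G F)"
  by (rule card_quotient_image[OF verts equiv_reach equiv_reach reach_iff[OF assms]])

lemma forest_image_iff:
  assumes "forest G Z" "Z \<subseteq> F" "F \<subseteq> edges G"
  shows "forest H (\<epsilon> ` (F - Z)) \<longleftrightarrow> forest G F"
proof -
  have fin: "finite F"
    using assms(3) fG by (auto simp: finite_multigraph_def intro: finite_subset)
  have inj: "inj_on \<epsilon> (edges G - Z)" and img: "\<epsilon> ` (edges G - Z) = edges H"
    using bij by (auto simp: bij_betw_def)
  have sub: "\<epsilon> ` (F - Z) \<subseteq> edges H"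
    using assms(3) img by blast
  have "card (\<epsilon> ` (F - Z)) = card F - card Z"
    using assms fin inj_on_subset[OF inj, of "F - Z"]
    by (subst card_image) (auto simp: card_Diff_subset finite_subset)
  moreover have "card Z \<le> card F"
    using assms(2) fin by (rule card_mono[rotated])
  moreover have "card (verts G) = card (verts G // reach G Z) + card Z"
    using forest_iff_card_components[OF edges_within_multigraph[OF fG Z]] assms(1) by simp
  moreover have "card (verts G // reach G Z) = card (verts H)"
    using card_components[OF order_refl Z] by (simp add: quotient_reach_empty card_image)
  ultimately show ?thesis
    using forest_iff_card_components[OF edges_within_multigraph[OF fH sub]]
      forest_iff_card_components[OF edges_within_multigraph[OF fG assms(3)]]
      card_components[OF assms(2,3)] by linarith
qed

lemma card_verts:
  assumes "forest G Z"
  shows "card (verts H) + card Z = card (verts G)"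
  using forest_iff_card_components[OF edges_within_multigraph[OF fG Z]] assms
    card_components[OF order_refl Z] by (simp add: quotient_reach_empty card_image)

lemma card_edges: "card (edges H) + card Z = card (edges G)"
proof -
  have "finite (edges G)" using fG by (simp add: finite_multigraph_def)
  then show ?thesis
    using bij_betw_same_card[OF bij] Z card_mono[of "edges G" Z]
    by (simp add: card_Diff_subset finite_subset)
qed

lemma genus_eq: "forest G Z \<Longrightarrow> genus H = genus G"
  using card_verts card_edges unfolding genus_def by linarith

text \<open>Valency minus 2 is additive under contraction, because a component of the
  contracted forest has one edge fewer than vertices.\<close>

lemma valency_contraction:
  assumes "forest G Z" "w \<in> verts H"
  shows "int (valency H w) - 2 = (\<Sum>v | v \<in> verts G \<and> h v = w. int (valency G v) - 2)"
proof -
  let ?W = "{v \<in> verts G. h v = w}"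
  have fin: "finite (edges G)" "finite (verts G)" "finite (edges H)"
    using fG fH by (auto simp: finite_multigraph_def)
  obtain v0 where v0: "v0 \<in> verts G" "h v0 = w"
    using assms(2) unfolding verts[symmetric] by blast
  have W: "?W = reach G Z `` {v0}"
  proof (rule set_eqI)
    fix x show "x \<in> ?W \<longleftrightarrow> x \<in> reach G Z `` {v0}"
      using fibres[OF v0(1), of x] v0(2) reach_verts[of v0 x G Z] by auto
  qed
  have cW: "card {e \<in> Z. ends G e \<subseteq> ?W} + 1 = card ?W"
    unfolding W by (rule forest_component_card[OF edges_within_multigraph[OF fG Z] assms(1) v0(1)])
  have "(\<Sum>v\<in>?W. valency G v) = (\<Sum>e\<in>edges G. \<Sum>v\<in>?W. incidence G e v)"
    by (simp add: valency_incidence[OF fin(1)] sum.swap[of _ "edges G"])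
  also have "\<dots> = (\<Sum>e\<in>edges G - Z. \<Sum>v\<in>?W. incidence G e v) + (\<Sum>e\<in>Z. \<Sum>v\<in>?W. incidence G e v)"
    by (rule sum.subset_diff[OF Z fin(1)])
  also have "(\<Sum>e\<in>edges G - Z. \<Sum>v\<in>?W. incidence G e v) = (\<Sum>e\<in>edges G - Z. incidence H (\<epsilon> e) w)"
  proof (rule sum.cong)
    fix e assume e: "e \<in> edges G - Z"
    then obtain a b where ab: "a \<in> verts G" "b \<in> verts G" "ends G e = {a, b}"
      using finite_multigraph_ends[OF fG, of e] by blast
    then show "(\<Sum>v\<in>?W. incidence G e v) = incidence H (\<epsilon> e) w"
      using ends[OF e] fin(2) by (auto simp: sum_incidence[of ?W G e a b] incidence_ends[of H "\<epsilon> e" "h a" "h b"])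
  qed simp
  also have "\<dots> = valency H w"
    unfolding valency_incidence[OF fin(3)] by (rule sum.reindex_bij_betw[OF bij])
  also have "(\<Sum>e\<in>Z. \<Sum>v\<in>?W. incidence G e v) = (\<Sum>e\<in>Z. if ends G e \<subseteq> ?W then 2 else 0)"
  proof (rule sum.cong)
    fix e assume e: "e \<in> Z"
    then have "e \<in> edges G" using Z by auto
    then obtain a b where ab: "a \<in> verts G" "b \<in> verts G" "ends G e = {a, b}"
      by (rule finite_multigraph_ends[OF fG])
    have "h a = h b"
      using fibres ab reach_edge[OF e ab(3,1,2)] by simp
    then show "(\<Sum>v\<in>?W. incidence G e v) = (if ends G e \<subseteq> ?W then 2 else 0)"
      using ab fin(2) by (auto simp: sum_incidence[of ?W G e a b])
  qed simp
  also have "\<dots> = 2 * card {e \<in> Z. ends G e \<subseteq> ?W}"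
    using finite_subset[OF Z fin(1)] by (simp add: sum.If_cases Int_def)
  finally have "int (\<Sum>v\<in>?W. valency G v) = int (valency H w) + 2 * int (card ?W) - 2"
    using cW by linarith
  then show ?thesis
    by (simp add: sum_subtractf)
qed

lemma combinatorial_type:
  assumes "combinatorial_type g n G p" "forest G Z"
  shows "combinatorial_type g n H (\<lambda>i\<in>{1..n}. h (p i))"
proof -
  have p: "p \<in> {1..n} \<rightarrow>\<^sub>E verts G"
    and st: "\<And>v. v \<in> verts G \<Longrightarrow> valency G v + card {i \<in> {1..n}. p i = v} \<ge> 3"
    using assms(1) by (auto simp: combinatorial_type_def)
  have fin: "finite (verts G)"
    using fG by (simp add: finite_multigraph_def)
  have "valency H w + card {i \<in> {1..n}. h (p i) = w} \<ge> 3" if w: "w \<in> verts H" for w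
  proof -
    let ?W = "{v \<in> verts G. h v = w}"
    obtain v0 where v0: "v0 \<in> ?W"
      using w unfolding verts[symmetric] by blast
    have "card {i \<in> {1..n}. h (p i) = w} = card (\<Union>v\<in>?W. {i \<in> {1..n}. p i = v})"
      using p by (intro arg_cong[of _ _ card]) auto
    also have "\<dots> = (\<Sum>v\<in>?W. card {i \<in> {1..n}. p i = v})"
      using fin by (intro card_UN_disjoint) auto
    finally have eq: "int (valency H w) - 2 + int (card {i \<in> {1..n}. h (p i) = w}) =
        (\<Sum>v\<in>?W. int (valency G v) - 2 + int (card {i \<in> {1..n}. p i = v}))"
      using valency_contraction[OF assms(2) w] by (simp add: sum.distrib)
    have "card ?W > 0"
      using v0 fin by (subst card_gt_0_iff) auto
    then have "1 \<le> (\<Sum>v\<in>?W. 1::int)"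
      by simp
    also have "\<dots> \<le> (\<Sum>v\<in>?W. int (valency G v) - 2 + int (card {i \<in> {1..n}. p i = v}))"
    proof (rule sum_mono)
      fix v assume "v \<in> ?W"
      then show "1 \<le> int (valency G v) - 2 + int (card {i \<in> {1..n}. p i = v})"
        using st[of v] by simp
    qed
    also note eq[symmetric]
    finally show ?thesis by linarith
  qed
  moreover have "(\<lambda>i\<in>{1..n}. h (p i)) \<in> {1..n} \<rightarrow>\<^sub>E verts H"
    using p verts by (auto simp: PiE_iff)
  moreover have "{i \<in> {1..n}. (\<lambda>i\<in>{1..n}. h (p i)) i = w} = {i \<in> {1..n}. h (p i) = w}" for w
    by auto
  ultimately show ?thesis
    using assms fH connected_iff genus_eq unfolding combinatorial_type_def by simp
qed

end

section \<open>Curves with edges of length zero\<close>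

text \<open>The points of the parameter space of the moduli space, with the condition on the edges of
  length zero in terms of forests.\<close>

definition degenerate_curve :: "nat \<Rightarrow> nat \<Rightarrow> ('v, 'e) curve \<Rightarrow> bool" where
  "degenerate_curve g n = (\<lambda>(G, l, p). combinatorial_type g n G p \<and>
     l \<in> edges G \<rightarrow>\<^sub>E {0..} \<and> forest G (zero_edges G l))"

text \<open>The relation between a degenerate curve and a curve isomorphic to its contraction, without reference
  to the quotient construction.\<close>

definition contraction_map ::
    "nat \<Rightarrow> ('v, 'e) curve \<Rightarrow> ('w, 'f) curve \<Rightarrow> ('v \<Rightarrow> 'w) \<Rightarrow> ('e \<Rightarrow> 'f) \<Rightarrow> bool" where
  "contraction_map n = (\<lambda>(G, l, p) (H, m, q) h \<epsilon>.
     h ` verts G = verts H \<and> (\<forall>i\<in>{1..n}. q i = h (p i)) \<and>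
     (\<forall>e\<in>zero_edges G l. \<forall>u v. ends G e = {u, v} \<longrightarrow> h u = h v) \<and>
     bij_betw \<epsilon> (edges G - zero_edges G l) (edges H) \<and>
     (\<forall>e\<in>edges G - zero_edges G l. ends H (\<epsilon> e) = h ` ends G e \<and> m (\<epsilon> e) = l e))"

lemma degenerate_curve_iff_cell:
  "degenerate_curve g n (G, l, p) \<longleftrightarrow> combinatorial_type g n G p \<and> l \<in> topspace (cell G)"
proof -
  have "forest G (zero_edges G l) \<longleftrightarrow> \<not> contains_cycle G (zero_edges G l)" if "finite_multigraph G"
    using contains_cycle_iff_not_forest[OF that, of "zero_edges G l"] by (auto simp: zero_edges_def)
  then show ?thesis
    unfolding degenerate_curve_def cell_def combinatorial_type_def
    by (auto simp: PiE_iff)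
qed

lemma tropical_imp_degenerate:
  assumes "tropical_curve g n (G, l, p)"
  shows "degenerate_curve g n (G, l, p)" "zero_edges G l = {}"
proof -
  show "zero_edges G l = {}"
    using assms by (fastforce simp: tropical_curve_def zero_edges_def PiE_iff)
  then show "degenerate_curve g n (G, l, p)"
    using assms by (auto simp: tropical_curve_def degenerate_curve_def forest_def PiE_iff less_imp_le)
qed

text \<open>The fibres of \<open>h\<close> are unions of components of the edges of length zero. If some fibre were the union
  of several components, then the target would have too few vertices, hence too large a genus.\<close>

lemma contraction_map_contraction_of:
  assumes C: "degenerate_curve g n (G, l, p)" and D: "combinatorial_type g n H q"
    and h: "contraction_map n (G, l, p) (H, m, q) h \<epsilon>"
  shows "contraction_of G H (zero_edges G l) h \<epsilon>"
proof -
  let ?Z = "zero_edges G l"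
  have Z: "?Z \<subseteq> edges G" by (auto simp: zero_edges_def)
  have fG: "finite_multigraph G" and fH: "finite_multigraph H" and gen: "genus G = genus H"
    and forest: "forest G ?Z"
    using C D by (auto simp: degenerate_curve_def combinatorial_type_def)
  have hv: "h ` verts G = verts H" and const: "\<And>e u v. e \<in> ?Z \<Longrightarrow> ends G e = {u, v} \<Longrightarrow> h u = h v"
    and bij: "bij_betw \<epsilon> (edges G - ?Z) (edges H)"
    and en: "\<And>e. e \<in> edges G - ?Z \<Longrightarrow> ends H (\<epsilon> e) = h ` ends G e"
    using h by (auto simp: contraction_map_def)
  have r: "h u = h v" if "(u, v) \<in> reach G ?Z" for u v
    using that
  proof (induction rule: reach_induct)
    case (step e a b)
    then show ?case using const[OF step(1,2)] by simp
  qed simp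
  define k where "k X = h (SOME v. v \<in> X)" for X
  have k: "k (reach G ?Z `` {u}) = h u" if "u \<in> verts G" for u
  proof -
    have "(SOME v. v \<in> reach G ?Z `` {u}) \<in> reach G ?Z `` {u}"
      using reach_refl[OF that, of ?Z] by (intro someI_ex[of "\<lambda>v. v \<in> reach G ?Z `` {u}"]) blast
    then show ?thesis
      using r[of u] by (simp add: k_def)
  qed
  let ?Q = "verts G // reach G ?Z"
  have img: "k ` ?Q = verts H"
    using k hv by (force simp: quotient_def image_iff)
  have finE: "finite (edges G)" "finite (verts G)" using fG by (auto simp: finite_multigraph_def)
  have "card (edges H) + card ?Z = card (edges G)"
    using bij_betw_same_card[OF bij] finE Z card_mono[of "edges G" ?Z]
    by (simp add: card_Diff_subset finite_subset)
  moreover have "card (verts G) = card ?Q + card ?Z"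
    using forest_iff_card_components[OF edges_within_multigraph[OF fG Z]] forest by simp
  ultimately have "card (k ` ?Q) = card ?Q"
    using gen unfolding img genus_def by linarith
  moreover have "finite ?Q"
    using finE by (intro finite_quotient) (auto simp: reach_def)
  ultimately have inj: "inj_on k ?Q"
    by (simp add: eq_card_imp_inj_on)
  show ?thesis
  proof
    fix u v assume uv: "u \<in> verts G" "v \<in> verts G"
    show "h u = h v \<longleftrightarrow> (u, v) \<in> reach G ?Z"
    proof
      assume "h u = h v"
      then have "reach G ?Z `` {u} = reach G ?Z `` {v}"
        using uv k by (intro inj_onD[OF inj]) (auto simp: quotient_def)
      then show "(u, v) \<in> reach G ?Z"
        using eq_equiv_class_iff[OF equiv_reach uv] by simp
    qed (rule r)
  qed (use fG fH Z hv bij en in auto)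
qed

lemma contraction_of_contract:
  assumes C: "degenerate_curve g n (G, l, p)" and H: "contract n (G, l, p) = (H, m, q)"
  defines "h \<equiv> \<lambda>v. reach G (zero_edges G l) `` {v}"
  shows "contraction_of G H (zero_edges G l) h id"
    and "contraction_map n (G, l, p) (H, m, q) h id"
    and "tropical_curve g n (H, m, q)"
proof -
  let ?Z = "zero_edges G l"
  have Z: "?Z \<subseteq> edges G" by (auto simp: zero_edges_def)
  have fG: "finite_multigraph G" and ct: "combinatorial_type g n G p" and forest: "forest G ?Z"
    and l: "l \<in> edges G \<rightarrow>\<^sub>E {0..}"
    using C by (auto simp: degenerate_curve_def combinatorial_type_def)
  have p: "p i \<in> verts G" if "i \<in> {1..n}" for i
    using ct that by (auto simp: combinatorial_type_def)
  have Hd: "H = \<lparr>verts = verts G // reach G ?Z, edges = edges G - ?Z,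
      ends = (\<lambda>e\<in>edges G - ?Z. h ` ends G e)\<rparr>" "m = restrict l (edges G - ?Z)"
    "q = (\<lambda>i\<in>{1..n}. h (p i))"
    using H by (auto simp: contract_def Let_def h_def)
  have hv: "h ` verts G = verts H"
    by (auto simp: Hd h_def quotient_def)
  have fH: "finite_multigraph H"
    unfolding finite_multigraph_def
  proof (intro conjI)
    show "finite (verts H)" "finite (edges H)"
      using fG unfolding hv[symmetric] by (auto simp: finite_multigraph_def Hd)
    have "h ` ends G e \<subseteq> verts H \<and> (card (h ` ends G e) = 1 \<or> card (h ` ends G e) = 2)"
      if e: "e \<in> edges G" for e
    proof -
      obtain a b where ab: "a \<in> verts G" "b \<in> verts G" "ends G e = {a, b}"
        using e by (rule finite_multigraph_ends[OF fG])
      then show ?thesis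
        using hv by (cases "h a = h b") auto
    qed
    then show "ends H \<in> edges H \<rightarrow>\<^sub>E {s. s \<subseteq> verts H \<and> (card s = 1 \<or> card s = 2)}"
      by (auto simp: Hd(1))
  qed
  show con: "contraction_of G H ?Z h id"
  proof
    show "h u = h v \<longleftrightarrow> (u, v) \<in> reach G ?Z" if "u \<in> verts G" "v \<in> verts G" for u v
      unfolding h_def by (rule eq_equiv_class_iff[OF equiv_reach that])
  qed (use fG fH Z hv in \<open>auto simp: Hd(1)\<close>)
  have "h u = h v" if e: "e \<in> ?Z" "ends G e = {u, v}" for e u v
  proof -
    have "e \<in> edges G" using e(1) Z by auto
    then obtain a b where ab: "a \<in> verts G" "b \<in> verts G" "ends G e = {a, b}"
      by (rule finite_multigraph_ends[OF fG])
    then have "u \<in> verts G" "v \<in> verts G"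
      using e(2) by (auto simp: doubleton_eq_iff)
    then show ?thesis
      using contraction_of.fibres[OF con] reach_edge[OF e] by simp
  qed
  then show "contraction_map n (G, l, p) (H, m, q) h id"
    unfolding contraction_map_def using hv by (auto simp: Hd)
  have "combinatorial_type g n H q"
    using contraction_of.combinatorial_type[OF con ct forest] by (simp add: Hd(3))
  moreover have "m \<in> edges H \<rightarrow>\<^sub>E {0<..}"
    using l by (force simp: Hd zero_edges_def PiE_iff)
  ultimately show "tropical_curve g n (H, m, q)"
    by (simp add: tropical_curve_def)
qed

lemma curve_iso_iff_contraction_map:
  assumes "tropical_curve g n (G, l, p)" "tropical_curve g n (H, m, q)"
  shows "curve_iso n (G, l, p) (H, m, q) \<longleftrightarrow> (\<exists>h \<epsilon>. contraction_map n (G, l, p) (H, m, q) h \<epsilon>)"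
proof -
  note Z0 = tropical_imp_degenerate(2)[OF assms(1)]
  show ?thesis
  proof
    assume "\<exists>h \<epsilon>. contraction_map n (G, l, p) (H, m, q) h \<epsilon>"
    then obtain h \<epsilon> where h: "contraction_map n (G, l, p) (H, m, q) h \<epsilon>"
      by auto
    interpret contraction_of G H "{}" h \<epsilon>
      using contraction_map_contraction_of[OF tropical_imp_degenerate(1)[OF assms(1)] _ h] assms(2) Z0
      by (simp add: tropical_curve_def)
    have "inj_on h (verts G)"
      using fibres by (auto simp: inj_on_def reach_def adj_def)
    then show "curve_iso n (G, l, p) (H, m, q)"
      using h Z0 unfolding curve_iso_def contraction_map_def
      by (auto simp: bij_betw_def intro!: exI[of _ h] exI[of _ \<epsilon>])
  next
    assume "curve_iso n (G, l, p) (H, m, q)"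
    then show "\<exists>h \<epsilon>. contraction_map n (G, l, p) (H, m, q) h \<epsilon>"
      unfolding curve_iso_def contraction_map_def using Z0 by (fastforce simp: bij_betw_def)
  qed
qed

text \<open>Both \<open>h\<close> and \<open>k\<close> identify exactly the vertices that are joined by edges of length zero, so \<open>k\<close>
  descends along \<open>h\<close>. Hence a degenerate curve has only one contraction up to isomorphism.\<close>

lemma contraction_map_factor:
  assumes C: "degenerate_curve g n (G, l, p)" and D: "combinatorial_type g n H q" "combinatorial_type g n K r"
    and h: "contraction_map n (G, l, p) (H, m, q) h \<epsilon>"
    and k: "contraction_map n (G, l, p) (K, s, r) k \<delta>"
    and m: "zero_edges H m = {}"
  shows "\<exists>k' \<delta>'. contraction_map n (H, m, q) (K, s, r) k' \<delta>'"
proof -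
  let ?Z = "zero_edges G l"
  interpret h: contraction_of G H ?Z h \<epsilon>
    by (rule contraction_map_contraction_of[OF C D(1) h])
  interpret k: contraction_of G K ?Z k \<delta>
    by (rule contraction_map_contraction_of[OF C D(2) k])
  define k' where "k' w = k (SOME v. v \<in> verts G \<and> h v = w)" for w
  have k': "k' (h v) = k v" if "v \<in> verts G" for v
  proof -
    have "(SOME x. x \<in> verts G \<and> h x = h v) \<in> verts G \<and> h (SOME x. x \<in> verts G \<and> h x = h v) = h v"
      by (rule someI[of _ v]) (use that in auto)
    then show ?thesis
      using h.fibres k.fibres that unfolding k'_def by metis
  qed
  let ?d = "\<delta> \<circ> the_inv_into (edges G - ?Z) \<epsilon>"
  have inj: "inj_on \<epsilon> (edges G - ?Z)"
    using h.bij by (simp add: bij_betw_def)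
  have "contraction_map n (H, m, q) (K, s, r) k' ?d"
    unfolding contraction_map_def prod.case m
  proof (intro conjI ballI)
    show "k' ` verts H = verts K"
      unfolding h.verts[symmetric] k.verts[symmetric] using k' by (force simp: image_iff)
    fix i assume "i \<in> {1..n}"
    moreover then have "p i \<in> verts G"
      using C by (auto simp: degenerate_curve_def combinatorial_type_def)
    ultimately show "r i = k' (q i)"
      using h k k' by (simp add: contraction_map_def)
  next
    show "bij_betw ?d (edges H - {}) (edges K)"
      using bij_betw_trans[OF bij_betw_the_inv_into[OF h.bij] k.bij] by simp
    fix f assume "f \<in> edges H - {}"
    then obtain e where e: "e \<in> edges G - ?Z" "f = \<epsilon> e"
      using h.image_edges by auto
    have d: "?d f = \<delta> e"
      using e inj by (simp add: the_inv_into_f_f)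
    obtain a b where ab: "a \<in> verts G" "b \<in> verts G" "ends G e = {a, b}"
      using e finite_multigraph_ends[OF h.fG, of e] by blast
    show "ends K (?d f) = k' ` ends H f"
      unfolding d using e h.ends[OF e(1)] k.ends[OF e(1)] ab k' by simp
    show "s (?d f) = m f"
      unfolding d using e h k by (auto simp: contraction_map_def)
  qed auto
  then show ?thesis by blast
qed

lemma contraction_map_compose_iso:
  assumes h: "contraction_map n (G, l, p) (H, m, q) h \<epsilon>"
    and k: "contraction_map n (H, m, q) (K, s, r) k \<delta>" and m: "zero_edges H m = {}"
  shows "contraction_map n (G, l, p) (K, s, r) (k \<circ> h) (\<delta> \<circ> \<epsilon>)"
  unfolding contraction_map_def prod.case
proof (intro conjI ballI allI impI)
  show "(k \<circ> h) ` verts G = verts K"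
    using h k unfolding contraction_map_def prod.case by (metis image_comp)
  show "r i = (k \<circ> h) (p i)" if "i \<in> {1..n}" for i
    using h k that by (simp add: contraction_map_def)
  show "(k \<circ> h) u = (k \<circ> h) v" if "e \<in> zero_edges G l" "ends G e = {u, v}" for e u v
  proof -
    have "h u = h v"
      using h that unfolding contraction_map_def prod.case by blast
    then show ?thesis by simp
  qed
  show "bij_betw (\<delta> \<circ> \<epsilon>) (edges G - zero_edges G l) (edges K)"
    using h k m by (auto simp: contraction_map_def intro: bij_betw_trans)
  fix e assume e: "e \<in> edges G - zero_edges G l"
  then have "\<epsilon> e \<in> edges H - zero_edges H m"
    using h m by (auto simp: contraction_map_def bij_betw_def)
  then have k': "ends K (\<delta> (\<epsilon> e)) = k ` ends H (\<epsilon> e)" "s (\<delta> (\<epsilon> e)) = m (\<epsilon> e)"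
    using k unfolding contraction_map_def prod.case by blast+
  have "ends H (\<epsilon> e) = h ` ends G e" "m (\<epsilon> e) = l e"
    using h e unfolding contraction_map_def prod.case by blast+
  then show "ends K ((\<delta> \<circ> \<epsilon>) e) = (k \<circ> h) ` ends G e" "s ((\<delta> \<circ> \<epsilon>) e) = l e"
    using k' by (simp_all add: image_comp)
qed

text \<open>Everything about the moduli space is derived from this description of its points: the class of a
  degenerate curve consists of the tropical curves onto which it maps by a contraction map.\<close>

lemma mem_TM_map:
  assumes C: "degenerate_curve g n (G, l, p)"
  shows "D \<in> TM_map g n ((G, p), l) \<longleftrightarrow>
    tropical_curve g n D \<and> (\<exists>h \<epsilon>. contraction_map n (G, l, p) D h \<epsilon>)"
proof -
  obtain K s r where K: "contract n (G, l, p) = (K, s, r)"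
    by (cases "contract n (G, l, p)") auto
  note con = contraction_of_contract[OF C K]
  obtain H m q where D: "D = (H, m, q)"
    by (cases D) auto
  have "curve_iso n (K, s, r) (H, m, q) \<longleftrightarrow> (\<exists>h \<epsilon>. contraction_map n (G, l, p) (H, m, q) h \<epsilon>)"
    if t: "tropical_curve g n (H, m, q)"
  proof -
    have ct: "combinatorial_type g n K r" "combinatorial_type g n H q" "combinatorial_type g n G p"
      using t con(3) C by (auto simp: tropical_curve_def degenerate_curve_def)
    note z = tropical_imp_degenerate(2)[OF con(3)]
    show ?thesis
      unfolding curve_iso_iff_contraction_map[OF con(3) t]
      using contraction_map_factor[OF C ct(1,2) con(2) _ z]
        contraction_map_compose_iso[OF con(2) _ z] by blast
  qed
  then show ?thesis
    by (auto simp: TM_map_def curve_class_def K D)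
qed

text \<open>Contracted graphs have sets of vertices as vertices, whereas the classes consist of curves whose
  vertices are natural numbers; so a copy of the curve is needed to see that classes are inhabited.\<close>

lemma curve_iso_nat_representative:
  fixes G :: "('v, 'e) multigraph"
  assumes t: "tropical_curve g n (G, l, p)"
  shows "\<exists>D :: (nat, nat) curve. tropical_curve g n D \<and> (\<exists>h \<epsilon>. contraction_map n (G, l, p) D h \<epsilon>)"
proof -
  have fG: "finite_multigraph G" and ct: "combinatorial_type g n G p" and l: "l \<in> edges G \<rightarrow>\<^sub>E {0<..}"
    using t by (auto simp: tropical_curve_def combinatorial_type_def)
  have p: "p i \<in> verts G" if "i \<in> {1..n}" for i
    using ct that by (auto simp: combinatorial_type_def)
  have fin: "finite (edges G)" "finite (verts G)" using fG by (auto simp: finite_multigraph_def)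
  obtain f :: "'v \<Rightarrow> nat" where f: "inj_on f (verts G)"
    using finite_imp_inj_to_nat_seg[OF fin(2)] by auto
  obtain k :: "'e \<Rightarrow> nat" where k: "inj_on k (edges G)"
    using finite_imp_inj_to_nat_seg[OF fin(1)] by auto
  define k' where "k' = the_inv_into (edges G) k"
  have k': "k' (k e) = e" if "e \<in> edges G" for e
    using that k by (simp add: k'_def the_inv_into_f_f)
  define H where "H = \<lparr>verts = f ` verts G, edges = k ` edges G,
    ends = (\<lambda>e\<in>k ` edges G. f ` ends G (k' e))\<rparr>"
  define m where "m = (\<lambda>e\<in>k ` edges G. l (k' e))"
  have eH: "ends H (k e) = f ` ends G e" if "e \<in> edges G" for e
    using that k' by (simp add: H_def)
  have fH: "finite_multigraph H"
    unfolding finite_multigraph_def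
  proof (intro conjI)
    show "finite (verts H)" "finite (edges H)"
      using fin by (auto simp: H_def)
    have cd: "f ` ends G e \<subseteq> verts H \<and> (card (f ` ends G e) = 1 \<or> card (f ` ends G e) = 2)"
      if e: "e \<in> edges G" for e
    proof -
      obtain a b where ab: "a \<in> verts G" "b \<in> verts G" "ends G e = {a, b}"
        using e by (rule finite_multigraph_ends[OF fG])
      then show ?thesis
        by (cases "f a = f b") (auto simp: H_def)
    qed
    show "ends H \<in> edges H \<rightarrow>\<^sub>E {s. s \<subseteq> verts H \<and> (card s = 1 \<or> card s = 2)}"
    proof (rule PiE_I)
      fix x assume "x \<in> edges H"
      then obtain e where e: "e \<in> edges G" "x = k e"
        by (auto simp: H_def)
      then show "ends H x \<in> {s. s \<subseteq> verts H \<and> (card s = 1 \<or> card s = 2)}"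
        using cd[OF e(1)] eH[OF e(1)] by simp
    qed (simp add: H_def)
  qed
  have con: "contraction_of G H {} f k"
  proof
    show "f u = f v \<longleftrightarrow> (u, v) \<in> reach G {}" if "u \<in> verts G" "v \<in> verts G" for u v
      using that f by (auto simp: reach_def adj_def inj_on_eq_iff)
    show "bij_betw k (edges G - {}) (edges H)"
      using k by (auto simp: bij_betw_def H_def)
  qed (use fG fH eH in \<open>auto simp: H_def\<close>)
  have "combinatorial_type g n H (\<lambda>i\<in>{1..n}. f (p i))"
    by (rule contraction_of.combinatorial_type[OF con ct]) (simp add: forest_def)
  moreover have "m \<in> edges H \<rightarrow>\<^sub>E {0<..}"
    using l k' by (auto simp: m_def H_def PiE_iff)
  moreover have "contraction_map n (G, l, p) (H, m, \<lambda>i\<in>{1..n}. f (p i)) f k"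
    unfolding contraction_map_def using tropical_imp_degenerate(2)[OF t] k eH k'
    by (auto simp: H_def m_def bij_betw_def)
  ultimately show ?thesis
    unfolding tropical_curve_def by blast
qed

lemma TM_map_nonempty:
  assumes C: "degenerate_curve g n (G, l, p)"
  shows "\<exists>D. D \<in> TM_map g n ((G, p), l)"
proof -
  obtain K s r where K: "contract n (G, l, p) = (K, s, r)"
    by (cases "contract n (G, l, p)") auto
  note con = contraction_of_contract[OF C K]
  obtain D :: "(nat, nat) curve" and h \<epsilon>
    where D: "tropical_curve g n D" "contraction_map n (K, s, r) D h \<epsilon>"
    using curve_iso_nat_representative[OF con(3)] by blast
  obtain H m q where [simp]: "D = (H, m, q)"
    by (cases D) auto
  from contraction_map_compose_iso[OF con(2) D(2)[simplified] tropical_imp_degenerate(2)[OF con(3)]]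
  show ?thesis
    using D(1) mem_TM_map[OF C, of D] by auto
qed

lemma contraction_map_refl:
  "zero_edges G l = {} \<Longrightarrow> contraction_map n (G, l, p) (G, l, p) id id"
  by (simp add: contraction_map_def)

text \<open>The classes are isomorphism classes, so two of them that share a member coincide.\<close>

lemma TM_map_eqI:
  assumes C: "degenerate_curve g n (G, l, p)" and C': "degenerate_curve g n (G', l', p')"
    and D: "D \<in> TM_map g n ((G, p), l)" "D \<in> TM_map g n ((G', p'), l')"
  shows "TM_map g n ((G, p), l) = TM_map g n ((G', p'), l')"
proof -
  have *: "E \<in> TM_map g n ((G, p), l) \<longleftrightarrow> E \<in> TM_map g n ((H, q), m)"
    if C: "degenerate_curve g n (G, l, p)" and D: "(H, m, q) \<in> TM_map g n ((G, p), l)" for G l p H m q E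
  proof -
    obtain K s r where E: "E = (K, s, r)"
      by (cases E) auto
    obtain h \<epsilon> where t: "tropical_curve g n (H, m, q)" and h: "contraction_map n (G, l, p) (H, m, q) h \<epsilon>"
      using D mem_TM_map[OF C] by auto
    note d = tropical_imp_degenerate[OF t]
    have ct: "combinatorial_type g n H q" "combinatorial_type g n G p"
      using t C by (auto simp: tropical_curve_def degenerate_curve_def)
    have "(\<exists>h \<epsilon>. contraction_map n (G, l, p) E h \<epsilon>) \<longleftrightarrow> (\<exists>h \<epsilon>. contraction_map n (H, m, q) E h \<epsilon>)"
      if "combinatorial_type g n K r"
      using contraction_map_factor[OF C ct(1) that h _ d(2)] contraction_map_compose_iso[OF h _ d(2)]
      unfolding E by blast
    then show ?thesis
      unfolding mem_TM_map[OF C] mem_TM_map[OF d(1)] by (auto simp: tropical_curve_def E)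
  qed
  obtain H m q where [simp]: "D = (H, m, q)"
    by (cases D) auto
  show ?thesis
    using *[OF C D(1)[simplified]] *[OF C' D(2)[simplified]] by blast
qed

lemma mem_TM_map_self:
  assumes "tropical_curve g n (G, l, p)"
  shows "(G, l, p) \<in> TM_map g n ((G, p), l)"
  using assms contraction_map_refl[OF tropical_imp_degenerate(2)[OF assms]]
  by (subst mem_TM_map[OF tropical_imp_degenerate(1)[OF assms]]) blast

lemma TM_points_eq:
  "TM_points g n = {TM_map g n ((G, p), l) | G p l. degenerate_curve g n (G, l, p)}"
proof -
  have cls: "curve_class g n (G, l, p) = TM_map g n ((G, p), l)" if t: "tropical_curve g n (G, l, p)"
    for G :: "(nat, nat) multigraph" and l p
  proof -
    note d = tropical_imp_degenerate(1)[OF t]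
    have "curve_iso n (G, l, p) D \<longleftrightarrow> (\<exists>h \<epsilon>. contraction_map n (G, l, p) D h \<epsilon>)"
      if "tropical_curve g n D" for D :: "(nat, nat) curve"
      using curve_iso_iff_contraction_map[OF t, of "fst D" "fst (snd D)" "snd (snd D)"] that by simp
    then show ?thesis
      using mem_TM_map[OF d] unfolding curve_class_def by blast
  qed
  show ?thesis
  proof (intro equalityI subsetI)
    fix x assume "x \<in> TM_points g n"
    then obtain C :: "(nat, nat) curve" where "x = curve_class g n C" "tropical_curve g n C"
      unfolding TM_points_def by blast
    then obtain G :: "(nat, nat) multigraph" and l p where "x = curve_class g n (G, l, p)" "tropical_curve g n (G, l, p)"
      by (cases C) blast
    then show "x \<in> {TM_map g n ((G, p), l) | G p l. degenerate_curve g n (G, l, p)}"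
      using cls tropical_imp_degenerate(1) by blast
  next
    fix x assume "x \<in> {TM_map g n ((G, p), l) | G p l. degenerate_curve g n (G, l, p)}"
    then obtain G p l where x: "x = TM_map g n ((G, p), l)" "degenerate_curve g n (G, l, p)"
      by blast
    obtain H m q where D: "(H, m, q) \<in> x"
      using TM_map_nonempty[OF x(2)] x(1) by auto
    then have t: "tropical_curve g n (H, m, q)"
      using mem_TM_map[OF x(2)] x(1) by blast
    have "x = TM_map g n ((H, q), m)"
      using TM_map_eqI[OF x(2) tropical_imp_degenerate(1)[OF t]] D mem_TM_map_self[OF t] x(1) by blast
    then show "x \<in> TM_points g n"
      using cls[OF t] t by (auto simp: TM_points_def)
  qed
qed

section \<open>Final topologies and homotopies\<close>

definition final_topology :: "'a topology \<Rightarrow> ('a \<Rightarrow> 'b) \<Rightarrow> 'b topology" where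
  "final_topology X f = topology (\<lambda>U. U \<subseteq> f ` topspace X \<and> openin X {x \<in> topspace X. f x \<in> U})"

lemma openin_final_topology:
  "openin (final_topology X f) U \<longleftrightarrow> U \<subseteq> f ` topspace X \<and> openin X {x \<in> topspace X. f x \<in> U}"
proof -
  have "istopology (\<lambda>U. U \<subseteq> f ` topspace X \<and> openin X {x \<in> topspace X. f x \<in> U})"
    unfolding istopology_def
  proof (intro conjI allI impI; (elim conjE)?)
    fix S T
    assume "openin X {x \<in> topspace X. f x \<in> S}" "openin X {x \<in> topspace X. f x \<in> T}"
    then have "openin X ({x \<in> topspace X. f x \<in> S} \<inter> {x \<in> topspace X. f x \<in> T})"
      by (rule openin_Int)
    then show "openin X {x \<in> topspace X. f x \<in> S \<inter> T}"
      by (rule back_subst[of "openin X"]) auto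
  next
    fix K assume K: "\<forall>U\<in>K. U \<subseteq> f ` topspace X \<and> openin X {x \<in> topspace X. f x \<in> U}"
    then have "openin X (\<Union>U\<in>K. {x \<in> topspace X. f x \<in> U})"
      by auto
    then show "openin X {x \<in> topspace X. f x \<in> \<Union>K}"
      by (rule back_subst[of "openin X"]) auto
    from K show "\<Union>K \<subseteq> f ` topspace X" by auto
  qed auto
  then show ?thesis
    by (simp add: final_topology_def)
qed

lemma topspace_final_topology: "topspace (final_topology X f) = f ` topspace X"
proof -
  have "openin (final_topology X f) (f ` topspace X)"
  proof -
    have "{x \<in> topspace X. f x \<in> f ` topspace X} = topspace X" by auto
    then show ?thesis
      unfolding openin_final_topology by simp
  qed
  then show ?thesis
    using openin_subset openin_final_topology[of X f "topspace (final_topology X f)"]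
    by (intro equalityI) auto
qed

lemma quotient_map_final_topology: "quotient_map X (final_topology X f) f"
  unfolding quotient_map_def by (auto simp: topspace_final_topology openin_final_topology)

lemma continuous_map_from_final_topology:
  assumes "continuous_map X Y (g \<circ> f)"
  shows "continuous_map (final_topology X f) Y g"
  using continuous_compose_quotient_map[OF quotient_map_final_topology assms] .

text \<open>The unit interval is locally compact, hence the product of a quotient map with its identity is again
  a quotient map. Therefore homotopies can be defined before passing to the quotient.\<close>

lemma continuous_map_prod_from_final_topology:
  assumes "continuous_map (prod_topology (top_of_set {0..1::real}) X) Y (\<lambda>(t, x). g (t, f x))"
  shows "continuous_map (prod_topology (top_of_set {0..1}) (final_topology X f)) Y g"
proof (rule continuous_compose_quotient_map[OF quotient_map_prod_right[OF _ _ quotient_map_final_topology[of X f]]])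
  show "locally_compact_space (top_of_set {0..1::real})"
    using compact_imp_locally_compact_space[of "top_of_set {0..1::real}"] by (simp add: compact_space_subtopology)
  show "Hausdorff_space (top_of_set {0..1::real}) \<or> regular_space (top_of_set {0..1::real})"
    by (simp add: Hausdorff_space_subtopology)
  show "continuous_map (prod_topology (top_of_set {0..1}) X) Y (g \<circ> (\<lambda>(t, x). (t, f x)))"
    using assms by (rule back_subst[of "continuous_map _ _"]) auto
qed

text \<open>The library notion of homotopy prescribes the end maps at all points of the type, also outside the
  space; this version prescribes them on the space only.\<close>

lemma homotopic_with_topspaceI:
  assumes H: "continuous_map (prod_topology (top_of_set {0..1::real}) X) Y H"
    and "\<And>x. x \<in> topspace X \<Longrightarrow> H (0, x) = f x" "\<And>x. x \<in> topspace X \<Longrightarrow> H (1, x) = g x"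
  shows "homotopic_with (\<lambda>_. True) X Y f g"
  unfolding homotopic_with_def
proof (intro exI conjI ballI allI TrueI)
  let ?H = "\<lambda>(t, x). if x \<in> topspace X then H (t, x) else if t = 0 then f x else g x"
  show "continuous_map (prod_topology (top_of_set {0..1}) X) Y ?H"
    by (rule continuous_map_eq[OF H]) auto
qed (use assms in auto)

lemma contractible_space_deformation:
  assumes "continuous_map X Y r" "continuous_map Y X i" "contractible_space Y"
    and "continuous_map (prod_topology (top_of_set {0..1::real}) X) X H"
    and "\<And>x. x \<in> topspace X \<Longrightarrow> H (0, x) = x" "\<And>x. x \<in> topspace X \<Longrightarrow> H (1, x) = i (r x)"
  shows "contractible_space X"
proof (rule homotopy_dominated_contractibility[OF assms(2,1) _ assms(3)])
  have "homotopic_with (\<lambda>_. True) X X id (i \<circ> r)"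
    by (rule homotopic_with_topspaceI[OF assms(4)]) (use assms(5,6) in auto)
  then show "homotopic_with (\<lambda>_. True) X X (i \<circ> r) id"
    by (rule homotopic_with_symD)
qed

lemma continuous_map_closed_pieces:
  assumes "finite I" "\<And>i. i \<in> I \<Longrightarrow> closedin X (T i)"
    and "\<And>i. i \<in> I \<Longrightarrow> continuous_map (subtopology X (T i)) Y (f i)"
    and "\<And>i x. i \<in> I \<Longrightarrow> x \<in> topspace X \<Longrightarrow> x \<in> T i \<Longrightarrow> f i x = g x"
    and "\<And>x. x \<in> topspace X \<Longrightarrow> \<exists>i\<in>I. x \<in> T i"
  shows "continuous_map X Y g"
  by (rule pasting_lemma_closed[of I X T Y f]) (use assms in \<open>auto, metis\<close>)

lemma continuous_map_sum_topology_inj: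
  assumes "i \<in> I"
  shows "continuous_map (X i) (sum_topology X I) (Pair i)"
  unfolding continuous_map_def
proof (intro conjI allI impI funcsetI)
  show "(i, x) \<in> topspace (sum_topology X I)" if "x \<in> topspace (X i)" for x
    using that assms by simp
  fix U assume U: "openin (sum_topology X I) U"
  then have "{x \<in> topspace (X i). (i, x) \<in> U} = {x. (i, x) \<in> U}"
    by (auto simp: openin_sum_topology)
  then show "openin (X i) {x \<in> topspace (X i). (i, x) \<in> U}"
    using U assms by (simp add: openin_sum_topology)
qed

lemma continuous_map_prod_sum_topology:
  assumes "\<And>i. i \<in> I \<Longrightarrow> continuous_map (prod_topology T (X i)) Y (\<lambda>(t, x). g (t, (i, x)))"
  shows "continuous_map (prod_topology T (sum_topology X I)) Y g"
  unfolding continuous_map_def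
proof (intro conjI allI impI funcsetI)
  show "g x \<in> topspace Y" if x: "x \<in> topspace (prod_topology T (sum_topology X I))" for x
  proof -
    obtain t i y where [simp]: "x = (t, (i, y))" by (cases x) auto
    show ?thesis
      using x continuous_map_funspace[OF assms, of i] by (auto simp: Pi_iff)
  qed
  fix U assume U: "openin Y U"
  show "openin (prod_topology T (sum_topology X I)) {x \<in> topspace (prod_topology T (sum_topology X I)). g x \<in> U}"
    unfolding openin_prod_topology_alt
  proof (intro allI impI)
    fix t z assume tz: "(t, z) \<in> {x \<in> topspace (prod_topology T (sum_topology X I)). g x \<in> U}"
    obtain i y where z: "z = (i, y)" by (cases z) auto
    have i: "i \<in> I" using tz z by auto
    have op: "openin (prod_topology T (X i)) {x \<in> topspace (prod_topology T (X i)). (\<lambda>(t, x). g (t, (i, x))) x \<in> U}"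
      by (rule openin_continuous_map_preimage[OF assms[OF i] U])
    have mem: "(t, y) \<in> {x \<in> topspace (prod_topology T (X i)). (\<lambda>(t, x). g (t, (i, x))) x \<in> U}"
      using tz z by simp
    obtain A B where AB: "openin T A" "openin (X i) B" "t \<in> A" "y \<in> B"
      "A \<times> B \<subseteq> {x \<in> topspace (prod_topology T (X i)). (\<lambda>(t, x). g (t, (i, x))) x \<in> U}"
      using op[unfolded openin_prod_topology_alt, rule_format, OF mem] by blast
    have "openin (sum_topology X I) ({i} \<times> B)"
      unfolding openin_sum_topology
    proof (intro conjI ballI)
      show "{i} \<times> B \<subseteq> Sigma I (topspace \<circ> X)"
        using openin_subset[OF AB(2)] i by auto
      fix j assume "j \<in> I"
      show "openin (X j) {x. (j, x) \<in> {i} \<times> B}"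
        using AB(2) by (cases "j = i") auto
    qed
    moreover have "A \<times> ({i} \<times> B) \<subseteq> {x \<in> topspace (prod_topology T (sum_topology X I)). g x \<in> U}"
      using AB(5) i by auto
    ultimately show "\<exists>A' B'. openin T A' \<and> openin (sum_topology X I) B' \<and> t \<in> A' \<and> z \<in> B' \<and>
        A' \<times> B' \<subseteq> {x \<in> topspace (prod_topology T (sum_topology X I)). g x \<in> U}"
      using AB(1,3,4) z by (intro exI[of _ A] exI[of _ "{i} \<times> B"]) auto
  qed
qed

section \<open>The two maximal bridgeless types\<close>

type_synonym lengths = "real \<times> real \<times> real \<times> real \<times> real"

definition lens :: "lengths \<Rightarrow> nat \<Rightarrow> real" where
  "lens = (\<lambda>(l0, l1, l2, l3, l4). \<lambda>e\<in>{0,1,2,3,4}.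
     if e = 0 then l0 else if e = 1 then l1 else if e = 2 then l2 else if e = 3 then l3 else l4)"

text \<open>Vertices 0 and 1 are the branch vertices \<open>u\<close> and \<open>v\<close>; vertices 2 and 3 are the marks \<open>x\<close> and \<open>y\<close>.\<close>

definition model_graph :: "nat set \<Rightarrow> nat set \<Rightarrow> nat set \<Rightarrow> nat set \<Rightarrow> nat set \<Rightarrow> (nat, nat) multigraph" where
  "model_graph s0 s1 s2 s3 s4 = \<lparr>verts = {0,1,2,3}, edges = {0,1,2,3,4}, ends = (\<lambda>e\<in>{0,1,2,3,4}.
     if e = 0 then s0 else if e = 1 then s1 else if e = 2 then s2 else if e = 3 then s3 else s4)\<rparr>"

definition model_marking :: "nat \<Rightarrow> nat" where
  "model_marking = (\<lambda>i\<in>{1..2}. if i = 1 then 2 else 3)"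

text \<open>Both marks on one arc: the edges are \<open>ux\<close>, \<open>xy\<close>, \<open>yv\<close> and twice \<open>uv\<close>.\<close>

definition graph_A :: "(nat, nat) multigraph" where
  "graph_A = model_graph {0,2} {2,3} {3,1} {0,1} {0,1}"

text \<open>Marks on different arcs: the edges are \<open>ux\<close>, \<open>xv\<close>, \<open>uy\<close>, \<open>yv\<close> and \<open>uv\<close>.\<close>

definition graph_B :: "(nat, nat) multigraph" where
  "graph_B = model_graph {0,2} {2,1} {0,3} {3,1} {0,1}"

text \<open>The edges of length zero contain no cycle if and only if no two of the three arcs have length zero.\<close>

definition cell_A :: "lengths set" where
  "cell_A = {(a1, a2, a3, b, c). a1 \<ge> 0 \<and> a2 \<ge> 0 \<and> a3 \<ge> 0 \<and> b \<ge> 0 \<and> c \<ge> 0 \<and>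
     \<not> (a1 + a2 + a3 = 0 \<and> b = 0) \<and> \<not> (a1 + a2 + a3 = 0 \<and> c = 0) \<and> \<not> (b = 0 \<and> c = 0)}"

definition cell_B :: "lengths set" where
  "cell_B = {(a1, a2, b1, b2, c). a1 \<ge> 0 \<and> a2 \<ge> 0 \<and> b1 \<ge> 0 \<and> b2 \<ge> 0 \<and> c \<ge> 0 \<and>
     \<not> (a1 + a2 = 0 \<and> b1 + b2 = 0) \<and> \<not> (a1 + a2 = 0 \<and> c = 0) \<and> \<not> (b1 + b2 = 0 \<and> c = 0)}"

definition curve_A :: "lengths \<Rightarrow> (nat, nat) curve set" where
  "curve_A l = TM_map 2 2 ((graph_A, model_marking), lens l)"

definition curve_B :: "lengths \<Rightarrow> (nat, nat) curve set" where
  "curve_B l = TM_map 2 2 ((graph_B, model_marking), lens l)"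

lemma verts_model: "verts (model_graph s0 s1 s2 s3 s4) = {0,1,2,3}"
  and edges_model: "edges (model_graph s0 s1 s2 s3 s4) = {0,1,2,3,4}"
  by (simp_all add: model_graph_def)

lemma ends_model:
  "ends (model_graph s0 s1 s2 s3 s4) 0 = s0" "ends (model_graph s0 s1 s2 s3 s4) (Suc 0) = s1"
  "ends (model_graph s0 s1 s2 s3 s4) 2 = s2" "ends (model_graph s0 s1 s2 s3 s4) 3 = s3"
  "ends (model_graph s0 s1 s2 s3 s4) 4 = s4"
  by (simp_all add: model_graph_def)

lemma lens_simps:
  "lens (l0, l1, l2, l3, l4) 0 = l0" "lens (l0, l1, l2, l3, l4) (Suc 0) = l1"
  "lens (l0, l1, l2, l3, l4) 2 = l2" "lens (l0, l1, l2, l3, l4) 3 = l3"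
  "lens (l0, l1, l2, l3, l4) 4 = l4"
  by (simp_all add: lens_def)

lemma model_marking_simps: "model_marking (Suc 0) = 2" "model_marking 2 = 3"
  by (simp_all add: model_marking_def)

lemma atLeastAtMost_1_2: "{1..2::nat} = {1, 2}"
  by auto

lemma combinatorial_type_model:
  fixes s0 s1 s2 s3 s4
  defines "G \<equiv> model_graph s0 s1 s2 s3 s4"
  assumes fin: "finite_multigraph G"
    and con: "(0, 1) \<in> reach G {0,1,2,3,4}" "(0, 2) \<in> reach G {0,1,2,3,4}" "(0, 3) \<in> reach G {0,1,2,3,4}"
    and val: "valency G 0 = 3" "valency G 1 = 3" "valency G 2 = 2" "valency G 3 = 2"
  shows "combinatorial_type 2 2 G model_marking"
proof -
  have V: "verts G = {0,1,2,3}" "edges G = {0,1,2,3,4}"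
    by (simp_all add: G_def verts_model edges_model)
  have con0: "(0, v) \<in> reach G {0,1,2,3,4}" if "v \<in> {0,1,2,3}" for v
    using that con reach_refl[of 0 G] by (auto simp: V)
  have "connected_multigraph G"
    unfolding connected_multigraph_def V
    by (intro conjI ballI) (simp, rule reach_trans[OF reach_sym[OF con0] con0])
  moreover have "card {i \<in> {1..2}. model_marking i = v} = of_bool (v = 2) + of_bool (v = 3)" for v
  proof -
    have "{i \<in> {1..2}. model_marking i = v} = (if v = 2 then {1} else {}) \<union> (if v = 3 then {2} else {})"
      unfolding atLeastAtMost_1_2 by (auto simp: model_marking_simps)
    then show ?thesis by auto
  qed
  ultimately show ?thesis
    unfolding combinatorial_type_def using fin val
    by (auto simp: V genus_def model_marking_def)
qed

text \<open>Three edges connecting four vertices leave no room for a cycle, by the count of components.\<close>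

lemma spanning_tree_forest:
  assumes fin: "finite_multigraph G" and V: "verts G = {0::nat,1,2,3}" and T: "T \<subseteq> edges G" "card T = 3"
    and con: "(0, Suc 0) \<in> reach G T" "(0, 2) \<in> reach G T" "(0, 3) \<in> reach G T"
  shows "forest G T"
proof -
  have con0: "(0, v) \<in> reach G T" if "v \<in> verts G" for v
    using that con reach_refl[of 0 G] by (auto simp: V)
  then have "reach G T `` {v} = verts G" if "v \<in> verts G" for v
    using reach_verts[of v _ G T] reach_trans[OF reach_sym[OF con0[OF that]] con0] by blast
  then have "verts G // reach G T = {verts G}"
    unfolding quotient_def by (auto simp: V)
  then show ?thesis
    using forest_iff_card_components[OF edges_within_multigraph[OF fin T(1)]] T(2) by (simp add: V)
qed

lemma edges_graph_AB: "edges graph_A = {0,1,2,3,4}" "edges graph_B = {0,1,2,3,4}"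
  "verts graph_A = {0,1,2,3}" "verts graph_B = {0,1,2,3}"
  by (simp_all add: graph_A_def graph_B_def edges_model verts_model)

lemma ends_graph_A: "ends graph_A 0 = {0,2}" "ends graph_A (Suc 0) = {2,3}" "ends graph_A 2 = {3,Suc 0}"
    "ends graph_A 3 = {0,Suc 0}" "ends graph_A 4 = {0,Suc 0}"
  and ends_graph_B: "ends graph_B 0 = {0,2}" "ends graph_B (Suc 0) = {2,Suc 0}" "ends graph_B 2 = {0,3}"
    "ends graph_B 3 = {3,Suc 0}" "ends graph_B 4 = {0,Suc 0}"
  by (simp_all add: graph_A_def graph_B_def ends_model)

lemma finite_multigraph_graph_B: "finite_multigraph graph_B"
  and finite_multigraph_graph_A: "finite_multigraph graph_A"
  unfolding finite_multigraph_def graph_A_def graph_B_def verts_model edges_model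
  by (auto simp: model_graph_def)

lemma reach_graph_B:
  "0 \<in> F \<Longrightarrow> (0, 2) \<in> reach graph_B F" "Suc 0 \<in> F \<Longrightarrow> (2, Suc 0) \<in> reach graph_B F"
  "2 \<in> F \<Longrightarrow> (0, 3) \<in> reach graph_B F" "3 \<in> F \<Longrightarrow> (3, Suc 0) \<in> reach graph_B F"
  "4 \<in> F \<Longrightarrow> (0, Suc 0) \<in> reach graph_B F"
  using reach_edge[of 0 F graph_B 0 2] reach_edge[of 1 F graph_B 2 1]
    reach_edge[of 2 F graph_B 0 3] reach_edge[of 3 F graph_B 3 1] reach_edge[of 4 F graph_B 0 1]
  by (simp_all add: ends_graph_B edges_graph_AB)

lemma reach_graph_A:
  "0 \<in> F \<Longrightarrow> (0, 2) \<in> reach graph_A F" "Suc 0 \<in> F \<Longrightarrow> (2, 3) \<in> reach graph_A F"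
  "2 \<in> F \<Longrightarrow> (3, Suc 0) \<in> reach graph_A F" "3 \<in> F \<Longrightarrow> (0, Suc 0) \<in> reach graph_A F"
  "4 \<in> F \<Longrightarrow> (0, Suc 0) \<in> reach graph_A F"
  using reach_edge[of 0 F graph_A 0 2] reach_edge[of 1 F graph_A 2 3]
    reach_edge[of 2 F graph_A 3 1] reach_edge[of 3 F graph_A 0 1] reach_edge[of 4 F graph_A 0 1]
  by (simp_all add: ends_graph_A edges_graph_AB)

lemma valency_graph_B: "valency graph_B 0 = 3" "valency graph_B (Suc 0) = 3" "valency graph_B 2 = 2" "valency graph_B 3 = 2"
  by (subst valency_incidence, simp add: graph_B_def edges_model,
      simp add: graph_B_def edges_model incidence_def ends_model doubleton_eq_iff)+

lemma valency_graph_A: "valency graph_A 0 = 3" "valency graph_A (Suc 0) = 3" "valency graph_A 2 = 2" "valency graph_A 3 = 2"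
  by (subst valency_incidence, simp add: graph_A_def edges_model,
      simp add: graph_A_def edges_model incidence_def ends_model doubleton_eq_iff)+

lemma combinatorial_type_graph_B: "combinatorial_type 2 2 graph_B model_marking"
proof -
  have "(0, Suc 0) \<in> reach graph_B {0,1,2,3,4}" "(0, 2) \<in> reach graph_B {0,1,2,3,4}" "(0, 3) \<in> reach graph_B {0,1,2,3,4}"
    by (simp_all add: reach_graph_B)
  then show ?thesis
    using valency_graph_B finite_multigraph_graph_B unfolding graph_B_def
    by (intro combinatorial_type_model) simp_all
qed

lemma combinatorial_type_graph_A: "combinatorial_type 2 2 graph_A model_marking"
proof -
  have "(0, Suc 0) \<in> reach graph_A {0,1,2,3,4}" "(0, 2) \<in> reach graph_A {0,1,2,3,4}"
    by (simp_all add: reach_graph_A)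
  moreover have "(0, 3) \<in> reach graph_A {0,1,2,3,4}"
    by (rule reach_trans[OF reach_graph_A(1) reach_graph_A(2)]) simp_all
  ultimately show ?thesis
    using valency_graph_A finite_multigraph_graph_A unfolding graph_A_def
    by (intro combinatorial_type_model) simp_all
qed

text \<open>The spanning trees that contain the possible zero sets: remove one edge from each of two arcs.\<close>

lemma forest_graph_B:
  assumes "i \<in> {0,1}" "j \<in> {2,3}"
  shows "forest graph_B ({0,1,2,3,4} - {i, j})" "forest graph_B ({0,1,2,3,4} - {i, 4})"
    "forest graph_B ({0,1,2,3,4} - {j, 4})"
proof -
  note * = spanning_tree_forest[OF finite_multigraph_graph_B edges_graph_AB(4), unfolded edges_graph_AB]
  note r = reach_graph_B reach_graph_B[THEN reach_sym]
  let ?T = "{0,1,2,3,4} - {i, j}"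
  have 1: "(0, Suc 0) \<in> reach graph_B ?T"
    by (rule r(5)) (use assms in auto)
  have 2: "(0, 2) \<in> reach graph_B ?T"
  proof (cases "i = 0")
    case True
    show ?thesis by (rule reach_trans[OF 1 r(7)]) (use assms True in auto)
  qed (rule r(1), use assms in auto)
  have 3: "(0, 3) \<in> reach graph_B ?T"
  proof (cases "j = 2")
    case True
    show ?thesis by (rule reach_trans[OF 1 r(9)]) (use assms True in auto)
  qed (rule r(3), use assms in auto)
  show "forest graph_B ?T"
    by (rule *[OF _ _ 1 2 3]) (use assms in auto)
  let ?T = "{0,1,2,3,4} - {i, 4}"
  have 3: "(0, 3) \<in> reach graph_B ?T"
    by (rule r(3)) (use assms in auto)
  have 1: "(0, Suc 0) \<in> reach graph_B ?T"
    by (rule reach_trans[OF 3 r(4)]) (use assms in auto)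
  have 2: "(0, 2) \<in> reach graph_B ?T"
  proof (cases "i = 0")
    case True
    show ?thesis by (rule reach_trans[OF 1 r(7)]) (use assms True in auto)
  qed (rule r(1), use assms in auto)
  show "forest graph_B ?T"
    by (rule *[OF _ _ 1 2 3]) (use assms in auto)
  let ?T = "{0,1,2,3,4} - {j, 4}"
  have 2: "(0, 2) \<in> reach graph_B ?T"
    by (rule r(1)) (use assms in auto)
  have 1: "(0, Suc 0) \<in> reach graph_B ?T"
    by (rule reach_trans[OF 2 r(2)]) (use assms in auto)
  have 3: "(0, 3) \<in> reach graph_B ?T"
  proof (cases "j = 2")
    case True
    show ?thesis by (rule reach_trans[OF 1 r(9)]) (use assms True in auto)
  qed (rule r(3), use assms in auto)
  show "forest graph_B ?T"
    by (rule *[OF _ _ 1 2 3]) (use assms in auto)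
qed

lemma forest_graph_A:
  assumes "i \<in> {0,1,2}" "j \<in> {3,4}"
  shows "forest graph_A ({0,1,2,3,4} - {i, j})" "forest graph_A ({0,1,2,3,4} - {3, 4})"
proof -
  note * = spanning_tree_forest[OF finite_multigraph_graph_A edges_graph_AB(3), unfolded edges_graph_AB]
  note r = reach_graph_A reach_graph_A[THEN reach_sym]
  let ?T = "{0,1,2,3,4} - {i, j}"
  have 1: "(0, Suc 0) \<in> reach graph_A ?T"
  proof (cases "j = 3")
    case True
    show ?thesis by (rule r(5)) (use assms True in auto)
  qed (rule r(4), use assms in auto)
  have "(0, 2) \<in> reach graph_A ?T \<and> (0, 3) \<in> reach graph_A ?T"
  proof -
    have 3: "(0, 3) \<in> reach graph_A ?T" if "i \<noteq> 2"
      by (rule reach_trans[OF 1 r(8)]) (use assms that in auto)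
    have 2: "(0, 2) \<in> reach graph_A ?T" if "i \<noteq> 0"
      by (rule r(1)) (use assms that in auto)
    consider "i = 0" | "i = 1" | "i = 2" using assms by auto
    then show ?thesis
    proof cases
      case c: 1
      have "(0, 2) \<in> reach graph_A ?T"
        by (rule reach_trans[OF 3 r(7)]) (use assms c in auto)
      then show ?thesis using 3 c by auto
    next
      case 2
      then show ?thesis using \<open>i \<noteq> 2 \<Longrightarrow> _\<close> \<open>i \<noteq> 0 \<Longrightarrow> _\<close> by auto
    next
      case c: 3
      have "(0, 3) \<in> reach graph_A ?T"
        by (rule reach_trans[OF 2 r(2)]) (use assms c in auto)
      then show ?thesis using 2 c by auto
    qed
  qed
  then show "forest graph_A ?T"
    by (intro *[OF _ _ 1]) (use assms in auto)
  let ?S = "{0,1,2,3,4} - {3::nat, 4}"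
  have 2: "(0, 2) \<in> reach graph_A ?S"
    by (rule r(1)) auto
  have 3: "(0, 3) \<in> reach graph_A ?S"
    by (rule reach_trans[OF 2 r(2)]) auto
  have 1: "(0, Suc 0) \<in> reach graph_A ?S"
    by (rule reach_trans[OF 3 r(3)]) auto
  show "forest graph_A ?S"
    by (rule *[OF _ _ 1 2 3]) auto
qed

lemma not_forestI: "e \<in> F \<Longrightarrow> ends G e = {u, v} \<Longrightarrow> (u, v) \<in> reach G (F - {e}) \<Longrightarrow> \<not> forest G F"
  by (auto simp: forest_def)

lemma degenerate_curve_graph_B: "degenerate_curve 2 2 (graph_B, lens l, model_marking) \<longleftrightarrow> l \<in> cell_B"
proof -
  obtain a1 a2 b1 b2 c where l: "l = (a1, a2, b1, b2, c)" by (cases l)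
  let ?Z = "zero_edges graph_B (lens l)"
  have nn: "lens l \<in> edges graph_B \<rightarrow>\<^sub>E {0..} \<longleftrightarrow> a1 \<ge> 0 \<and> a2 \<ge> 0 \<and> b1 \<ge> 0 \<and> b2 \<ge> 0 \<and> c \<ge> 0"
    unfolding l lens_def edges_graph_AB by (auto simp: PiE_iff extensional_def)
  have z: "0 \<in> ?Z \<longleftrightarrow> a1 = 0" "Suc 0 \<in> ?Z \<longleftrightarrow> a2 = 0" "2 \<in> ?Z \<longleftrightarrow> b1 = 0" "3 \<in> ?Z \<longleftrightarrow> b2 = 0" "4 \<in> ?Z \<longleftrightarrow> c = 0"
    unfolding zero_edges_def edges_graph_AB l by (simp_all add: lens_simps)
  have Z: "?Z \<subseteq> {0,1,2,3,4}"
    by (auto simp: zero_edges_def edges_graph_AB)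
  note r = reach_graph_B reach_graph_B[THEN reach_sym]
  have "forest graph_B ?Z \<longleftrightarrow> \<not> (a1 = 0 \<and> a2 = 0 \<and> b1 = 0 \<and> b2 = 0) \<and> \<not> (a1 = 0 \<and> a2 = 0 \<and> c = 0) \<and>
      \<not> (b1 = 0 \<and> b2 = 0 \<and> c = 0)"
  proof (intro iffI conjI notI)
    assume f: "forest graph_B ?Z"
    { assume 0: "a1 = 0 \<and> a2 = 0 \<and> b1 = 0 \<and> b2 = 0"
      have "(0, 3) \<in> reach graph_B (?Z - {0})" "(3, Suc 0) \<in> reach graph_B (?Z - {0})" "(Suc 0, 2) \<in> reach graph_B (?Z - {0})"
        using 0 z by (auto intro!: r)
      then have "(0, 2) \<in> reach graph_B (?Z - {0})"
        by (meson reach_trans)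
      then show False
        using not_forestI[OF _ ends_graph_B(1)] f z 0 by blast }
    { assume 0: "a1 = 0 \<and> a2 = 0 \<and> c = 0"
      have "(0, 2) \<in> reach graph_B (?Z - {4})" "(2, Suc 0) \<in> reach graph_B (?Z - {4})"
        using 0 z by (auto intro!: r)
      then have "(0, Suc 0) \<in> reach graph_B (?Z - {4})"
        by (meson reach_trans)
      then show False
        using not_forestI[OF _ ends_graph_B(5)] f z 0 by blast }
    { assume 0: "b1 = 0 \<and> b2 = 0 \<and> c = 0"
      have "(0, 3) \<in> reach graph_B (?Z - {4})" "(3, Suc 0) \<in> reach graph_B (?Z - {4})"
        using 0 z by (auto intro!: r)
      then have "(0, Suc 0) \<in> reach graph_B (?Z - {4})"
        by (meson reach_trans)
      then show False
        using not_forestI[OF _ ends_graph_B(5)] f z 0 by blast }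
  next
    assume a: "\<not> (a1 = 0 \<and> a2 = 0 \<and> b1 = 0 \<and> b2 = 0) \<and> \<not> (a1 = 0 \<and> a2 = 0 \<and> c = 0) \<and>
      \<not> (b1 = 0 \<and> b2 = 0 \<and> c = 0)"
    then have "(0 \<notin> ?Z \<or> Suc 0 \<notin> ?Z) \<and> (2 \<notin> ?Z \<or> 3 \<notin> ?Z) \<or>
        (0 \<notin> ?Z \<or> Suc 0 \<notin> ?Z) \<and> 4 \<notin> ?Z \<or> (2 \<notin> ?Z \<or> 3 \<notin> ?Z) \<and> 4 \<notin> ?Z"
      unfolding z by blast
    moreover have "0 \<notin> ?Z \<or> Suc 0 \<notin> ?Z \<longleftrightarrow> (\<exists>i\<in>{0,1}. i \<notin> ?Z)" "2 \<notin> ?Z \<or> 3 \<notin> ?Z \<longleftrightarrow> (\<exists>j\<in>{2,3}. j \<notin> ?Z)"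
      by auto
    ultimately consider i j where "i \<in> {0,1}" "j \<in> {2,3}" "i \<notin> ?Z" "j \<notin> ?Z"
      | i where "i \<in> {0,1}" "i \<notin> ?Z" "4 \<notin> ?Z" | j where "j \<in> {2,3}" "j \<notin> ?Z" "4 \<notin> ?Z"
      by metis
    then show "forest graph_B ?Z"
    proof cases
      case 1
      then show ?thesis
        by (intro forest_subset[OF forest_graph_B(1)[OF 1(1,2)]]) (use Z 1 in blast)
    next
      case 2
      then show ?thesis
        by (intro forest_subset[OF forest_graph_B(2)[OF 2(1), of 2]]) (simp, use Z 2 in blast)
    next
      case 3
      then show ?thesis
        by (intro forest_subset[OF forest_graph_B(3)[of 0, OF _ 3(1)]]) (simp, use Z 3 in blast)
    qed
  qed
  note fo = this
  have s: "a1 + a2 = 0 \<longleftrightarrow> a1 = 0 \<and> a2 = 0" if "a1 \<ge> 0" "a2 \<ge> 0" for a1 a2 :: real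
    using that by (rule add_nonneg_eq_0_iff)
  show ?thesis
    unfolding degenerate_curve_def prod.case nn fo using combinatorial_type_graph_B s[of a1 a2] s[of b1 b2]
    unfolding l cell_B_def mem_Collect_eq prod.case by blast
qed

lemma degenerate_curve_graph_A: "degenerate_curve 2 2 (graph_A, lens l, model_marking) \<longleftrightarrow> l \<in> cell_A"
proof -
  obtain a1 a2 a3 b c where l: "l = (a1, a2, a3, b, c)" by (cases l)
  let ?Z = "zero_edges graph_A (lens l)"
  have nn: "lens l \<in> edges graph_A \<rightarrow>\<^sub>E {0..} \<longleftrightarrow> a1 \<ge> 0 \<and> a2 \<ge> 0 \<and> a3 \<ge> 0 \<and> b \<ge> 0 \<and> c \<ge> 0"
    unfolding l lens_def edges_graph_AB by (auto simp: PiE_iff extensional_def)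
  have z: "0 \<in> ?Z \<longleftrightarrow> a1 = 0" "Suc 0 \<in> ?Z \<longleftrightarrow> a2 = 0" "2 \<in> ?Z \<longleftrightarrow> a3 = 0" "3 \<in> ?Z \<longleftrightarrow> b = 0" "4 \<in> ?Z \<longleftrightarrow> c = 0"
    unfolding zero_edges_def edges_graph_AB l by (simp_all add: lens_simps)
  have Z: "?Z \<subseteq> {0,1,2,3,4}"
    by (auto simp: zero_edges_def edges_graph_AB)
  note r = reach_graph_A reach_graph_A[THEN reach_sym]
  have "forest graph_A ?Z \<longleftrightarrow> \<not> (a1 = 0 \<and> a2 = 0 \<and> a3 = 0 \<and> b = 0) \<and> \<not> (a1 = 0 \<and> a2 = 0 \<and> a3 = 0 \<and> c = 0) \<and>
      \<not> (b = 0 \<and> c = 0)"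
  proof (intro iffI conjI notI)
    assume f: "forest graph_A ?Z"
    { assume 0: "a1 = 0 \<and> a2 = 0 \<and> a3 = 0 \<and> b = 0"
      have "(0, 2) \<in> reach graph_A (?Z - {3})" "(2, 3) \<in> reach graph_A (?Z - {3})" "(3, Suc 0) \<in> reach graph_A (?Z - {3})"
        using 0 z by (auto intro!: r)
      then have "(0, Suc 0) \<in> reach graph_A (?Z - {3})"
        by (meson reach_trans)
      then show False
        using not_forestI[OF _ ends_graph_A(4)] f z 0 by blast }
    { assume 0: "a1 = 0 \<and> a2 = 0 \<and> a3 = 0 \<and> c = 0"
      have "(0, 2) \<in> reach graph_A (?Z - {4})" "(2, 3) \<in> reach graph_A (?Z - {4})" "(3, Suc 0) \<in> reach graph_A (?Z - {4})"
        using 0 z by (auto intro!: r)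
      then have "(0, Suc 0) \<in> reach graph_A (?Z - {4})"
        by (meson reach_trans)
      then show False
        using not_forestI[OF _ ends_graph_A(5)] f z 0 by blast }
    { assume 0: "b = 0 \<and> c = 0"
      have "(0, Suc 0) \<in> reach graph_A (?Z - {4})"
        using 0 z by (intro r(4)) auto
      then show False
        using not_forestI[OF _ ends_graph_A(5)] f z 0 by blast }
  next
    assume a: "\<not> (a1 = 0 \<and> a2 = 0 \<and> a3 = 0 \<and> b = 0) \<and> \<not> (a1 = 0 \<and> a2 = 0 \<and> a3 = 0 \<and> c = 0) \<and>
      \<not> (b = 0 \<and> c = 0)"
    then have "(0 \<notin> ?Z \<or> Suc 0 \<notin> ?Z \<or> 2 \<notin> ?Z) \<and> (3 \<notin> ?Z \<or> 4 \<notin> ?Z) \<or> 3 \<notin> ?Z \<and> 4 \<notin> ?Z"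
      unfolding z by blast
    moreover have "0 \<notin> ?Z \<or> Suc 0 \<notin> ?Z \<or> 2 \<notin> ?Z \<longleftrightarrow> (\<exists>i\<in>{0,1,2}. i \<notin> ?Z)"
        "3 \<notin> ?Z \<or> 4 \<notin> ?Z \<longleftrightarrow> (\<exists>j\<in>{3,4}. j \<notin> ?Z)"
      by auto
    ultimately consider i j where "i \<in> {0,1,2}" "j \<in> {3,4}" "i \<notin> ?Z" "j \<notin> ?Z"
      | "3 \<notin> ?Z" "4 \<notin> ?Z"
      by metis
    then show "forest graph_A ?Z"
    proof cases
      case 1
      then show ?thesis
        by (intro forest_subset[OF forest_graph_A(1)[OF 1(1,2)]]) (use Z 1 in blast)
    next
      case 2
      then show ?thesis
        by (intro forest_subset[OF forest_graph_A(2)[of 0 3]]) (simp, simp, use Z 2 in blast)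
    qed
  qed
  note fo = this
  have s: "a1 + a2 + a3 = 0 \<longleftrightarrow> a1 = 0 \<and> a2 = 0 \<and> a3 = 0" if "a1 \<ge> 0" "a2 \<ge> 0" "a3 \<ge> 0"
    using that by linarith
  show ?thesis
    unfolding degenerate_curve_def prod.case nn fo using combinatorial_type_graph_A s
    unfolding l cell_A_def mem_Collect_eq prod.case by blast
qed

section \<open>Recovering the lengths from the curve\<close>

text \<open>The isomorphism class of a curve forgets the names of the edges. What it remembers of them is the
  multiset of their ends and lengths.\<close>

definition edge_data :: "('v, 'e) curve \<Rightarrow> ('v set \<times> real) multiset" where
  "edge_data = (\<lambda>(G, l, p). image_mset (\<lambda>e. (ends G e, l e)) (mset_set (edges G)))"

text \<open>The matching of edges in a contraction map can thus be replaced by an equality of multisets.\<close>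

lemma image_mset_eq_iff_bij:
  assumes "finite A" "finite B"
  shows "image_mset f (mset_set A) = image_mset g (mset_set B) \<longleftrightarrow>
    (\<exists>\<epsilon>. bij_betw \<epsilon> A B \<and> (\<forall>a\<in>A. g (\<epsilon> a) = f a))"
proof
  assume "\<exists>\<epsilon>. bij_betw \<epsilon> A B \<and> (\<forall>a\<in>A. g (\<epsilon> a) = f a)"
  then obtain \<epsilon> where e: "bij_betw \<epsilon> A B" "\<And>a. a \<in> A \<Longrightarrow> g (\<epsilon> a) = f a" by auto
  have "mset_set B = image_mset \<epsilon> (mset_set A)"
    using e(1) by (simp add: bij_betw_def image_mset_mset_set)
  then have "image_mset g (mset_set B) = image_mset (\<lambda>a. g (\<epsilon> a)) (mset_set A)"
    by (simp add: image_mset.compositionality o_def)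
  also have "\<dots> = image_mset f (mset_set A)"
    using e(2) assms(1) by (intro image_mset_cong) simp
  finally show "image_mset f (mset_set A) = image_mset g (mset_set B)" by simp
next
  assume "image_mset f (mset_set A) = image_mset g (mset_set B)"
  with assms show "\<exists>\<epsilon>. bij_betw \<epsilon> A B \<and> (\<forall>a\<in>A. g (\<epsilon> a) = f a)"
  proof (induction A arbitrary: B rule: finite_induct)
    case empty
    then show ?case by (auto simp: mset_set_empty_iff bij_betw_def)
  next
    case (insert a A)
    have "f a \<in># image_mset g (mset_set B)"
      using insert.prems(2) insert.hyps by (metis finite.insertI finite_set_mset_mset_set image_eqI insertI1 set_image_mset)
    then obtain b where b: "b \<in> B" "g b = f a"
      using insert.prems(1) by auto
    have "add_mset (f a) (image_mset f (mset_set A)) = add_mset (g b) (image_mset g (mset_set (B - {b})))"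
      using insert.prems insert.hyps b by (simp add: mset_set.remove)
    then have "image_mset f (mset_set A) = image_mset g (mset_set (B - {b}))"
      using b by simp
    then obtain \<epsilon> where e: "bij_betw \<epsilon> A (B - {b})" "\<forall>x\<in>A. g (\<epsilon> x) = f x"
      using insert.IH[of "B - {b}"] insert.prems(1) by auto
    have "bij_betw (\<epsilon>(a := b)) (insert a A) B"
      using e(1) insert.hyps b by (auto simp: bij_betw_def inj_on_def)
    moreover have "\<forall>x\<in>insert a A. g ((\<epsilon>(a := b)) x) = f x"
      using e(2) b insert.hyps by auto
    ultimately show ?case by blast
  qed
qed

definition lengths_at :: "'v set \<Rightarrow> ('v set \<times> real) multiset \<Rightarrow> real multiset" where
  "lengths_at s M = image_mset snd (filter_mset (\<lambda>p. fst p = s) M)"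

lemma lengths_at_simps [simp]:
  "lengths_at s {#} = {#}"
  "lengths_at s (add_mset (s', r) M) = (if s = s' then add_mset r (lengths_at s M) else lengths_at s M)"
  by (auto simp: lengths_at_def)

lemma lengths_at_filter: "lengths_at s (filter_mset (\<lambda>p. snd p \<noteq> 0) M) = filter_mset (\<lambda>r. r \<noteq> 0) (lengths_at s M)"
  by (induction M) (auto simp: lengths_at_def)

lemma mset_pair_eq: "{#a, b#} = {#c, d#} \<longleftrightarrow> a = c \<and> b = d \<or> a = d \<and> b = c"
  by (auto simp: add_eq_conv_ex)

lemma mset_triple_eq: "{#a, b, c#} = {#a', b', c'#} \<longleftrightarrow>
    a = a' \<and> {#b, c#} = {#b', c'#} \<or> a = b' \<and> {#b, c#} = {#a', c'#} \<or> a = c' \<and> {#b, c#} = {#a', b'#}"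
  by (auto simp: add_eq_conv_ex add_mset_commute)

text \<open>The edges of a curve modelled by \<open>graph_B\<close> whose branch vertices and marks are \<open>u\<close>, \<open>v\<close>, \<open>x\<close>, \<open>y\<close>.
  Edges of length zero have disappeared.\<close>

definition B_data :: "'v \<Rightarrow> 'v \<Rightarrow> 'v \<Rightarrow> 'v \<Rightarrow> lengths \<Rightarrow> ('v set \<times> real) multiset" where
  "B_data u v x y = (\<lambda>(a1, a2, b1, b2, c). filter_mset (\<lambda>p. snd p \<noteq> 0)
     {#({u, x}, a1), ({x, v}, a2), ({u, y}, b1), ({y, v}, b2), ({u, v}, c)#})"

definition A_data :: "'v \<Rightarrow> 'v \<Rightarrow> 'v \<Rightarrow> 'v \<Rightarrow> lengths \<Rightarrow> ('v set \<times> real) multiset" where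
  "A_data u v x y = (\<lambda>(a1, a2, a3, b, c). filter_mset (\<lambda>p. snd p \<noteq> 0)
     {#({u, x}, a1), ({x, y}, a2), ({y, v}, a3), ({u, v}, b), ({u, v}, c)#})"

definition zeros :: "lengths \<Rightarrow> nat" where
  "zeros = (\<lambda>(l0, l1, l2, l3, l4). of_bool (l0 = 0) + of_bool (l1 = 0) + of_bool (l2 = 0) + of_bool (l3 = 0) + of_bool (l4 = 0))"

text \<open>If the edge data of two length vectors agree, for the same vertices, then the vectors are related
  by the moves. The function \<open>\<Phi>\<close> stands for any invariant of the moves. The card conditions say that
  distinct vertices are identified only as often as edges of length zero require. They determine
  which lengths vanish from the coincidences among \<open>u\<close>, \<open>v\<close>, \<open>x\<close>, \<open>y\<close>, and the proof is a case
  distinction on these coincidences. In each case the moves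
  permute the lengths of edges that have the same ends.\<close>

lemma B_data_determines_lengths:
  fixes u v x y :: 'v and \<Phi> :: "lengths \<Rightarrow> 'z"
  assumes iota: "\<And>a1 a2 b1 b2 c. \<Phi> (a1, a2, b1, b2, c) = \<Phi> (a2, a1, b2, b1, c)"
    and flip: "\<And>a1 a2 b1 b2. \<Phi> (a1, a2, b1, b2, 0) = \<Phi> (a2, a1, b1, b2, 0)"
    and swapa: "\<And>a2 b1 b2 c. \<Phi> (0, a2, b1, b2, c) = \<Phi> (0, c, b1, b2, a2)"
    and swapb: "\<And>a1 a2 b2 c. \<Phi> (a1, a2, 0, b2, c) = \<Phi> (a1, a2, 0, c, b2)"
    and card: "card {u, v, x, y} + zeros (a1, a2, b1, b2, c) = 4" "card {u, v, x, y} + zeros (a1', a2', b1', b2', c') = 4"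
    and z: "a1 = 0 \<longrightarrow> u = x" "a2 = 0 \<longrightarrow> x = v" "b1 = 0 \<longrightarrow> u = y" "b2 = 0 \<longrightarrow> y = v" "c = 0 \<longrightarrow> u = v"
    and z': "a1' = 0 \<longrightarrow> u = x" "a2' = 0 \<longrightarrow> x = v" "b1' = 0 \<longrightarrow> u = y" "b2' = 0 \<longrightarrow> y = v" "c' = 0 \<longrightarrow> u = v"
    and arcs: "\<not> (a1 = 0 \<and> a2 = 0 \<and> b1 = 0 \<and> b2 = 0)" "\<not> (a1 = 0 \<and> a2 = 0 \<and> c = 0)" "\<not> (b1 = 0 \<and> b2 = 0 \<and> c = 0)"
    and arcs': "\<not> (a1' = 0 \<and> a2' = 0 \<and> b1' = 0 \<and> b2' = 0)" "\<not> (a1' = 0 \<and> a2' = 0 \<and> c' = 0)" "\<not> (b1' = 0 \<and> b2' = 0 \<and> c' = 0)"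
    and eq: "B_data u v x y (a1, a2, b1, b2, c) = B_data u v x y (a1', a2', b1', b2', c')"
  shows "\<Phi> (a1, a2, b1, b2, c) = \<Phi> (a1', a2', b1', b2', c')"
proof -
  have flipb: "\<Phi> (a1, a2, b1, b2, 0) = \<Phi> (a1, a2, b2, b1, 0)" for a1 a2 b1 b2
    by (metis iota flip)
  have swapa': "\<Phi> (a1, 0, b1, b2, c) = \<Phi> (c, 0, b1, b2, a1)" for a1 b1 b2 c
    by (metis iota swapa)
  have swapb': "\<Phi> (a1, a2, b1, 0, c) = \<Phi> (a1, a2, c, 0, b1)" for a1 a2 b1 c
    by (metis iota swapb)
  note sel = arg_cong[OF eq, of "lengths_at s" for s, unfolded B_data_def prod.case lengths_at_filter]
  have xy: "x \<in> {u, v}" if "x = y"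
    using that card(1) z by (cases "u = v"; cases "c = 0") (auto simp: zeros_def card_insert_if split: if_splits)
  show ?thesis
  proof (cases "u = v")
    case uv: False
    consider (none) "x \<notin> {u, v}" "y \<notin> {u, v}" | (xu) "x = u" "y \<notin> {u, v}" | (xv) "x = v" "y \<notin> {u, v}"
      | (yu) "x \<notin> {u, v}" "y = u" | (yv) "x \<notin> {u, v}" "y = v"
      | (uu) "x = u" "y = u" | (vv) "x = v" "y = v" | (uv) "x = u" "y = v" | (vu) "x = v" "y = u"
      by blast
    then show ?thesis
    proof cases
      case none
      then have "x \<noteq> y" using xy by auto
      then show ?thesis
        using none uv z z' sel[of "{u, x}"] sel[of "{x, v}"] sel[of "{u, y}"] sel[of "{y, v}"] sel[of "{u, v}"]
        by (auto simp: doubleton_eq_iff split: if_splits)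
    next
      case xu
      then have nz: "a2 \<noteq> 0 \<and> b1 \<noteq> 0 \<and> b2 \<noteq> 0 \<and> c \<noteq> 0 \<and> a2' \<noteq> 0 \<and> b1' \<noteq> 0 \<and> b2' \<noteq> 0 \<and> c' \<noteq> 0"
        using uv z z' by auto
      have "a1 = 0 \<and> a1' = 0"
        using xu uv card nz by (cases "a1 = 0"; cases "a1' = 0"; auto simp: zeros_def card_insert_if)
      then show ?thesis
        using nz xu uv sel[of "{u, y}"] sel[of "{y, v}"] sel[of "{u, v}"] swapa
        by (auto simp: doubleton_eq_iff mset_pair_eq mset_triple_eq)
    next
      case xv
      then have nz: "a1 \<noteq> 0 \<and> b1 \<noteq> 0 \<and> b2 \<noteq> 0 \<and> c \<noteq> 0 \<and> a1' \<noteq> 0 \<and> b1' \<noteq> 0 \<and> b2' \<noteq> 0 \<and> c' \<noteq> 0"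
        using uv z z' by auto
      have "a2 = 0 \<and> a2' = 0"
        using xv uv card nz by (cases "a2 = 0"; cases "a2' = 0"; auto simp: zeros_def card_insert_if)
      then show ?thesis
        using nz xv uv sel[of "{u, y}"] sel[of "{y, v}"] sel[of "{u, v}"] swapa'
        by (auto simp: doubleton_eq_iff mset_pair_eq mset_triple_eq)
    next
      case yu
      then have nz: "a2 \<noteq> 0 \<and> a1 \<noteq> 0 \<and> b2 \<noteq> 0 \<and> c \<noteq> 0 \<and> a2' \<noteq> 0 \<and> a1' \<noteq> 0 \<and> b2' \<noteq> 0 \<and> c' \<noteq> 0"
        using uv z z' by auto
      have "b1 = 0 \<and> b1' = 0"
        using yu uv card nz by (cases "b1 = 0"; cases "b1' = 0"; auto simp: zeros_def card_insert_if)
      then show ?thesis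
        using nz yu uv sel[of "{u, x}"] sel[of "{x, v}"] sel[of "{u, v}"] swapb
        by (auto simp: doubleton_eq_iff mset_pair_eq mset_triple_eq)
    next
      case yv
      then have nz: "a2 \<noteq> 0 \<and> a1 \<noteq> 0 \<and> b1 \<noteq> 0 \<and> c \<noteq> 0 \<and> a2' \<noteq> 0 \<and> a1' \<noteq> 0 \<and> b1' \<noteq> 0 \<and> c' \<noteq> 0"
        using uv z z' by auto
      have "b2 = 0 \<and> b2' = 0"
        using yv uv card nz by (cases "b2 = 0"; cases "b2' = 0"; auto simp: zeros_def card_insert_if)
      then show ?thesis
        using nz yv uv sel[of "{u, x}"] sel[of "{x, v}"] sel[of "{u, v}"] swapb'
        by (auto simp: doubleton_eq_iff mset_pair_eq mset_triple_eq)
    next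
      case uu
      then have nz: "a2 \<noteq> 0 \<and> b2 \<noteq> 0 \<and> c \<noteq> 0 \<and> a2' \<noteq> 0 \<and> b2' \<noteq> 0 \<and> c' \<noteq> 0"
        using uv z z' by auto
      have "a1 = 0 \<and> b1 = 0 \<and> a1' = 0 \<and> b1' = 0"
        using uu uv card nz by (cases "a1 = 0"; cases "b1 = 0"; cases "a1' = 0"; cases "b1' = 0"; auto simp: zeros_def card_insert_if)
      then show ?thesis
        using nz uu uv sel[of "{u, v}"] swapb[of 0] swapa[of _ 0]
        by (auto simp: doubleton_eq_iff mset_pair_eq mset_triple_eq; metis)
    next
      case vv
      then have nz: "a1 \<noteq> 0 \<and> b1 \<noteq> 0 \<and> c \<noteq> 0 \<and> a1' \<noteq> 0 \<and> b1' \<noteq> 0 \<and> c' \<noteq> 0"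
        using uv z z' by auto
      have "a2 = 0 \<and> b2 = 0 \<and> a2' = 0 \<and> b2' = 0"
        using vv uv card nz by (cases "a2 = 0"; cases "b2 = 0"; cases "a2' = 0"; cases "b2' = 0"; auto simp: zeros_def card_insert_if)
      then show ?thesis
        using nz vv uv sel[of "{u, v}"] swapb'[of _ 0] swapa'[of _ _ 0]
        by (auto simp: doubleton_eq_iff mset_pair_eq mset_triple_eq; metis)
    next
      case uv': uv
      then have nz: "a2 \<noteq> 0 \<and> b1 \<noteq> 0 \<and> c \<noteq> 0 \<and> a2' \<noteq> 0 \<and> b1' \<noteq> 0 \<and> c' \<noteq> 0"
        using uv z z' by auto
      have "a1 = 0 \<and> b2 = 0 \<and> a1' = 0 \<and> b2' = 0"
        using uv' uv card nz by (cases "a1 = 0"; cases "b2 = 0"; cases "a1' = 0"; cases "b2' = 0"; auto simp: zeros_def card_insert_if)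
      then show ?thesis
        using nz uv' uv sel[of "{u, v}"] swapb'[of 0] swapa[of _ _ 0]
        by (auto simp: doubleton_eq_iff mset_pair_eq mset_triple_eq; metis)
    next
      case vu
      then have nz: "a1 \<noteq> 0 \<and> b2 \<noteq> 0 \<and> c \<noteq> 0 \<and> a1' \<noteq> 0 \<and> b2' \<noteq> 0 \<and> c' \<noteq> 0"
        using uv z z' by auto
      have "a2 = 0 \<and> b1 = 0 \<and> a2' = 0 \<and> b1' = 0"
        using vu uv card nz by (cases "a2 = 0"; cases "b1 = 0"; cases "a2' = 0"; cases "b1' = 0"; auto simp: zeros_def card_insert_if)
      then show ?thesis
        using nz vu uv sel[of "{u, v}"] swapb[of _ 0] swapa'[of _ 0]
        by (auto simp: doubleton_eq_iff mset_pair_eq mset_triple_eq; metis)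
    qed
  next
    case uv: True
    \<comment> \<open>For \<open>u = v\<close> all arcs are loops. If \<open>x = u\<close> too, then only one of \<open>a1\<close>, \<open>a2\<close>, \<open>c\<close> is nonzero,
      and the sum names it without a further case distinction.\<close>
    have one_a: "\<Phi> (a1, a2, b1, b2, c) = \<Phi> (0, a1 + a2 + c, b1, b2, 0)"
      if "a1 = 0 \<and> a2 = 0 \<or> a1 = 0 \<and> c = 0 \<or> a2 = 0 \<and> c = 0" for a1 a2 b1 b2 c
      using that flip swapa by auto
    have one_b: "\<Phi> (a1, a2, b1, b2, c) = \<Phi> (a1, a2, 0, b1 + b2 + c, 0)"
      if "b1 = 0 \<and> b2 = 0 \<or> b1 = 0 \<and> c = 0 \<or> b2 = 0 \<and> c = 0" for a1 a2 b1 b2 c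
      using that flipb swapb by auto
    consider (none) "x \<noteq> u" "y \<noteq> u" | (x) "x = u" "y \<noteq> u" | (y) "x \<noteq> u" "y = u" | (xy) "x = u" "y = u"
      by blast
    then show ?thesis
    proof cases
      case none
      then have "x \<noteq> y" using xy uv by auto
      moreover have "c = 0 \<and> c' = 0 \<and> a1 \<noteq> 0 \<and> a2 \<noteq> 0 \<and> b1 \<noteq> 0 \<and> b2 \<noteq> 0 \<and> a1' \<noteq> 0 \<and> a2' \<noteq> 0 \<and> b1' \<noteq> 0 \<and> b2' \<noteq> 0"
        using none uv z z' card \<open>x \<noteq> y\<close>
        by (cases "c = 0"; cases "c' = 0") (auto simp: zeros_def card_insert_if)
      ultimately show ?thesis
        using none uv sel[of "{u, x}"] sel[of "{u, y}"] flip flipb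
        by (auto simp: doubleton_eq_iff mset_pair_eq mset_triple_eq; metis)
    next
      case x
      have nz: "b1 \<noteq> 0 \<and> b2 \<noteq> 0 \<and> b1' \<noteq> 0 \<and> b2' \<noteq> 0"
        using x uv z z' by auto
      have 2: "a1 = 0 \<and> a2 = 0 \<or> a1 = 0 \<and> c = 0 \<or> a2 = 0 \<and> c = 0" "a1' = 0 \<and> a2' = 0 \<or> a1' = 0 \<and> c' = 0 \<or> a2' = 0 \<and> c' = 0"
        using x uv card(1) nz by (cases "a1 = 0"; cases "a2 = 0"; cases "c = 0"; auto simp: zeros_def card_insert_if)
          (use x uv card(2) nz in \<open>cases "a1' = 0"; cases "a2' = 0"; cases "c' = 0"; auto simp: zeros_def card_insert_if\<close>)
      have s: "a1 + a2 + c = a1' + a2' + c'"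
        using sel[of "{u}"] 2 x uv arcs arcs' nz by (auto simp: doubleton_eq_iff split: if_splits)
      have b: "{#b1, b2#} = {#b1', b2'#}"
        using sel[of "{u, y}"] x uv nz by (auto simp: doubleton_eq_iff insert_commute)
      show ?thesis
        unfolding one_a[OF 2(1)] one_a[OF 2(2)] s using b flipb by (auto simp: mset_pair_eq mset_triple_eq)
    next
      case y
      have nz: "a1 \<noteq> 0 \<and> a2 \<noteq> 0 \<and> a1' \<noteq> 0 \<and> a2' \<noteq> 0"
        using y uv z z' by auto
      have 2: "b1 = 0 \<and> b2 = 0 \<or> b1 = 0 \<and> c = 0 \<or> b2 = 0 \<and> c = 0" "b1' = 0 \<and> b2' = 0 \<or> b1' = 0 \<and> c' = 0 \<or> b2' = 0 \<and> c' = 0"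
        using y uv card(1) nz by (cases "b1 = 0"; cases "b2 = 0"; cases "c = 0"; auto simp: zeros_def card_insert_if)
          (use y uv card(2) nz in \<open>cases "b1' = 0"; cases "b2' = 0"; cases "c' = 0"; auto simp: zeros_def card_insert_if\<close>)
      have s: "b1 + b2 + c = b1' + b2' + c'"
        using sel[of "{u}"] 2 y uv arcs arcs' nz by (auto simp: doubleton_eq_iff split: if_splits)
      have a: "{#a1, a2#} = {#a1', a2'#}"
        using sel[of "{u, x}"] y uv nz by (auto simp: doubleton_eq_iff insert_commute)
      show ?thesis
        unfolding one_b[OF 2(1)] one_b[OF 2(2)] s using a flip by (auto simp: mset_pair_eq mset_triple_eq)
    next
      case xy
      \<comment> \<open>All vertices coincide and two loops remain; the moves bring their lengths into standard places.\<close>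
      have normal: "\<exists>r s. r \<noteq> 0 \<and> s \<noteq> 0 \<and> \<Phi> (a1, a2, b1, b2, c) = \<Phi> (0, r, 0, s, 0) \<and>
          filter_mset (\<lambda>r. r \<noteq> 0) {#a1, a2, b1, b2, c#} = {#r, s#}"
        if zz: "zeros (a1, a2, b1, b2, c) = 3" and n: "\<not> (a1 = 0 \<and> a2 = 0 \<and> b1 = 0 \<and> b2 = 0)"
          "\<not> (a1 = 0 \<and> a2 = 0 \<and> c = 0)" "\<not> (b1 = 0 \<and> b2 = 0 \<and> c = 0)" for a1 a2 b1 b2 c
      proof -
        have z3: "of_bool (a1 = 0) + of_bool (a2 = 0) + of_bool (b1 = 0) + of_bool (b2 = 0) + of_bool (c = 0) = (3::nat)"
          using zz by (simp add: zeros_def)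
        consider "b1 = 0" "b2 = 0" "c \<noteq> 0" | "a1 = 0" "a2 = 0" "c \<noteq> 0" | "c = 0" "a1 = 0 \<and> a2 \<noteq> 0 \<or> a2 = 0 \<and> a1 \<noteq> 0" "b1 = 0 \<and> b2 \<noteq> 0 \<or> b2 = 0 \<and> b1 \<noteq> 0"
          using z3 n
          by (cases "a1 = 0"; cases "a2 = 0"; cases "b1 = 0"; cases "b2 = 0"; cases "c = 0"; simp)
        then show ?thesis
        proof cases
          case 1
          then have a: "a1 = 0 \<and> a2 \<noteq> 0 \<or> a2 = 0 \<and> a1 \<noteq> 0"
            using z3 n by (cases "a1 = 0"; cases "a2 = 0"; simp)
          have "\<Phi> (a1, a2, b1, b2, c) = \<Phi> (a1, a2, 0, c, 0)"
            using one_b[of b1 b2 c a1 a2] 1 by simp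
          also have "\<dots> = \<Phi> (0, a1 + a2, 0, c, 0)"
            using one_a[of a1 a2 0 0 c] a by auto
          finally show ?thesis
            using a 1 by (intro exI[of _ "a1 + a2"] exI[of _ c]) auto
        next
          case 2
          then have b: "b1 = 0 \<and> b2 \<noteq> 0 \<or> b2 = 0 \<and> b1 \<noteq> 0"
            using z3 n by (cases "b1 = 0"; cases "b2 = 0"; simp)
          have "\<Phi> (a1, a2, b1, b2, c) = \<Phi> (0, c, b1, b2, 0)"
            using one_a[of a1 a2 c b1 b2] 2 by simp
          also have "\<dots> = \<Phi> (0, c, 0, b1 + b2, 0)"
            using one_b[of b1 b2 0 0 c] b by auto
          finally show ?thesis
            using b 2 by (intro exI[of _ c] exI[of _ "b1 + b2"]) auto
        next
          case 3
          have "\<Phi> (a1, a2, b1, b2, c) = \<Phi> (0, a1 + a2, b1, b2, 0)"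
            using one_a[of a1 a2 c b1 b2] 3 by auto
          also have "\<dots> = \<Phi> (0, a1 + a2, 0, b1 + b2, 0)"
            using one_b[of b1 b2 0 0 "a1 + a2"] 3 by auto
          finally show ?thesis
            using 3 by (intro exI[of _ "a1 + a2"] exI[of _ "b1 + b2"]) auto
        qed
      qed
      have com: "\<Phi> (0, r, 0, s, 0) = \<Phi> (0, s, 0, r, 0)" for r s
        by (metis swapa swapb)
      have z3: "zeros (a1, a2, b1, b2, c) = 3" "zeros (a1', a2', b1', b2', c') = 3"
        using card xy uv by auto
      obtain r s where rs: "\<Phi> (a1, a2, b1, b2, c) = \<Phi> (0, r, 0, s, 0)"
          "filter_mset (\<lambda>r. r \<noteq> 0) {#a1, a2, b1, b2, c#} = {#r, s#}"
        using normal[OF z3(1) arcs] by blast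
      obtain r' s' where rs': "\<Phi> (a1', a2', b1', b2', c') = \<Phi> (0, r', 0, s', 0)"
          "filter_mset (\<lambda>r. r \<noteq> 0) {#a1', a2', b1', b2', c'#} = {#r', s'#}"
        using normal[OF z3(2) arcs'] by blast
      have "{#r, s#} = {#r', s'#}"
        unfolding rs(2)[symmetric] rs'(2)[symmetric] using sel[of "{u}"] xy uv by simp
      then show ?thesis
        using rs(1) rs'(1) com by (auto simp: mset_pair_eq mset_triple_eq)
    qed
  qed
qed

lemma A_data_facts:
  assumes card: "card {u, v, x, y} + zeros (a1, a2, a3, b, c) = 4"
    and z: "a2 = 0 \<longrightarrow> x = y" "b = 0 \<longrightarrow> u = v" "c = 0 \<longrightarrow> u = v"
    and nz: "a1 \<noteq> 0" "a3 \<noteq> 0" "\<not> (b = 0 \<and> c = 0)"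
  shows "x \<notin> {u, v}" "y \<notin> {u, v}" "x = y \<longleftrightarrow> a2 = 0" "u = v \<longleftrightarrow> b = 0 \<or> c = 0"
proof -
  have "x \<notin> {u, v} \<and> y \<notin> {u, v} \<and> (x = y \<longleftrightarrow> a2 = 0) \<and> (u = v \<longleftrightarrow> b = 0 \<or> c = 0)"
    using card z nz
    by (cases "a2 = 0"; cases "b = 0"; cases "c = 0") (auto simp: zeros_def card_insert_if split: if_splits)
  then show "x \<notin> {u, v}" "y \<notin> {u, v}" "x = y \<longleftrightarrow> a2 = 0" "u = v \<longleftrightarrow> b = 0 \<or> c = 0"
    by auto
qed

text \<open>If \<open>a1\<close> and \<open>a3\<close> are nonzero, then both marks lie in the interior of their arc; in the other cases the
  curve is modelled by \<open>graph_B\<close> as well. The branch vertex adjacent to \<open>x\<close> is \<open>u\<close>, which fixes the roles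
  of \<open>u\<close> and \<open>v\<close>, unless \<open>x = y\<close>.\<close>

lemma A_data_determines_lengths:
  assumes swap: "\<And>a1 a2 a3 b c. \<Phi> (a1, a2, a3, b, c) = \<Phi> (a1, a2, a3, c, b)"
    and fold: "\<And>a1 a3 b c. \<Phi> (a1, 0, a3, b, c) = \<Phi> (a3, 0, a1, b, c)"
    and card: "card {u, v, x, y} + zeros (a1, a2, a3, b, c) = 4" "card {u, v, x, y} + zeros (a1', a2', a3', b', c') = 4"
    and z: "a2 = 0 \<longrightarrow> x = y" "b = 0 \<longrightarrow> u = v" "c = 0 \<longrightarrow> u = v"
    and z': "a2' = 0 \<longrightarrow> x = y" "b' = 0 \<longrightarrow> u = v" "c' = 0 \<longrightarrow> u = v"
    and nz: "a1 \<noteq> 0" "a3 \<noteq> 0" "\<not> (b = 0 \<and> c = 0)"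
    and nz': "a1' \<noteq> 0" "a3' \<noteq> 0" "\<not> (b' = 0 \<and> c' = 0)"
    and uv': "u' = u \<and> v' = v \<or> u' = v \<and> v' = u"
    and eq: "A_data u v x y (a1, a2, a3, b, c) = A_data u' v' x y (a1', a2', a3', b', c')"
  shows "\<Phi> (a1, a2, a3, b, c) = \<Phi> (a1', a2', a3', b', c')"
proof -
  note f = A_data_facts[OF card(1) z nz]
  note f' = A_data_facts[OF card(2) z' nz']
  note sel = arg_cong[OF eq, of "lengths_at s" for s, unfolded A_data_def prod.case lengths_at_filter]
  have "lengths_at {u, v} {#({u, x}, a1), ({x, y}, a2), ({y, v}, a3), ({u, v}, b), ({u, v}, c)#} = {#b, c#}"
    using f(1,2) by (auto simp: doubleton_eq_iff)
  moreover have "lengths_at {u, v} {#({u', x}, a1'), ({x, y}, a2'), ({y, v'}, a3'), ({u', v'}, b'), ({u', v'}, c')#} = {#b', c'#}"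
    using f(1,2) uv' by (elim disjE) (auto simp: doubleton_eq_iff)
  ultimately have "filter_mset (\<lambda>r. r \<noteq> 0) {#b, c#} = filter_mset (\<lambda>r. r \<noteq> 0) {#b', c'#}"
    using sel[of "{u, v}"] by simp
  then have bc: "b = b' \<and> c = c' \<or> b = c' \<and> c = b'"
    using f(4) f'(4) nz(3) nz'(3)
    by (cases "b = 0"; cases "c = 0"; cases "b' = 0"; cases "c' = 0") (auto simp: mset_pair_eq)
  show ?thesis
  proof (cases "x = y")
    case True
    then have a2: "a2 = 0" "a2' = 0" using f f' by auto
    have "a1 = a1' \<and> a3 = a3' \<or> a1 = a3' \<and> a3 = a1'"
    proof (cases "u = v")
      case uv: True
      then show ?thesis
        using sel[of "{u, x}"] True f uv' nz nz' a2 by (auto simp: doubleton_eq_iff insert_commute mset_pair_eq)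
    next
      case uv: False
      then show ?thesis
        using sel[of "{u, x}"] sel[of "{v, x}"] True f uv' nz nz' a2
        by (auto simp: doubleton_eq_iff insert_commute)
    qed
    then show ?thesis
      using bc fold swap by (auto simp: a2)
  next
    case False
    then have a2: "a2 \<noteq> 0" "a2' \<noteq> 0" using f f' by auto
    have "u' = u \<and> v' = v"
      using sel[of "{u, x}"] False f uv' nz nz' by (auto simp: doubleton_eq_iff split: if_splits)
    then have "a1 = a1' \<and> a2 = a2' \<and> a3 = a3'"
      using sel[of "{u, x}"] sel[of "{x, y}"] sel[of "{y, v}"] False f nz nz' a2
      by (auto simp: doubleton_eq_iff split: if_splits)
    then show ?thesis
      using bc swap by auto
  qed
qed

text \<open>A mark inside an arc has two edges, and in the model B their other ends are branch vertices for both
  marks. This forces \<open>x = y\<close> in the model A, which is impossible for different arcs.\<close>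

lemma A_data_neq_B_data:
  assumes card: "card {u, v, x, y} + zeros (a1, a2, a3, b, c) = 4" "card {u, v, x, y} + zeros (a1', a2', b1', b2', c') = 4"
    and z: "a2 = 0 \<longrightarrow> x = y" "b = 0 \<longrightarrow> u = v" "c = 0 \<longrightarrow> u = v"
    and z': "a1' = 0 \<longrightarrow> u' = x" "a2' = 0 \<longrightarrow> x = v'" "b1' = 0 \<longrightarrow> u' = y" "b2' = 0 \<longrightarrow> y = v'"
      "c' = 0 \<longrightarrow> u' = v'"
    and nz: "a1 \<noteq> 0" "a3 \<noteq> 0" "\<not> (b = 0 \<and> c = 0)"
    and uv': "u' = u \<and> v' = v \<or> u' = v \<and> v' = u"
  shows "A_data u v x y (a1, a2, a3, b, c) \<noteq> B_data u' v' x y (a1', a2', b1', b2', c')"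
proof
  assume eq: "A_data u v x y (a1, a2, a3, b, c) = B_data u' v' x y (a1', a2', b1', b2', c')"
  note f = A_data_facts[OF card(1) z nz]
  note sel = arg_cong[OF eq, of "lengths_at s" for s, unfolded A_data_def B_data_def prod.case lengths_at_filter]
  have nz': "a1' \<noteq> 0" "a2' \<noteq> 0" "b1' \<noteq> 0" "b2' \<noteq> 0"
    using f(1,2) z' uv' by auto
  have "x \<noteq> y"
  proof
    assume "x = y"
    then show False
      using card(2) f(1,2,4) nz nz' z'(5) uv' by (cases "u = v"; cases "c' = 0") (auto simp: zeros_def card_insert_if split: if_splits)
  qed
  then have "a2 \<noteq> 0" using f(3) by simp
  then show False
    using sel[of "{x, y}"] \<open>x \<noteq> y\<close> f(1,2) uv' by (auto simp: doubleton_eq_iff split: if_splits)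
qed

lemma model_data:
  assumes "edges G = {0,1,2,3,4}"
  shows "image_mset (\<lambda>e. (h ` ends G e, lens (l0, l1, l2, l3, l4) e)) (mset_set (edges G - zero_edges G (lens (l0, l1, l2, l3, l4)))) =
    filter_mset (\<lambda>p. snd p \<noteq> 0) {#(h ` ends G 0, l0), (h ` ends G (Suc 0), l1), (h ` ends G 2, l2), (h ` ends G 3, l3), (h ` ends G 4, l4)#}"
proof -
  let ?l = "lens (l0, l1, l2, l3, l4)"
  have fin: "finite (edges G)" by (simp add: assms)
  have "edges G - zero_edges G ?l = {e \<in> edges G. ?l e \<noteq> 0}"
    by (auto simp: zero_edges_def)
  then have "image_mset (\<lambda>e. (h ` ends G e, ?l e)) (mset_set (edges G - zero_edges G ?l)) =
      image_mset (\<lambda>e. (h ` ends G e, ?l e)) (filter_mset ((\<lambda>p. snd p \<noteq> 0) \<circ> (\<lambda>e. (h ` ends G e, ?l e))) (mset_set (edges G)))"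
    by (simp only: filter_mset_mset_set[OF fin] o_def snd_conv)
  also have "\<dots> = filter_mset (\<lambda>p. snd p \<noteq> 0) (image_mset (\<lambda>e. (h ` ends G e, ?l e)) (mset_set {0,1,2,3,4}))"
    by (simp only: filter_mset_image_mset assms o_def)
  also have "mset_set {0::nat,1,2,3,4} = {#0, Suc 0, 2, 3, 4#}"
    by simp
  finally show ?thesis
    by (simp only: image_mset_add_mset image_mset_empty lens_simps)
qed

lemma card_zero_edges_lens:
  assumes "edges G = {0,1,2,3,4}"
  shows "card (zero_edges G (lens l)) = zeros l"
proof -
  obtain l0 l1 l2 l3 l4 where l: "l = (l0, l1, l2, l3, l4)" by (cases l)
  have "zero_edges G (lens l) = {0,1,2,3,4} \<inter> {e. lens l e = 0}"
    by (auto simp: zero_edges_def assms)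
  moreover have "card ({0,1,2,3,4} \<inter> {e. lens l e = 0}) = (\<Sum>e\<in>{0,1,2,3,4}. of_bool (lens l e = 0))"
    by (subst sum_of_bool_eq) simp_all
  ultimately show ?thesis
    by (simp add: l zeros_def lens_simps)
qed

text \<open>The branch vertices can be read off from the curve: valency minus 2 counts how many of the two
  branch vertices of the model go to a given vertex, by additivity under contraction.\<close>

lemma model_branch_vertices:
  assumes C: "degenerate_curve 2 2 (G, lens l, model_marking)"
    and G: "edges G = {0,1,2,3,4}" "verts G = {0,1,2,3}"
      "valency G 0 = 3" "valency G (Suc 0) = 3" "valency G 2 = 2" "valency G 3 = 2"
    and t: "tropical_curve 2 2 (H, m, q)"
    and h: "contraction_map 2 (G, lens l, model_marking) (H, m, q) h \<epsilon>"
  shows "card (verts H) + zeros l = 4"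
    and "w \<in> verts H \<Longrightarrow> int (valency H w) - 2 = of_bool (h 0 = w) + of_bool (h (Suc 0) = w)"
proof -
  interpret contraction_of G H "zero_edges G (lens l)" h \<epsilon>
    by (rule contraction_map_contraction_of[OF C _ h]) (use t in \<open>auto simp: tropical_curve_def\<close>)
  have f: "forest G (zero_edges G (lens l))"
    using C by (simp add: degenerate_curve_def)
  show "card (verts H) + zeros l = 4"
    using card_verts[OF f] card_zero_edges_lens[OF G(1)] by (simp add: G(2))
  assume w: "w \<in> verts H"
  have fin: "finite (verts G)"
    by (simp add: G)
  have "int (valency H w) - 2 = (\<Sum>v\<in>verts G. if h v = w then int (valency G v) - 2 else 0)"
    unfolding valency_contraction[OF f w] by (rule sum.inter_filter[OF fin])
  then show "int (valency H w) - 2 = of_bool (h 0 = w) + of_bool (h (Suc 0) = w)"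
    by (simp add: G of_bool_def)
qed

lemma ex_contraction_map_iff:
  assumes C: "degenerate_curve g n (G, l, p)" and t: "tropical_curve g n (H, m, q)"
  shows "(\<exists>\<epsilon>. contraction_map n (G, l, p) (H, m, q) h \<epsilon>) \<longleftrightarrow>
    h ` verts G = verts H \<and> (\<forall>i\<in>{1..n}. q i = h (p i)) \<and>
      (\<forall>e\<in>zero_edges G l. \<forall>u v. ends G e = {u, v} \<longrightarrow> h u = h v) \<and>
      edge_data (H, m, q) = image_mset (\<lambda>e. (h ` ends G e, l e)) (mset_set (edges G - zero_edges G l))"
proof -
  have fin: "finite (edges G - zero_edges G l)" "finite (edges H)"
    using t C by (auto simp: tropical_curve_def degenerate_curve_def combinatorial_type_def finite_multigraph_def)
  have "edge_data (H, m, q) = image_mset (\<lambda>e. (h ` ends G e, l e)) (mset_set (edges G - zero_edges G l)) \<longleftrightarrow>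
     (\<exists>\<epsilon>. bij_betw \<epsilon> (edges G - zero_edges G l) (edges H) \<and>
       (\<forall>e\<in>edges G - zero_edges G l. ends H (\<epsilon> e) = h ` ends G e \<and> m (\<epsilon> e) = l e))"
    unfolding edge_data_def prod.case eq_commute[of "image_mset _ (mset_set (edges H))"]
    by (subst image_mset_eq_iff_bij[OF fin]) simp
  then show ?thesis
    unfolding contraction_map_def prod.case by auto
qed

lemma ex_contraction_map_model_iff:
  assumes C: "degenerate_curve 2 2 (G, lens (l0, l1, l2, l3, l4), model_marking)"
    and G: "edges G = {0,1,2,3,4}" "verts G = {0,1,2,3}"
    and t: "tropical_curve 2 2 (H, m, q)"
  shows "(\<exists>\<epsilon>. contraction_map 2 (G, lens (l0, l1, l2, l3, l4), model_marking) (H, m, q) h \<epsilon>) \<longleftrightarrow>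
    h ` {0,1,2,3} = verts H \<and> q 1 = h 2 \<and> q 2 = h 3 \<and>
      (\<forall>e\<in>{0,1,2,3,4}. lens (l0, l1, l2, l3, l4) e = 0 \<longrightarrow> (\<forall>u v. ends G e = {u, v} \<longrightarrow> h u = h v)) \<and>
      edge_data (H, m, q) = filter_mset (\<lambda>p. snd p \<noteq> 0) {#(h ` ends G 0, l0), (h ` ends G (Suc 0), l1), (h ` ends G 2, l2), (h ` ends G 3, l3), (h ` ends G 4, l4)#}"
proof -
  have 1: "(\<forall>i\<in>{1..2}. q i = h (model_marking i)) \<longleftrightarrow> q 1 = h 2 \<and> q 2 = h 3"
    unfolding atLeastAtMost_1_2 by (simp add: model_marking_simps)
  have 2: "(\<forall>e\<in>zero_edges G (lens (l0, l1, l2, l3, l4)). P e) \<longleftrightarrow> (\<forall>e\<in>{0,1,2,3,4}. lens (l0, l1, l2, l3, l4) e = 0 \<longrightarrow> P e)" for P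
    by (auto simp: zero_edges_def G)
  show ?thesis
    unfolding ex_contraction_map_iff[OF C t] 1 2 model_data[OF G(1)] unfolding G(2) by blast
qed

text \<open>The curve is the contraction of \<open>graph_B\<close> with these lengths, where \<open>u\<close> and \<open>v\<close> are the images of the
  branch vertices; the marks of the curve determine the other two images.\<close>

definition fits_B :: "('v, 'e) curve \<Rightarrow> 'v \<Rightarrow> 'v \<Rightarrow> lengths \<Rightarrow> bool" where
  "fits_B = (\<lambda>(H, m, q) u v (a1, a2, b1, b2, c). verts H = {u, v, q 1, q 2} \<and>
     (a1 = 0 \<longrightarrow> u = q 1) \<and> (a2 = 0 \<longrightarrow> q 1 = v) \<and> (b1 = 0 \<longrightarrow> u = q 2) \<and> (b2 = 0 \<longrightarrow> q 2 = v) \<and>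
     (c = 0 \<longrightarrow> u = v) \<and> edge_data (H, m, q) = B_data u v (q 1) (q 2) (a1, a2, b1, b2, c))"

definition fits_A :: "('v, 'e) curve \<Rightarrow> 'v \<Rightarrow> 'v \<Rightarrow> lengths \<Rightarrow> bool" where
  "fits_A = (\<lambda>(H, m, q) u v (a1, a2, a3, b, c). verts H = {u, v, q 1, q 2} \<and>
     (a1 = 0 \<longrightarrow> u = q 1) \<and> (a2 = 0 \<longrightarrow> q 1 = q 2) \<and> (a3 = 0 \<longrightarrow> q 2 = v) \<and> (b = 0 \<longrightarrow> u = v) \<and>
     (c = 0 \<longrightarrow> u = v) \<and> edge_data (H, m, q) = A_data u v (q 1) (q 2) (a1, a2, a3, b, c))"

lemma pair_const: "(\<forall>u v. {a, b} = {u, v} \<longrightarrow> h u = h v) \<longleftrightarrow> h a = h b"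
  by (auto simp: doubleton_eq_iff)

lemma fits_B_contraction_map:
  assumes l: "l \<in> cell_B" and t: "tropical_curve 2 2 (H, m, q)" and h: "h 2 = q 1" "h 3 = q 2"
  shows "(\<exists>\<epsilon>. contraction_map 2 (graph_B, lens l, model_marking) (H, m, q) h \<epsilon>) \<longleftrightarrow> fits_B (H, m, q) (h 0) (h (Suc 0)) l"
proof -
  obtain a1 a2 b1 b2 c where l': "l = (a1, a2, b1, b2, c)" by (cases l)
  have C: "degenerate_curve 2 2 (graph_B, lens (a1, a2, b1, b2, c), model_marking)"
    using l degenerate_curve_graph_B by (simp add: l')
  have z: "(\<forall>e\<in>{0,1,2,3,4}. lens (a1, a2, b1, b2, c) e = 0 \<longrightarrow> (\<forall>u v. ends graph_B e = {u, v} \<longrightarrow> h u = h v)) \<longleftrightarrow>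
      (a1 = 0 \<longrightarrow> h 0 = h 2) \<and> (a2 = 0 \<longrightarrow> h 2 = h (Suc 0)) \<and> (b1 = 0 \<longrightarrow> h 0 = h 3) \<and> (b2 = 0 \<longrightarrow> h 3 = h (Suc 0)) \<and>
      (c = 0 \<longrightarrow> h 0 = h (Suc 0))"
    by (simp add: lens_simps ends_graph_B pair_const)
  have d: "filter_mset (\<lambda>p. snd p \<noteq> 0) {#(h ` ends graph_B 0, a1), (h ` ends graph_B (Suc 0), a2), (h ` ends graph_B 2, b1), (h ` ends graph_B 3, b2), (h ` ends graph_B 4, c)#} =
      B_data (h 0) (h (Suc 0)) (h 2) (h 3) (a1, a2, b1, b2, c)"
    unfolding B_data_def prod.case by (simp only: ends_graph_B image_insert image_empty)
  have im: "h ` {0, 1, 2, 3} = {h 0, h (Suc 0), h 2, h 3}"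
    by simp
  show ?thesis
    unfolding l' ex_contraction_map_model_iff[OF C edges_graph_AB(2,4) t] z d im fits_B_def prod.case h
    by auto
qed

lemma mem_curve_B:
  assumes l: "l \<in> cell_B"
  shows "(H, m, q) \<in> curve_B l \<longleftrightarrow> tropical_curve 2 2 (H, m, q) \<and> (\<exists>u v. fits_B (H, m, q) u v l)"
proof (cases "tropical_curve 2 2 (H, m, q)")
  case True
  note C = degenerate_curve_graph_B[THEN iffD2, OF l]
  show ?thesis
  proof
    assume "(H, m, q) \<in> curve_B l"
    then obtain h \<epsilon> where h: "contraction_map 2 (graph_B, lens l, model_marking) (H, m, q) h \<epsilon>"
      unfolding curve_B_def mem_TM_map[OF C] by blast
    then have "h 2 = q 1" "h 3 = q 2"
      unfolding contraction_map_def atLeastAtMost_1_2 by (auto simp: model_marking_simps)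
    then show "tropical_curve 2 2 (H, m, q) \<and> (\<exists>u v. fits_B (H, m, q) u v l)"
      using fits_B_contraction_map[OF l True] h True by blast
  next
    assume "tropical_curve 2 2 (H, m, q) \<and> (\<exists>u v. fits_B (H, m, q) u v l)"
    then obtain u v where uv: "fits_B (H, m, q) u v l" by blast
    define h where "h k = (if k = 0 then u else if k = 1 then v else if k = 2 then q 1 else q 2)" for k :: nat
    have "\<exists>\<epsilon>. contraction_map 2 (graph_B, lens l, model_marking) (H, m, q) h \<epsilon>"
      using uv by (subst fits_B_contraction_map[OF l True]) (simp_all add: h_def)
    then show "(H, m, q) \<in> curve_B l"
      unfolding curve_B_def mem_TM_map[OF C] using True by blast
  qed
qed (simp add: mem_TM_map[OF degenerate_curve_graph_B[THEN iffD2, OF l]] curve_B_def)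

lemma fits_B_branch:
  assumes l: "l \<in> cell_B" and t: "tropical_curve 2 2 (H, m, q)" and f: "fits_B (H, m, q) u v l"
  shows "card (verts H) + zeros l = 4"
    and "w \<in> verts H \<Longrightarrow> int (valency H w) - 2 = of_bool (u = w) + of_bool (v = w)"
proof -
  define h where "h k = (if k = 0 then u else if k = 1 then v else if k = 2 then q 1 else q 2)" for k :: nat
  have "\<exists>\<epsilon>. contraction_map 2 (graph_B, lens l, model_marking) (H, m, q) h \<epsilon>"
    using f by (subst fits_B_contraction_map[OF l t]) (simp_all add: h_def)
  then obtain \<epsilon> where e: "contraction_map 2 (graph_B, lens l, model_marking) (H, m, q) h \<epsilon>" ..
  note * = model_branch_vertices[OF degenerate_curve_graph_B[THEN iffD2, OF l] edges_graph_AB(2,4) valency_graph_B t e]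
  show "card (verts H) + zeros l = 4"
    by (rule *(1))
  show "int (valency H w) - 2 = of_bool (u = w) + of_bool (v = w)" if "w \<in> verts H"
    using *(2)[OF that] by (simp add: h_def)
qed

lemma fits_A_contraction_map:
  assumes l: "l \<in> cell_A" and t: "tropical_curve 2 2 (H, m, q)" and h: "h 2 = q 1" "h 3 = q 2"
  shows "(\<exists>\<epsilon>. contraction_map 2 (graph_A, lens l, model_marking) (H, m, q) h \<epsilon>) \<longleftrightarrow> fits_A (H, m, q) (h 0) (h (Suc 0)) l"
proof -
  obtain a1 a2 a3 b c where l': "l = (a1, a2, a3, b, c)" by (cases l)
  have C: "degenerate_curve 2 2 (graph_A, lens (a1, a2, a3, b, c), model_marking)"
    using l degenerate_curve_graph_A by (simp add: l')
  have z: "(\<forall>e\<in>{0,1,2,3,4}. lens (a1, a2, a3, b, c) e = 0 \<longrightarrow> (\<forall>u v. ends graph_A e = {u, v} \<longrightarrow> h u = h v)) \<longleftrightarrow>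
      (a1 = 0 \<longrightarrow> h 0 = h 2) \<and> (a2 = 0 \<longrightarrow> h 2 = h 3) \<and> (a3 = 0 \<longrightarrow> h 3 = h (Suc 0)) \<and> (b = 0 \<longrightarrow> h 0 = h (Suc 0)) \<and>
      (c = 0 \<longrightarrow> h 0 = h (Suc 0))"
    by (simp add: lens_simps ends_graph_A pair_const)
  have d: "filter_mset (\<lambda>p. snd p \<noteq> 0) {#(h ` ends graph_A 0, a1), (h ` ends graph_A (Suc 0), a2), (h ` ends graph_A 2, a3), (h ` ends graph_A 3, b), (h ` ends graph_A 4, c)#} =
      A_data (h 0) (h (Suc 0)) (h 2) (h 3) (a1, a2, a3, b, c)"
    unfolding A_data_def prod.case by (simp only: ends_graph_A image_insert image_empty)
  have im: "h ` {0, 1, 2, 3} = {h 0, h (Suc 0), h 2, h 3}"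
    by simp
  show ?thesis
    unfolding l' ex_contraction_map_model_iff[OF C edges_graph_AB(1,3) t] z d im fits_A_def prod.case h
    by auto
qed

lemma mem_curve_A:
  assumes l: "l \<in> cell_A"
  shows "(H, m, q) \<in> curve_A l \<longleftrightarrow> tropical_curve 2 2 (H, m, q) \<and> (\<exists>u v. fits_A (H, m, q) u v l)"
proof (cases "tropical_curve 2 2 (H, m, q)")
  case True
  note C = degenerate_curve_graph_A[THEN iffD2, OF l]
  show ?thesis
  proof
    assume "(H, m, q) \<in> curve_A l"
    then obtain h \<epsilon> where h: "contraction_map 2 (graph_A, lens l, model_marking) (H, m, q) h \<epsilon>"
      unfolding curve_A_def mem_TM_map[OF C] by blast
    then have "h 2 = q 1" "h 3 = q 2"
      unfolding contraction_map_def atLeastAtMost_1_2 by (auto simp: model_marking_simps)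
    then show "tropical_curve 2 2 (H, m, q) \<and> (\<exists>u v. fits_A (H, m, q) u v l)"
      using fits_A_contraction_map[OF l True] h True by blast
  next
    assume "tropical_curve 2 2 (H, m, q) \<and> (\<exists>u v. fits_A (H, m, q) u v l)"
    then obtain u v where uv: "fits_A (H, m, q) u v l" by blast
    define h where "h k = (if k = 0 then u else if k = 1 then v else if k = 2 then q 1 else q 2)" for k :: nat
    have "\<exists>\<epsilon>. contraction_map 2 (graph_A, lens l, model_marking) (H, m, q) h \<epsilon>"
      using uv by (subst fits_A_contraction_map[OF l True]) (simp_all add: h_def)
    then show "(H, m, q) \<in> curve_A l"
      unfolding curve_A_def mem_TM_map[OF C] using True by blast
  qed
qed (simp add: mem_TM_map[OF degenerate_curve_graph_A[THEN iffD2, OF l]] curve_A_def)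

lemma fits_A_branch:
  assumes l: "l \<in> cell_A" and t: "tropical_curve 2 2 (H, m, q)" and f: "fits_A (H, m, q) u v l"
  shows "card (verts H) + zeros l = 4"
    and "w \<in> verts H \<Longrightarrow> int (valency H w) - 2 = of_bool (u = w) + of_bool (v = w)"
proof -
  define h where "h k = (if k = 0 then u else if k = 1 then v else if k = 2 then q 1 else q 2)" for k :: nat
  have "\<exists>\<epsilon>. contraction_map 2 (graph_A, lens l, model_marking) (H, m, q) h \<epsilon>"
    using f by (subst fits_A_contraction_map[OF l t]) (simp_all add: h_def)
  then obtain \<epsilon> where e: "contraction_map 2 (graph_A, lens l, model_marking) (H, m, q) h \<epsilon>" ..
  note * = model_branch_vertices[OF degenerate_curve_graph_A[THEN iffD2, OF l] edges_graph_AB(1,3) valency_graph_A t e]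
  show "card (verts H) + zeros l = 4"
    by (rule *(1))
  show "int (valency H w) - 2 = of_bool (u = w) + of_bool (v = w)" if "w \<in> verts H"
    using *(2)[OF that] by (simp add: h_def)
qed

lemma fits_verts:
  "fits_B (H, m, q) u v l \<Longrightarrow> u \<in> verts H \<and> v \<in> verts H"
  "fits_A (H, m, q) u v l \<Longrightarrow> u \<in> verts H \<and> v \<in> verts H"
  by (cases l, simp add: fits_B_def, cases l, simp add: fits_A_def)

text \<open>An unordered pair is determined by its indicator counted with multiplicity.\<close>

lemma branch_eq:
  assumes "\<And>w. w \<in> V \<Longrightarrow> of_bool (u = w) + of_bool (v = w) = (of_bool (u' = w) + of_bool (v' = w) :: int)"
    and "{u, v, u', v'} \<subseteq> V"
  shows "u' = u \<and> v' = v \<or> u' = v \<and> v' = u"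
  using assms(1)[of u] assms(1)[of v] assms(2) by (auto simp: of_bool_def split: if_splits)

text \<open>The moves: each of them rearranges the edge data without changing it.\<close>

lemma fits_B_iota: "fits_B D u v (a1, a2, b1, b2, c) \<Longrightarrow> fits_B D v u (a2, a1, b2, b1, c)"
  by (cases D) (auto simp: fits_B_def B_data_def insert_commute add_mset_commute)

lemma fits_B_flip: "fits_B D u v (a1, a2, b1, b2, 0) \<Longrightarrow> fits_B D u v (a2, a1, b1, b2, 0)"
  by (cases D) (auto simp: fits_B_def B_data_def insert_commute add_mset_commute)

lemma fits_B_swap_a: "fits_B D u v (0, a2, b1, b2, c) \<Longrightarrow> fits_B D u v (0, c, b1, b2, a2)"
  by (cases D) (auto simp: fits_B_def B_data_def insert_commute add_mset_commute)

lemma fits_B_swap_b: "fits_B D u v (a1, a2, 0, b2, c) \<Longrightarrow> fits_B D u v (a1, a2, 0, c, b2)"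
  by (cases D) (auto simp: fits_B_def B_data_def insert_commute add_mset_commute)

lemma fits_A_swap: "fits_A D u v (a1, a2, a3, b, c) \<Longrightarrow> fits_A D u v (a1, a2, a3, c, b)"
  by (cases D) (auto simp: fits_A_def A_data_def insert_commute add_mset_commute)

lemma fits_A_fold: "fits_A D u v (a1, 0, a3, b, c) \<Longrightarrow> fits_A D v u (a3, 0, a1, b, c)"
  by (cases D) (auto simp: fits_A_def A_data_def insert_commute add_mset_commute)

lemma fits_A_B_first: "fits_A D u v (0, a2, a3, b, c) \<Longrightarrow> fits_B D u v (0, b, a2, a3, c)"
  by (cases D) (auto simp: fits_A_def A_data_def fits_B_def B_data_def insert_commute add_mset_commute)

lemma fits_A_B_last: "fits_A D u v (a1, a2, 0, b, c) \<Longrightarrow> fits_B D u v (a1, a2, b, 0, c)"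
  by (cases D) (auto simp: fits_A_def A_data_def fits_B_def B_data_def insert_commute add_mset_commute)

lemma curve_B_eqI:
  assumes "l \<in> cell_B" "l' \<in> cell_B" "\<And>D u v. fits_B D u v l \<Longrightarrow> \<exists>u v. fits_B (D :: (nat, nat) curve) u v l'"
  shows "curve_B l = curve_B l'"
proof -
  obtain D where D: "D \<in> curve_B l"
    using TM_map_nonempty[OF degenerate_curve_graph_B[THEN iffD2, OF assms(1)]] by (auto simp: curve_B_def)
  obtain H m q where [simp]: "D = (H, m, q)" by (cases D)
  have "D \<in> curve_B l'"
    using D mem_curve_B assms by auto
  then show ?thesis
    using D unfolding curve_B_def
    by (intro TM_map_eqI[of _ _ _ _ _ _ _ _ D] degenerate_curve_graph_B[THEN iffD2] assms(1,2))
qed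

lemma curve_A_eqI:
  assumes "l \<in> cell_A" "l' \<in> cell_A" "\<And>D u v. fits_A D u v l \<Longrightarrow> \<exists>u v. fits_A (D :: (nat, nat) curve) u v l'"
  shows "curve_A l = curve_A l'"
proof -
  obtain D where D: "D \<in> curve_A l"
    using TM_map_nonempty[OF degenerate_curve_graph_A[THEN iffD2, OF assms(1)]] by (auto simp: curve_A_def)
  obtain H m q where [simp]: "D = (H, m, q)" by (cases D)
  have "D \<in> curve_A l'"
    using D mem_curve_A assms by auto
  then show ?thesis
    using D unfolding curve_A_def
    by (intro TM_map_eqI[of _ _ _ _ _ _ _ _ D] degenerate_curve_graph_A[THEN iffD2] assms(1,2))
qed

lemma curve_A_B_eqI:
  assumes "l \<in> cell_A" "l' \<in> cell_B" "\<And>D u v. fits_A D u v l \<Longrightarrow> \<exists>u v. fits_B (D :: (nat, nat) curve) u v l'"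
  shows "curve_A l = curve_B l'"
proof -
  obtain D where D: "D \<in> curve_A l"
    using TM_map_nonempty[OF degenerate_curve_graph_A[THEN iffD2, OF assms(1)]] by (auto simp: curve_A_def)
  obtain H m q where [simp]: "D = (H, m, q)" by (cases D)
  have "D \<in> curve_B l'"
    using D mem_curve_A mem_curve_B assms by auto
  then show ?thesis
    using D unfolding curve_A_def curve_B_def
    by (intro TM_map_eqI[of _ _ _ _ _ _ _ _ D] degenerate_curve_graph_A[THEN iffD2] degenerate_curve_graph_B[THEN iffD2] assms(1,2))
qed

lemma curve_B_iota: "(a1, a2, b1, b2, c) \<in> cell_B \<Longrightarrow> curve_B (a1, a2, b1, b2, c) = curve_B (a2, a1, b2, b1, c)"
  by (rule curve_B_eqI) (auto simp: cell_B_def add.commute dest: fits_B_iota)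

lemma curve_B_flip: "(a1, a2, b1, b2, 0) \<in> cell_B \<Longrightarrow> curve_B (a1, a2, b1, b2, 0) = curve_B (a2, a1, b1, b2, 0)"
  by (rule curve_B_eqI) (auto simp: cell_B_def add.commute dest: fits_B_flip)

lemma curve_B_swap_a: "(0, a2, b1, b2, c) \<in> cell_B \<Longrightarrow> curve_B (0, a2, b1, b2, c) = curve_B (0, c, b1, b2, a2)"
  by (rule curve_B_eqI) (auto simp: cell_B_def dest: fits_B_swap_a)

lemma curve_B_swap_b: "(a1, a2, 0, b2, c) \<in> cell_B \<Longrightarrow> curve_B (a1, a2, 0, b2, c) = curve_B (a1, a2, 0, c, b2)"
  by (rule curve_B_eqI) (auto simp: cell_B_def dest: fits_B_swap_b)

lemma curve_A_swap: "(a1, a2, a3, b, c) \<in> cell_A \<Longrightarrow> curve_A (a1, a2, a3, b, c) = curve_A (a1, a2, a3, c, b)"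
  by (rule curve_A_eqI) (auto simp: cell_A_def dest: fits_A_swap)

lemma curve_A_fold: "(a1, 0, a3, b, c) \<in> cell_A \<Longrightarrow> curve_A (a1, 0, a3, b, c) = curve_A (a3, 0, a1, b, c)"
  by (rule curve_A_eqI) (auto simp: cell_A_def add.commute dest: fits_A_fold)

lemma curve_A_B_first: "(0, a2, a3, b, c) \<in> cell_A \<Longrightarrow> curve_A (0, a2, a3, b, c) = curve_B (0, b, a2, a3, c)"
  by (rule curve_A_B_eqI) (auto simp: cell_A_def cell_B_def dest: fits_A_B_first)

lemma curve_A_B_last: "(a1, a2, 0, b, c) \<in> cell_A \<Longrightarrow> curve_A (a1, a2, 0, b, c) = curve_B (a1, a2, b, 0, c)"
  by (rule curve_A_B_eqI) (auto simp: cell_A_def cell_B_def dest: fits_A_B_last)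

section \<open>Functions of lengths that depend only on the curve\<close>

text \<open>A function of the lengths that is constant under the moves is a function of the curve. The branch
  vertices are determined by the curve up to order, and exchanging them is one of the moves, so that
  the comparison of edge data applies.\<close>

lemma curve_B_invariance:
  fixes \<Phi> :: "lengths \<Rightarrow> 'z"
  assumes iota: "\<And>a1 a2 b1 b2 c. \<Phi> (a1, a2, b1, b2, c) = \<Phi> (a2, a1, b2, b1, c)"
    and flip: "\<And>a1 a2 b1 b2. \<Phi> (a1, a2, b1, b2, 0) = \<Phi> (a2, a1, b1, b2, 0)"
    and swapa: "\<And>a2 b1 b2 c. \<Phi> (0, a2, b1, b2, c) = \<Phi> (0, c, b1, b2, a2)"
    and swapb: "\<And>a1 a2 b2 c. \<Phi> (a1, a2, 0, b2, c) = \<Phi> (a1, a2, 0, c, b2)"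
    and l: "l \<in> cell_B" "l' \<in> cell_B" and eq: "curve_B l = curve_B l'"
  shows "\<Phi> l = \<Phi> l'"
proof -
  obtain D where "D \<in> curve_B l"
    using TM_map_nonempty[OF degenerate_curve_graph_B[THEN iffD2, OF l(1)]] by (auto simp: curve_B_def)
  moreover obtain H m q where "D = (H, m, q)" by (cases D)
  ultimately obtain u v u' v' where t: "tropical_curve 2 2 (H, m, q)"
    and f: "fits_B (H, m, q) u v l" and f': "fits_B (H, m, q) u' v' l'"
    using eq mem_curve_B[OF l(1)] mem_curve_B[OF l(2)] by blast
  obtain a1 a2 b1 b2 c where l1: "l = (a1, a2, b1, b2, c)" by (cases l)
  have main: "\<Phi> l = \<Phi> l'" if l2: "l' \<in> cell_B" and f2: "fits_B (H, m, q) u v l'" for l'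
  proof -
    obtain a1' a2' b1' b2' c' where l': "l' = (a1', a2', b1', b2', c')" by (cases l')
    have V: "{u, v, q 1, q 2} = verts H"
      using f by (simp add: fits_B_def l1)
    have card: "card {u, v, q 1, q 2} + zeros (a1, a2, b1, b2, c) = 4" "card {u, v, q 1, q 2} + zeros (a1', a2', b1', b2', c') = 4"
      using fits_B_branch(1)[OF l(1) t f] fits_B_branch(1)[OF l2 t f2] unfolding V l1 l' by simp_all
    have z: "a1 = 0 \<longrightarrow> u = q 1" "a2 = 0 \<longrightarrow> q 1 = v" "b1 = 0 \<longrightarrow> u = q 2" "b2 = 0 \<longrightarrow> q 2 = v" "c = 0 \<longrightarrow> u = v"
      using f unfolding fits_B_def l1 prod.case by blast+
    have z': "a1' = 0 \<longrightarrow> u = q 1" "a2' = 0 \<longrightarrow> q 1 = v" "b1' = 0 \<longrightarrow> u = q 2" "b2' = 0 \<longrightarrow> q 2 = v" "c' = 0 \<longrightarrow> u = v"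
      using f2 unfolding fits_B_def l' prod.case by blast+
    have arcs: "\<not> (a1 = 0 \<and> a2 = 0 \<and> b1 = 0 \<and> b2 = 0)" "\<not> (a1 = 0 \<and> a2 = 0 \<and> c = 0)" "\<not> (b1 = 0 \<and> b2 = 0 \<and> c = 0)"
      using l(1) by (auto simp: l1 cell_B_def)
    have arcs': "\<not> (a1' = 0 \<and> a2' = 0 \<and> b1' = 0 \<and> b2' = 0)" "\<not> (a1' = 0 \<and> a2' = 0 \<and> c' = 0)" "\<not> (b1' = 0 \<and> b2' = 0 \<and> c' = 0)"
      using l2 by (auto simp: l' cell_B_def)
    have eq: "B_data u v (q 1) (q 2) (a1, a2, b1, b2, c) = B_data u v (q 1) (q 2) (a1', a2', b1', b2', c')"
      using f f2 by (simp add: fits_B_def l1 l')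
    show ?thesis
      unfolding l1 l' by (rule B_data_determines_lengths[where \<Phi> = \<Phi>, OF iota flip swapa swapb card z z' arcs arcs' eq])
  qed
  have "u' = u \<and> v' = v \<or> u' = v \<and> v' = u"
  proof (rule branch_eq)
    show "{u, v, u', v'} \<subseteq> verts H"
      using fits_verts(1)[OF f] fits_verts(1)[OF f'] by simp
    show "of_bool (u = w) + of_bool (v = w) = (of_bool (u' = w) + of_bool (v' = w) :: int)" if "w \<in> verts H" for w
      using fits_B_branch(2)[OF l(1) t f that] fits_B_branch(2)[OF l(2) t f' that] by simp
  qed
  then show ?thesis
  proof
    assume "u' = u \<and> v' = v"
    then show ?thesis using main[OF l(2)] f' by simp
  next
    assume uv: "u' = v \<and> v' = u"
    obtain a1' a2' b1' b2' c' where l': "l' = (a1', a2', b1', b2', c')" by (cases l')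
    have "(a2', a1', b2', b1', c') \<in> cell_B"
      using l(2) by (auto simp: l' cell_B_def add.commute)
    moreover have "fits_B (H, m, q) u v (a2', a1', b2', b1', c')"
      using f' uv fits_B_iota by (simp add: l')
    ultimately show ?thesis
      using main iota by (simp add: l')
  qed
qed

text \<open>The same for both models at once; \<open>\<Phi>\<close> and \<open>\<Psi>\<close> are the functions for the models B and A.\<close>

theorem curve_invariance:
  fixes \<Phi> \<Psi> :: "lengths \<Rightarrow> 'z"
  assumes iota: "\<And>a1 a2 b1 b2 c. \<Phi> (a1, a2, b1, b2, c) = \<Phi> (a2, a1, b2, b1, c)"
    and flip: "\<And>a1 a2 b1 b2. \<Phi> (a1, a2, b1, b2, 0) = \<Phi> (a2, a1, b1, b2, 0)"
    and swapa: "\<And>a2 b1 b2 c. \<Phi> (0, a2, b1, b2, c) = \<Phi> (0, c, b1, b2, a2)"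
    and swapb: "\<And>a1 a2 b2 c. \<Phi> (a1, a2, 0, b2, c) = \<Phi> (a1, a2, 0, c, b2)"
    and swap: "\<And>a1 a2 a3 b c. \<Psi> (a1, a2, a3, b, c) = \<Psi> (a1, a2, a3, c, b)"
    and fold: "\<And>a1 a3 b c. \<Psi> (a1, 0, a3, b, c) = \<Psi> (a3, 0, a1, b, c)"
    and first: "\<And>a2 a3 b c. \<Psi> (0, a2, a3, b, c) = \<Phi> (0, b, a2, a3, c)"
    and last: "\<And>a1 a2 b c. \<Psi> (a1, a2, 0, b, c) = \<Phi> (a1, a2, b, 0, c)"
  shows "l \<in> cell_B \<Longrightarrow> l' \<in> cell_B \<Longrightarrow> curve_B l = curve_B l' \<Longrightarrow> \<Phi> l = \<Phi> l'" (is "PROP ?BB l l'")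
    and "l \<in> cell_A \<Longrightarrow> l' \<in> cell_B \<Longrightarrow> curve_A l = curve_B l' \<Longrightarrow> \<Psi> l = \<Phi> l'" (is "PROP ?AB l l'")
    and "l \<in> cell_A \<Longrightarrow> l' \<in> cell_A \<Longrightarrow> curve_A l = curve_A l' \<Longrightarrow> \<Psi> l = \<Psi> l'" (is "PROP ?AA l l'")
proof -
  have BB: "\<Phi> l = \<Phi> l'" if "l \<in> cell_B" "l' \<in> cell_B" "curve_B l = curve_B l'" for l l'
    using curve_B_invariance[where \<Phi> = \<Phi>, OF iota flip swapa swapb that] .
  have first': "curve_A (0, a2, a3, b, c) = curve_B (0, b, a2, a3, c) \<and> (0, b, a2, a3, c) \<in> cell_B"
    if "(0, a2, a3, b, c) \<in> cell_A" for a2 a3 b c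
    using curve_A_B_first[OF that] that by (auto simp: cell_A_def cell_B_def)
  have last': "curve_A (a1, a2, 0, b, c) = curve_B (a1, a2, b, 0, c) \<and> (a1, a2, b, 0, c) \<in> cell_B"
    if "(a1, a2, 0, b, c) \<in> cell_A" for a1 a2 b c
    using curve_A_B_last[OF that] that by (auto simp: cell_A_def cell_B_def)
  have to_B: "\<exists>k\<in>cell_B. curve_A (a1, a2, a3, b, c) = curve_B k \<and> \<Psi> (a1, a2, a3, b, c) = \<Phi> k"
    if l: "(a1, a2, a3, b, c) \<in> cell_A" and "a1 = 0 \<or> a3 = 0" for a1 a2 a3 b c
    using that(2)
  proof
    assume "a1 = 0"
    then show ?thesis using first'[of a2 a3 b c] l first by auto
  next
    assume "a3 = 0"
    then show ?thesis using last'[of a1 a2 b c] l last by auto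
  qed
  have AB: "\<Psi> l = \<Phi> l'" if l: "l \<in> cell_A" "l' \<in> cell_B" and eq: "curve_A l = curve_B l'" for l l'
  proof -
    obtain a1 a2 a3 b c where l1: "l = (a1, a2, a3, b, c)" by (cases l)
    show ?thesis
    proof (cases "a1 = 0 \<or> a3 = 0")
      case True
      then obtain k where "k \<in> cell_B" "curve_A l = curve_B k" "\<Psi> l = \<Phi> k"
        using to_B l(1) unfolding l1 by blast
      then show ?thesis using BB[of k l'] l(2) eq by simp
    next
      case False
      obtain D where "D \<in> curve_A l"
        using TM_map_nonempty[OF degenerate_curve_graph_A[THEN iffD2, OF l(1)]] by (auto simp: curve_A_def)
      moreover obtain H m q where "D = (H, m, q)" by (cases D)
      ultimately obtain u v u' v' where t: "tropical_curve 2 2 (H, m, q)"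
        and f: "fits_A (H, m, q) u v l" and f': "fits_B (H, m, q) u' v' l'"
        using eq mem_curve_A[OF l(1)] mem_curve_B[OF l(2)] by blast
      obtain a1' a2' b1' b2' c' where l': "l' = (a1', a2', b1', b2', c')" by (cases l')
      have uv: "u' = u \<and> v' = v \<or> u' = v \<and> v' = u"
      proof (rule branch_eq)
        show "{u, v, u', v'} \<subseteq> verts H"
          using fits_verts(2)[OF f] fits_verts(1)[OF f'] by simp
        show "of_bool (u = w) + of_bool (v = w) = (of_bool (u' = w) + of_bool (v' = w) :: int)" if "w \<in> verts H" for w
          using fits_A_branch(2)[OF l(1) t f that] fits_B_branch(2)[OF l(2) t f' that] by simp
      qed
      have V: "{u, v, q 1, q 2} = verts H"
        using f by (simp add: fits_A_def l1)
      have card: "card {u, v, q 1, q 2} + zeros (a1, a2, a3, b, c) = 4" "card {u, v, q 1, q 2} + zeros (a1', a2', b1', b2', c') = 4"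
        using fits_A_branch(1)[OF l(1) t f] fits_B_branch(1)[OF l(2) t f'] unfolding V l1 l' by simp_all
      have z: "a2 = 0 \<longrightarrow> q 1 = q 2" "b = 0 \<longrightarrow> u = v" "c = 0 \<longrightarrow> u = v"
        using f unfolding fits_A_def l1 prod.case by blast+
      have z': "a1' = 0 \<longrightarrow> u' = q 1" "a2' = 0 \<longrightarrow> q 1 = v'" "b1' = 0 \<longrightarrow> u' = q 2" "b2' = 0 \<longrightarrow> q 2 = v'" "c' = 0 \<longrightarrow> u' = v'"
        using f' unfolding fits_B_def l' prod.case by blast+
      have nz: "a1 \<noteq> 0" "a3 \<noteq> 0" "\<not> (b = 0 \<and> c = 0)"
        using False l(1) by (auto simp: l1 cell_A_def)
      have "A_data u v (q 1) (q 2) (a1, a2, a3, b, c) \<noteq> B_data u' v' (q 1) (q 2) (a1', a2', b1', b2', c')"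
        by (rule A_data_neq_B_data[OF card z z' nz uv])
      then show ?thesis
        using f f' by (simp add: fits_A_def fits_B_def l1 l')
    qed
  qed
  have AA: "\<Psi> l = \<Psi> l'" if l: "l \<in> cell_A" "l' \<in> cell_A" and eq: "curve_A l = curve_A l'" for l l'
  proof -
    obtain a1 a2 a3 b c where l1: "l = (a1, a2, a3, b, c)" by (cases l)
    obtain a1' a2' a3' b' c' where l2: "l' = (a1', a2', a3', b', c')" by (cases l')
    consider "a1 = 0 \<or> a3 = 0" | "a1' = 0 \<or> a3' = 0" | "a1 \<noteq> 0" "a3 \<noteq> 0" "a1' \<noteq> 0" "a3' \<noteq> 0" by blast
    then show ?thesis
    proof cases
      case 1
      then obtain k where "k \<in> cell_B" "curve_A l = curve_B k" "\<Psi> l = \<Phi> k"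
        using to_B l(1) unfolding l1 by blast
      then show ?thesis using AB[of l' k] l(2) eq by simp
    next
      case 2
      then obtain k where "k \<in> cell_B" "curve_A l' = curve_B k" "\<Psi> l' = \<Phi> k"
        using to_B l(2) unfolding l2 by blast
      then show ?thesis using AB[of l k] l(1) eq by simp
    next
      case 3
      obtain D where "D \<in> curve_A l"
        using TM_map_nonempty[OF degenerate_curve_graph_A[THEN iffD2, OF l(1)]] by (auto simp: curve_A_def)
      moreover obtain H m q where "D = (H, m, q)" by (cases D)
      ultimately obtain u v u' v' where t: "tropical_curve 2 2 (H, m, q)"
        and f: "fits_A (H, m, q) u v l" and f': "fits_A (H, m, q) u' v' l'"
        using eq mem_curve_A[OF l(1)] mem_curve_A[OF l(2)] by blast
      have uv: "u' = u \<and> v' = v \<or> u' = v \<and> v' = u"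
      proof (rule branch_eq)
        show "{u, v, u', v'} \<subseteq> verts H"
          using fits_verts(2)[OF f] fits_verts(2)[OF f'] by simp
        show "of_bool (u = w) + of_bool (v = w) = (of_bool (u' = w) + of_bool (v' = w) :: int)" if "w \<in> verts H" for w
          using fits_A_branch(2)[OF l(1) t f that] fits_A_branch(2)[OF l(2) t f' that] by simp
      qed
      have V: "{u, v, q 1, q 2} = verts H"
        using f by (simp add: fits_A_def l1)
      have card: "card {u, v, q 1, q 2} + zeros (a1, a2, a3, b, c) = 4" "card {u, v, q 1, q 2} + zeros (a1', a2', a3', b', c') = 4"
        using fits_A_branch(1)[OF l(1) t f] fits_A_branch(1)[OF l(2) t f'] unfolding V l1 l2 by simp_all
      have z: "a2 = 0 \<longrightarrow> q 1 = q 2" "b = 0 \<longrightarrow> u = v" "c = 0 \<longrightarrow> u = v"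
        using f unfolding fits_A_def l1 prod.case by blast+
      have z': "a2' = 0 \<longrightarrow> q 1 = q 2" "b' = 0 \<longrightarrow> u = v" "c' = 0 \<longrightarrow> u = v"
      proof -
        have "u' = v' \<longleftrightarrow> u = v" using uv by auto
        moreover have "a2' = 0 \<longrightarrow> q 1 = q 2" "b' = 0 \<longrightarrow> u' = v'" "c' = 0 \<longrightarrow> u' = v'"
          using f' unfolding fits_A_def l2 prod.case by blast+
        ultimately show "a2' = 0 \<longrightarrow> q 1 = q 2" "b' = 0 \<longrightarrow> u = v" "c' = 0 \<longrightarrow> u = v"
          by simp_all
      qed
      have nz: "a1 \<noteq> 0" "a3 \<noteq> 0" "\<not> (b = 0 \<and> c = 0)"
        using 3 l(1) by (auto simp: l1 cell_A_def)
      have nz': "a1' \<noteq> 0" "a3' \<noteq> 0" "\<not> (b' = 0 \<and> c' = 0)"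
        using 3 l(2) by (auto simp: l2 cell_A_def)
      have eq: "A_data u v (q 1) (q 2) (a1, a2, a3, b, c) = A_data u' v' (q 1) (q 2) (a1', a2', a3', b', c')"
        using f f' by (simp add: fits_A_def l1 l2)
      show ?thesis
        unfolding l1 l2 by (rule A_data_determines_lengths[where \<Phi> = \<Psi>, OF swap fold card z z' nz nz' uv eq])
    qed
  qed
  show "PROP ?BB l l'" by (rule BB)
  show "PROP ?AB l l'" by (rule AB)
  show "PROP ?AA l l'" by (rule AA)
qed

section \<open>Pulling lengths back along a contraction\<close>

text \<open>Lengths that vanish wherever \<open>l\<close> does can be transported to the contraction, where the missing
  edges have length zero anyway. So any continuous family of such lengths can be studied after
  contraction.\<close>

lemma TM_map_pullback:
  assumes C: "degenerate_curve g n (G, l, p)" and t: "tropical_curve g n (H, m, q)"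
    and h: "contraction_map n (G, l, p) (H, m, q) h \<epsilon>"
    and l': "l' \<in> edges G \<rightarrow>\<^sub>E {0..}" "\<And>e. e \<in> zero_edges G l \<Longrightarrow> l' e = 0"
    and m': "m' \<in> edges H \<rightarrow>\<^sub>E {0..}" "\<And>e. e \<in> edges G - zero_edges G l \<Longrightarrow> m' (\<epsilon> e) = l' e"
  shows "degenerate_curve g n (G, l', p) \<longleftrightarrow> degenerate_curve g n (H, m', q)"
    and "degenerate_curve g n (G, l', p) \<Longrightarrow> TM_map g n ((G, p), l') = TM_map g n ((H, q), m')"
proof -
  let ?Z = "zero_edges G l"
  have ct: "combinatorial_type g n H q" "combinatorial_type g n G p"
    using t C by (auto simp: tropical_curve_def degenerate_curve_def)
  interpret contraction_of G H ?Z h \<epsilon>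
    by (rule contraction_map_contraction_of[OF C ct(1) h])
  have f: "forest G ?Z"
    using C by (simp add: degenerate_curve_def)
  have ZF: "?Z \<subseteq> zero_edges G l'" "zero_edges G l' \<subseteq> edges G"
    using l'(2) by (auto simp: zero_edges_def)
  have bij': "\<epsilon> e \<in> edges H" if "e \<in> edges G - ?Z" for e
    using that image_edges by blast
  have "zero_edges H m' = \<epsilon> ` (zero_edges G l' - ?Z)"
  proof (intro equalityI subsetI)
    fix e' assume e': "e' \<in> zero_edges H m'"
    then obtain e where "e \<in> edges G - ?Z" "e' = \<epsilon> e"
      using image_edges unfolding zero_edges_def by blast
    then show "e' \<in> \<epsilon> ` (zero_edges G l' - ?Z)"
      using e' m'(2)[of e] by (auto simp: zero_edges_def)
  next
    fix e' assume "e' \<in> \<epsilon> ` (zero_edges G l' - ?Z)"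
    then obtain e where e: "e \<in> edges G - ?Z" "e' = \<epsilon> e" "l' e = 0"
      by (auto simp: zero_edges_def)
    then show "e' \<in> zero_edges H m'"
      using m'(2)[OF e(1)] bij'[OF e(1)] by (simp add: zero_edges_def)
  qed
  note zm = this
  show iff: "degenerate_curve g n (G, l', p) \<longleftrightarrow> degenerate_curve g n (H, m', q)"
    unfolding degenerate_curve_def prod.case zm forest_image_iff[OF f ZF] using ct l'(1) m'(1) by simp
  assume D: "degenerate_curve g n (G, l', p)"
  then have D': "degenerate_curve g n (H, m', q)"
    using iff by simp
  obtain E where E: "E \<in> TM_map g n ((H, q), m')"
    using TM_map_nonempty[OF D'] by blast
  obtain K s r where K: "E = (K, s, r)" by (cases E)
  obtain k \<delta> where k: "contraction_map n (H, m', q) (K, s, r) k \<delta>" and tK: "tropical_curve g n (K, s, r)"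
    using E unfolding mem_TM_map[OF D'] K by blast
  have "contraction_map n (G, l', p) (K, s, r) (k \<circ> h) (\<delta> \<circ> \<epsilon>)"
    unfolding contraction_map_def prod.case
  proof (intro conjI ballI allI impI)
    have "k ` verts H = verts K"
      using k by (simp add: contraction_map_def)
    then show "(k \<circ> h) ` verts G = verts K"
      unfolding verts[symmetric] by (simp add: image_comp)
    show "r i = (k \<circ> h) (p i)" if "i \<in> {1..n}" for i
      using h k that by (simp add: contraction_map_def)
    show "(k \<circ> h) u = (k \<circ> h) v" if e: "e \<in> zero_edges G l'" "ends G e = {u, v}" for e u v
    proof (cases "e \<in> ?Z")
      case True
      then have "h u = h v"
        using h e(2) unfolding contraction_map_def prod.case by blast
      then show ?thesis by simp
    next
      case False
      then have "\<epsilon> e \<in> zero_edges H m'" "ends H (\<epsilon> e) = {h u, h v}"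
        using e zm ends[of e] by (auto simp: zero_edges_def)
      then show ?thesis
        using k unfolding contraction_map_def prod.case by auto
    qed
    have inj: "inj_on \<epsilon> (edges G - ?Z)"
      using bij by (simp add: bij_betw_def)
    have "edges G - ?Z - (zero_edges G l' - ?Z) = edges G - zero_edges G l'"
      using ZF by blast
    then have "\<epsilon> ` (edges G - zero_edges G l') = edges H - zero_edges H m'"
      unfolding zm image_edges[symmetric] using inj_on_image_set_diff[OF inj, of "edges G - ?Z" "zero_edges G l' - ?Z"] ZF
      by auto
    moreover have "inj_on \<epsilon> (edges G - zero_edges G l')"
      by (rule inj_on_subset[OF inj]) (use ZF in blast)
    ultimately have "bij_betw \<epsilon> (edges G - zero_edges G l') (edges H - zero_edges H m')"
      by (simp add: bij_betw_def)
    then show "bij_betw (\<delta> \<circ> \<epsilon>) (edges G - zero_edges G l') (edges K)"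
      using k by (auto simp: contraction_map_def intro: bij_betw_trans)
    fix e assume e: "e \<in> edges G - zero_edges G l'"
    then have e': "e \<in> edges G - ?Z" using ZF by blast
    have "\<epsilon> e \<in> edges H - zero_edges H m'"
      using e e' \<open>bij_betw \<epsilon> (edges G - zero_edges G l') _\<close> by (auto simp: bij_betw_def)
    then have "ends K (\<delta> (\<epsilon> e)) = k ` ends H (\<epsilon> e)" "s (\<delta> (\<epsilon> e)) = m' (\<epsilon> e)"
      using k unfolding contraction_map_def prod.case by blast+
    then show "ends K ((\<delta> \<circ> \<epsilon>) e) = (k \<circ> h) ` ends G e" "s ((\<delta> \<circ> \<epsilon>) e) = l' e"
      using ends[OF e'] m'(2)[OF e'] by (simp_all add: image_comp)
  qed
  then have "E \<in> TM_map g n ((G, p), l')"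
    unfolding mem_TM_map[OF D] K using tK by blast
  then show "TM_map g n ((G, p), l') = TM_map g n ((H, q), m')"
    by (rule TM_map_eqI[OF D D' _ E])
qed

section \<open>Bridges\<close>

definition bridges :: "('v, 'e) multigraph \<Rightarrow> 'e set" where
  "bridges G = {e \<in> edges G. \<forall>u v. ends G e = {u, v} \<longrightarrow> (u, v) \<notin> reach G (edges G - {e})}"

lemma bridges_iff:
  "ends G e = {u, v} \<Longrightarrow> e \<in> bridges G \<longleftrightarrow> e \<in> edges G \<and> (u, v) \<notin> reach G (edges G - {e})"
  unfolding bridges_def by (auto simp: doubleton_eq_iff dest: reach_sym)

text \<open>Contraction changes connectivity only by identifying connected vertices, so bridges stay bridges.\<close>

lemma (in contraction_of) bridges_image_iff:
  assumes e: "e \<in> edges G - Z"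
  shows "\<epsilon> e \<in> bridges H \<longleftrightarrow> e \<in> bridges G"
proof -
  obtain a b where ab: "a \<in> verts G" "b \<in> verts G" "ends G e = {a, b}"
    using e finite_multigraph_ends[OF fG, of e] by blast
  have inj: "inj_on \<epsilon> (edges G - Z)"
    using bij by (simp add: bij_betw_def)
  have "\<epsilon> ` (edges G - {e} - Z) = edges H - {\<epsilon> e}"
  proof -
    have "edges G - {e} - Z = (edges G - Z) - {e}"
      by blast
    moreover have "\<epsilon> ` ((edges G - Z) - {e}) = \<epsilon> ` (edges G - Z) - \<epsilon> ` {e}"
      by (rule inj_on_image_set_diff[OF inj]) (use e in blast)+
    ultimately show ?thesis
      using image_edges by simp
  qed
  then have "(h a, h b) \<in> reach H (edges H - {\<epsilon> e}) \<longleftrightarrow> (a, b) \<in> reach G (edges G - {e})"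
    using reach_iff[of "edges G - {e}" a b] e Z ab by auto
  moreover have "ends H (\<epsilon> e) = {h a, h b}"
    using ends[OF e] ab by simp
  ultimately show ?thesis
    using bridges_iff[OF ab(3)] bridges_iff[of H "\<epsilon> e" "h a" "h b"] e image_edges by blast
qed

text \<open>No cycle passes through a bridge.\<close>

lemma forest_Un_bridges:
  assumes fin: "finite_multigraph G" and Z: "Z \<subseteq> edges G" "forest G Z"
  shows "forest G (Z \<union> bridges G)"
proof -
  have sub: "Z \<union> bridges G \<subseteq> edges G"
    using Z by (auto simp: bridges_def)
  have "\<not> contains_cycle G (Z \<union> bridges G)"
  proof
    assume "contains_cycle G (Z \<union> bridges G)"
    then obtain vs es where c: "is_cycle G vs es" "set es \<subseteq> Z \<union> bridges G"
      by (auto simp: contains_cycle_def)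
    have "b \<notin> bridges G" if b: "b \<in> set es" for b
    proof -
      have bE: "b \<in> edges G" using b c(2) sub by blast
      then obtain u v where uv: "ends G b = {u, v}"
        by (rule finite_multigraph_ends[OF fin])
      have "set es - {b} \<subseteq> edges G - {b}"
        using c(2) sub by blast
      then have "(u, v) \<in> reach G (edges G - {b})"
        using cycle_edge_reach[OF c(1) b uv] by (rule reach_mono)
      then show ?thesis
        using bridges_iff[OF uv] by blast
    qed
    then have "contains_cycle G Z"
      using c by (auto simp: contains_cycle_def)
    then show False
      using contains_cycle_iff_not_forest[OF fin Z(1)] Z(2) by simp
  qed
  then show ?thesis
    using contains_cycle_iff_not_forest[OF fin sub] by simp
qed

definition shrink_bridges :: "('v, 'e) multigraph \<Rightarrow> real \<Rightarrow> ('e \<Rightarrow> real) \<Rightarrow> 'e \<Rightarrow> real" where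
  "shrink_bridges G t l = (\<lambda>e\<in>edges G. if e \<in> bridges G then (1 - t) * l e else l e)"

lemma degenerate_shrink_bridges:
  assumes C: "degenerate_curve g n (G, l, p)" and t: "t \<in> {0..1}"
  shows "degenerate_curve g n (G, shrink_bridges G t l, p)"
proof -
  have fin: "finite_multigraph G" and ct: "combinatorial_type g n G p" and f: "forest G (zero_edges G l)"
    and l: "l \<in> edges G \<rightarrow>\<^sub>E {0..}"
    using C by (auto simp: degenerate_curve_def combinatorial_type_def)
  have "forest G (zero_edges G l \<union> bridges G)"
    by (rule forest_Un_bridges[OF fin _ f]) (auto simp: zero_edges_def)
  then have "forest G (zero_edges G (shrink_bridges G t l))"
    by (rule forest_subset) (auto simp: zero_edges_def shrink_bridges_def split: if_splits)
  moreover have "shrink_bridges G t l \<in> edges G \<rightarrow>\<^sub>E {0..}"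
    using l t by (auto simp: shrink_bridges_def PiE_iff)
  ultimately show ?thesis
    using ct by (simp add: degenerate_curve_def)
qed

text \<open>Shrinking bridges commutes with contracting edges of length zero, so it is well defined on the moduli
  space.\<close>

lemma TM_map_shrink_bridges:
  assumes C: "degenerate_curve g n (G, l, p)" and D: "(H, m, q) \<in> TM_map g n ((G, p), l)" and t: "t \<in> {0..1}"
  shows "TM_map g n ((G, p), shrink_bridges G t l) = TM_map g n ((H, q), shrink_bridges H t m)"
proof -
  obtain h \<epsilon> where tr: "tropical_curve g n (H, m, q)" and h: "contraction_map n (G, l, p) (H, m, q) h \<epsilon>"
    using D unfolding mem_TM_map[OF C] by blast
  interpret contraction_of G H "zero_edges G l" h \<epsilon>
    by (rule contraction_map_contraction_of[OF C _ h]) (use tr in \<open>simp add: tropical_curve_def\<close>)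
  have D: "degenerate_curve g n (G, shrink_bridges G t l, p)" "degenerate_curve g n (H, shrink_bridges H t m, q)"
    using degenerate_shrink_bridges t C tropical_imp_degenerate(1)[OF tr] by blast+
  show ?thesis
  proof (rule TM_map_pullback(2)[OF C tr h _ _ _ _ D(1)])
    show "shrink_bridges G t l \<in> edges G \<rightarrow>\<^sub>E {0..}" "shrink_bridges H t m \<in> edges H \<rightarrow>\<^sub>E {0..}"
      using D by (auto simp: degenerate_curve_def)
    show "shrink_bridges G t l e = 0" if "e \<in> zero_edges G l" for e
      using that by (auto simp: shrink_bridges_def zero_edges_def)
    fix e assume e: "e \<in> edges G - zero_edges G l"
    have "\<epsilon> e \<in> edges H"
      using e image_edges by blast
    moreover have "m (\<epsilon> e) = l e"
      using h e unfolding contraction_map_def prod.case by blast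
    ultimately show "shrink_bridges H t m (\<epsilon> e) = shrink_bridges G t l e"
      using e bridges_image_iff[OF e] by (simp add: shrink_bridges_def)
  qed
qed

section \<open>Bridgeless curves of genus 2\<close>

definition multiplicity_of :: "('v, 'e) multigraph \<Rightarrow> 'v set \<Rightarrow> nat" where
  "multiplicity_of H s = card {e \<in> edges H. ends H e = s}"

lemma sum_over_edges:
  assumes "finite (edges H)" "finite S" "\<And>e. e \<in> edges H \<Longrightarrow> ends H e \<in> S"
  shows "(\<Sum>e\<in>edges H. f (ends H e)) = (\<Sum>s\<in>S. multiplicity_of H s * (f s :: nat))"
proof -
  have "(\<Sum>e\<in>edges H. f (ends H e)) = (\<Sum>s\<in>S. \<Sum>e\<in>{e \<in> edges H. ends H e = s}. f (ends H e))"
    using assms by (intro sum.group[symmetric]) auto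
  also have "\<dots> = (\<Sum>s\<in>S. multiplicity_of H s * f s)"
    by (intro sum.cong) (simp_all add: multiplicity_of_def)
  finally show ?thesis .
qed

lemma ends_mset_expand:
  assumes "finite (edges H)" "finite S" "\<And>e. e \<in> edges H \<Longrightarrow> ends H e \<in> S"
  shows "image_mset (ends H) (mset_set (edges H)) = (\<Sum>s\<in>S. replicate_mset (multiplicity_of H s) s)"
proof (rule multiset_eqI)
  fix s
  have "count (image_mset (ends H) (mset_set (edges H))) s = multiplicity_of H s"
    using assms(1) by (simp add: count_image_mset multiplicity_of_def vimage_def Int_def conj_commute)
  moreover have "multiplicity_of H s = 0" if "s \<notin> S"
    using that assms by (auto simp: multiplicity_of_def)
  ultimately show "count (image_mset (ends H) (mset_set (edges H))) s = count (\<Sum>s\<in>S. replicate_mset (multiplicity_of H s) s) s"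
    using assms(2) by (auto simp: count_sum)
qed

text \<open>A single edge leaving \<open>W\<close> would be a bridge.\<close>

lemma bridgeless_cut:
  assumes fin: "finite_multigraph H" and con: "connected_multigraph H" and br: "bridges H = {}"
    and W: "W \<subseteq> verts H" "W \<noteq> {}" "W \<noteq> verts H"
  shows "2 \<le> card {e \<in> edges H. ends H e \<inter> W \<noteq> {} \<and> \<not> ends H e \<subseteq> W}"
proof (rule ccontr)
  let ?X = "{e \<in> edges H. ends H e \<inter> W \<noteq> {} \<and> \<not> ends H e \<subseteq> W}"
  assume "\<not> 2 \<le> card ?X"
  then have "card ?X = 0 \<or> card ?X = 1" by linarith
  moreover have "finite ?X"
    using fin by (simp add: finite_multigraph_def)
  ultimately consider "?X = {}" | e where "?X = {e}"
    by (auto simp: card_1_singleton_iff)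
  moreover have stay: "b \<in> W" if "(a, b) \<in> reach H (edges H - ?X)" "a \<in> W" for a b
    using that
  proof (induction rule: reach_induct)
    case (step e x y)
    then show ?case by auto
  qed
  ultimately show False
  proof cases
    case 1
    obtain a b where "a \<in> W" "b \<in> verts H" "b \<notin> W"
      using W by blast
    moreover then have "(a, b) \<in> reach H (edges H - ?X)"
      using con W(1) unfolding 1 by (auto simp: connected_multigraph_def)
    ultimately show False using stay by blast
  next
    case (2 e)
    then have e: "e \<in> edges H" "ends H e \<inter> W \<noteq> {}" "\<not> ends H e \<subseteq> W" by blast+
    obtain x y where xy: "ends H e = {x, y}" "x \<in> W" "y \<notin> W"
    proof -
      obtain a b where "ends H e = {a, b}"
        using finite_multigraph_ends[OF fin e(1)] by metis
      then show thesis
        using e(2,3) that[of a b] that[of b a] by auto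
    qed
    have "(x, y) \<in> reach H (edges H - ?X)"
      using bridges_iff[OF xy(1)] br e(1) unfolding 2 by blast
    then show False using stay xy by blast
  qed
qed

locale bridgeless_type =
  fixes H :: "('v, 'e) multigraph" and q :: "nat \<Rightarrow> 'v"
  assumes ct: "combinatorial_type 2 2 H q" and br: "bridges H = {}"
begin

abbreviation "m \<equiv> multiplicity_of H"

lemma fin: "finite_multigraph H" "finite (edges H)" "finite (verts H)"
  and con: "connected_multigraph H"
  using ct by (auto simp: combinatorial_type_def finite_multigraph_def)

lemma valency_multiplicity:
  assumes "finite S" "\<And>e. e \<in> edges H \<Longrightarrow> ends H e \<in> S"
  shows "valency H w = (\<Sum>s\<in>S. m s * (if w \<in> s then if s = {w} then 2 else 1 else 0))"
  unfolding valency_incidence[OF fin(2)] incidence_def using sum_over_edges[OF fin(2) assms] by simp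

lemma cut_multiplicity:
  assumes "finite S" "\<And>e. e \<in> edges H \<Longrightarrow> ends H e \<in> S" "W \<subseteq> verts H" "W \<noteq> {}" "W \<noteq> verts H"
  shows "2 \<le> (\<Sum>s\<in>S. m s * (if s \<inter> W \<noteq> {} \<and> \<not> s \<subseteq> W then 1 else 0))"
proof -
  have "card {e \<in> edges H. ends H e \<inter> W \<noteq> {} \<and> \<not> ends H e \<subseteq> W} =
      (\<Sum>e\<in>edges H. if ends H e \<inter> W \<noteq> {} \<and> \<not> ends H e \<subseteq> W then 1 else 0)"
    using fin(2) by (simp add: sum.If_cases Int_def)
  also have "\<dots> = (\<Sum>s\<in>S. m s * (if s \<inter> W \<noteq> {} \<and> \<not> s \<subseteq> W then 1 else 0))"
    by (rule sum_over_edges[OF fin(2) assms(1,2)])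
  finally show ?thesis
    using bridgeless_cut[OF fin(1) con br assms(3-5)] by simp
qed

lemma ends_subset_verts: "e \<in> edges H \<Longrightarrow> \<exists>a\<in>verts H. \<exists>b\<in>verts H. ends H e = {a, b}"
  using finite_multigraph_ends[OF fin(1)] by metis

lemma valency_ge_2:
  assumes w: "w \<in> verts H"
  shows "2 \<le> valency H w"
proof (cases "verts H = {w}")
  case True
  then have "card (edges H) = 2"
    using ct by (simp add: combinatorial_type_def genus_def)
  then show ?thesis
    using sum_valency[OF fin(1)] by (simp add: True)
next
  case False
  have "2 \<le> card {e \<in> edges H. ends H e \<inter> {w} \<noteq> {} \<and> \<not> ends H e \<subseteq> {w}}"
    by (rule bridgeless_cut[OF fin(1) con br]) (use w False in auto)
  also have "\<dots> = (\<Sum>e\<in>edges H. if ends H e \<inter> {w} \<noteq> {} \<and> \<not> ends H e \<subseteq> {w} then 1 else 0)"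
    using fin(2) by (simp add: sum.If_cases Int_def)
  also have "\<dots> \<le> (\<Sum>e\<in>edges H. incidence H e w)"
    by (rule sum_mono) (auto simp: incidence_def)
  finally show ?thesis
    by (simp add: valency_incidence[OF fin(2)])
qed

text \<open>Valency minus 2 is nonnegative without bridges and sums to 2, so it is carried by at most two vertices.
  By stability every other vertex carries a mark.\<close>

lemma branch_vertices:
  obtains u v where "u \<in> verts H" "v \<in> verts H" "\<forall>w\<in>verts H. int (valency H w) - 2 = of_bool (u = w) + of_bool (v = w)"
    "verts H = {u, v, q 1, q 2}"
proof -
  let ?K = "\<lambda>w. int (valency H w) - 2"
  have K0: "?K w \<ge> 0" if "w \<in> verts H" for w
    using valency_ge_2[OF that] by linarith
  have "(\<Sum>w\<in>verts H. int (valency H w)) = 2 * int (card (edges H))"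
    using sum_valency[OF fin(1)] by (metis of_nat_mult of_nat_numeral of_nat_sum)
  then have sum2: "(\<Sum>w\<in>verts H. ?K w) = 2"
    using ct by (simp add: sum_subtractf combinatorial_type_def genus_def)
  have pos: "\<exists>w\<in>V. f w > 0" if "(\<Sum>w\<in>V. f w) > 0" for f :: "'v \<Rightarrow> int" and V
    using that sum_nonpos[of V f] by (metis linorder_not_le)
  obtain u where u: "u \<in> verts H" "?K u > 0"
    using pos[of ?K "verts H"] sum2 by auto
  let ?K1 = "\<lambda>w. ?K w - of_bool (u = w)"
  have "(\<Sum>w\<in>verts H. ?K1 w) = (\<Sum>w\<in>verts H. ?K w) - (\<Sum>w\<in>verts H. of_bool (u = w))"
    by (rule sum_subtractf)
  also have "(\<Sum>w\<in>verts H. of_bool (u = w)) = (1::int)"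
    using u fin(3) by (simp add: of_bool_def)
  finally have sum1: "(\<Sum>w\<in>verts H. ?K1 w) = 1"
    using sum2 by simp
  obtain v where v: "v \<in> verts H" "?K1 v > 0"
    using pos[of ?K1 "verts H"] sum1 by auto
  let ?K2 = "\<lambda>w. ?K1 w - of_bool (v = w)"
  have "(\<Sum>w\<in>verts H. ?K2 w) = (\<Sum>w\<in>verts H. ?K1 w) - (\<Sum>w\<in>verts H. of_bool (v = w))"
    by (rule sum_subtractf)
  also have "(\<Sum>w\<in>verts H. of_bool (v = w)) = (1::int)"
    using v fin(3) by (simp add: of_bool_def)
  finally have sum0: "(\<Sum>w\<in>verts H. ?K2 w) = 0"
    using sum1 by simp
  have "\<forall>w\<in>verts H. ?K2 w = 0"
  proof (subst sum_nonneg_eq_0_iff[symmetric])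
    show "0 \<le> ?K2 w" if "w \<in> verts H" for w
      using K0[OF that] u v by (cases "u = w"; cases "v = w") auto
  qed (use fin sum0 in auto)
  then have K: "int (valency H w) - 2 = of_bool (u = w) + of_bool (v = w)" if "w \<in> verts H" for w
    using that by (metis (no_types, lifting) add.commute diff_diff_eq diff_eq_diff_eq diff_self eq_iff_diff_eq_0)
  have q: "q 1 \<in> verts H" "q 2 \<in> verts H"
    using ct unfolding combinatorial_type_def atLeastAtMost_1_2 by auto
  have "verts H \<subseteq> {u, v, q 1, q 2}"
  proof
    fix w assume w: "w \<in> verts H"
    show "w \<in> {u, v, q 1, q 2}"
    proof (rule ccontr)
      assume "w \<notin> {u, v, q 1, q 2}"
      then have "valency H w = 2" "{i \<in> {1..2}. q i = w} = {}"
        using K[OF w] unfolding atLeastAtMost_1_2 by auto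
      then have "valency H w + card {i \<in> {1..2}. q i = w} = 2" by simp
      moreover have "valency H w + card {i \<in> {1..2}. q i = w} \<ge> 3"
        using ct w unfolding combinatorial_type_def by blast
      ultimately show False by linarith
    qed
  qed
  then have "verts H = {u, v, q 1, q 2}"
    using u(1) v(1) q by blast
  then show thesis
    using that[OF u(1) v(1)] K by blast
qed

lemma multiplicities_1:
  assumes V: "verts H = {a}"
  shows "valency H a = 2 * m {a}"
    and "image_mset (ends H) (mset_set (edges H)) = replicate_mset (m {a}) {a}"
proof -
  have S: "finite {{a}}" "\<And>e. e \<in> edges H \<Longrightarrow> ends H e \<in> {{a}}"
    using ends_subset_verts unfolding V by force+
  show "valency H a = 2 * m {a}"
    using valency_multiplicity[OF S, of a] by simp
  show "image_mset (ends H) (mset_set (edges H)) = replicate_mset (m {a}) {a}"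
    using ends_mset_expand[OF fin(2) S] by simp
qed

lemma multiplicities_2:
  assumes V: "verts H = {a, b}" and ne: "a \<noteq> b"
  shows "valency H a = 2 * m {a} + m {a, b}" "valency H b = 2 * m {b} + m {a, b}" "2 \<le> m {a, b}"
    and "image_mset (ends H) (mset_set (edges H)) =
      replicate_mset (m {a}) {a} + replicate_mset (m {b}) {b} + replicate_mset (m {a, b}) {a, b}"
proof -
  let ?S = "{{a}, {b}, {a, b}}"
  have S: "finite ?S" "\<And>e. e \<in> edges H \<Longrightarrow> ends H e \<in> ?S"
    using ends_subset_verts unfolding V by (fastforce simp: insert_commute)+
  note n = ne ne[symmetric] singleton_insert_inj_eq' singleton_insert_inj_eq
  show "valency H a = 2 * m {a} + m {a, b}" "valency H b = 2 * m {b} + m {a, b}"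
    using valency_multiplicity[OF S, of a] valency_multiplicity[OF S, of b] by (simp_all add: n)
  show "2 \<le> m {a, b}"
    using cut_multiplicity[OF S, of "{a}"] ne by (simp add: n V)
  show "image_mset (ends H) (mset_set (edges H)) =
      replicate_mset (m {a}) {a} + replicate_mset (m {b}) {b} + replicate_mset (m {a, b}) {a, b}"
    using ends_mset_expand[OF fin(2) S] by (simp add: n)
qed

lemma multiplicities_3:
  assumes V: "verts H = {a, b, c}" and ne: "a \<noteq> b" "a \<noteq> c" "b \<noteq> c"
  shows "valency H a = 2 * m {a} + m {a, b} + m {a, c}" "valency H b = 2 * m {b} + m {a, b} + m {b, c}"
      "valency H c = 2 * m {c} + m {a, c} + m {b, c}"
      "2 \<le> m {a, b} + m {a, c}" "2 \<le> m {a, b} + m {b, c}" "2 \<le> m {a, c} + m {b, c}"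
    and "image_mset (ends H) (mset_set (edges H)) =
      replicate_mset (m {a}) {a} + replicate_mset (m {b}) {b} + replicate_mset (m {c}) {c} +
      replicate_mset (m {a, b}) {a, b} + replicate_mset (m {a, c}) {a, c} + replicate_mset (m {b, c}) {b, c}"
proof -
  let ?S = "{{a}, {b}, {c}, {a, b}, {a, c}, {b, c}}"
  have S: "finite ?S" "\<And>e. e \<in> edges H \<Longrightarrow> ends H e \<in> ?S"
  proof -
    fix e assume "e \<in> edges H"
    then obtain x y where "x \<in> {a, b, c}" "y \<in> {a, b, c}" "ends H e = {x, y}"
      using ends_subset_verts V by metis
    then show "ends H e \<in> ?S" by (elim insertE) (auto simp: insert_commute)
  qed simp
  note n = ne ne[symmetric] doubleton_eq_iff singleton_insert_inj_eq' singleton_insert_inj_eq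
  show "valency H a = 2 * m {a} + m {a, b} + m {a, c}" "valency H b = 2 * m {b} + m {a, b} + m {b, c}"
      "valency H c = 2 * m {c} + m {a, c} + m {b, c}"
    using valency_multiplicity[OF S, of a] valency_multiplicity[OF S, of b] valency_multiplicity[OF S, of c]
    by (simp_all add: n)
  show "2 \<le> m {a, b} + m {a, c}" "2 \<le> m {a, b} + m {b, c}" "2 \<le> m {a, c} + m {b, c}"
    using cut_multiplicity[OF S, of "{a}"] cut_multiplicity[OF S, of "{b}"] cut_multiplicity[OF S, of "{c}"] ne
    by (simp_all add: n V)
  show "image_mset (ends H) (mset_set (edges H)) =
      replicate_mset (m {a}) {a} + replicate_mset (m {b}) {b} + replicate_mset (m {c}) {c} +
      replicate_mset (m {a, b}) {a, b} + replicate_mset (m {a, c}) {a, c} + replicate_mset (m {b, c}) {b, c}"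
    using ends_mset_expand[OF fin(2) S] by (simp add: n add_ac)
qed

text \<open>The valencies and the cut conditions become linear relations between multiplicities, which leave few
  possibilities for the graph.\<close>

lemma multiplicities_4:
  assumes V: "verts H = {a, b, c, d}" and ne: "a \<noteq> b" "a \<noteq> c" "a \<noteq> d" "b \<noteq> c" "b \<noteq> d" "c \<noteq> d"
  shows "valency H a = 2 * m {a} + m {a, b} + m {a, c} + m {a, d}" "valency H b = 2 * m {b} + m {a, b} + m {b, c} + m {b, d}"
      "valency H c = 2 * m {c} + m {a, c} + m {b, c} + m {c, d}" "valency H d = 2 * m {d} + m {a, d} + m {b, d} + m {c, d}"
      "2 \<le> m {a, b} + m {a, c} + m {a, d}" "2 \<le> m {a, b} + m {b, c} + m {b, d}"
      "2 \<le> m {a, c} + m {b, c} + m {c, d}" "2 \<le> m {a, d} + m {b, d} + m {c, d}"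
      "2 \<le> m {a, c} + m {a, d} + m {b, c} + m {b, d}" "2 \<le> m {a, b} + m {a, d} + m {b, c} + m {c, d}"
      "2 \<le> m {a, b} + m {a, c} + m {b, d} + m {c, d}"
    and "image_mset (ends H) (mset_set (edges H)) =
      replicate_mset (m {a}) {a} + replicate_mset (m {b}) {b} + replicate_mset (m {c}) {c} + replicate_mset (m {d}) {d} +
      replicate_mset (m {a, b}) {a, b} + replicate_mset (m {a, c}) {a, c} + replicate_mset (m {a, d}) {a, d} +
      replicate_mset (m {b, c}) {b, c} + replicate_mset (m {b, d}) {b, d} + replicate_mset (m {c, d}) {c, d}"
proof -
  let ?S = "{{a}, {b}, {c}, {d}, {a, b}, {a, c}, {a, d}, {b, c}, {b, d}, {c, d}}"
  have S: "finite ?S" "\<And>e. e \<in> edges H \<Longrightarrow> ends H e \<in> ?S"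
  proof -
    fix e assume "e \<in> edges H"
    then obtain x y where "x \<in> {a, b, c, d}" "y \<in> {a, b, c, d}" "ends H e = {x, y}"
      using ends_subset_verts V by metis
    then show "ends H e \<in> ?S" by (elim insertE) (auto simp: insert_commute)
  qed simp
  note n = ne ne[symmetric] doubleton_eq_iff singleton_insert_inj_eq' singleton_insert_inj_eq
  show "valency H a = 2 * m {a} + m {a, b} + m {a, c} + m {a, d}"
    using valency_multiplicity[OF S, of a] by (simp add: n)
  show "valency H b = 2 * m {b} + m {a, b} + m {b, c} + m {b, d}"
    using valency_multiplicity[OF S, of b] by (simp add: n)
  show "valency H c = 2 * m {c} + m {a, c} + m {b, c} + m {c, d}"
    using valency_multiplicity[OF S, of c] by (simp add: n)
  show "valency H d = 2 * m {d} + m {a, d} + m {b, d} + m {c, d}"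
    using valency_multiplicity[OF S, of d] by (simp add: n)
  show "2 \<le> m {a, b} + m {a, c} + m {a, d}"
    using cut_multiplicity[OF S, of "{a}"] by (simp add: n V)
  show "2 \<le> m {a, b} + m {b, c} + m {b, d}"
    using cut_multiplicity[OF S, of "{b}"] by (simp add: n V)
  show "2 \<le> m {a, c} + m {b, c} + m {c, d}"
    using cut_multiplicity[OF S, of "{c}"] by (simp add: n V)
  show "2 \<le> m {a, d} + m {b, d} + m {c, d}"
    using cut_multiplicity[OF S, of "{d}"] by (simp add: n V)
  have W: "{a, b} \<noteq> {a, b, c, d}" "{a, c} \<noteq> {a, b, c, d}" "{a, d} \<noteq> {a, b, c, d}"
    using ne by (auto simp: set_eq_iff)
  show "2 \<le> m {a, c} + m {a, d} + m {b, c} + m {b, d}"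
    using cut_multiplicity[OF S, of "{a, b}"] W(1) by (simp add: n V)
  show "2 \<le> m {a, b} + m {a, d} + m {b, c} + m {c, d}"
    using cut_multiplicity[OF S, of "{a, c}"] W(2) by (simp add: n V)
  show "2 \<le> m {a, b} + m {a, c} + m {b, d} + m {c, d}"
    using cut_multiplicity[OF S, of "{a, d}"] W(3) by (simp add: n V)
  show "image_mset (ends H) (mset_set (edges H)) =
      replicate_mset (m {a}) {a} + replicate_mset (m {b}) {b} + replicate_mset (m {c}) {c} + replicate_mset (m {d}) {d} +
      replicate_mset (m {a, b}) {a, b} + replicate_mset (m {a, c}) {a, c} + replicate_mset (m {a, d}) {a, d} +
      replicate_mset (m {b, c}) {b, c} + replicate_mset (m {b, d}) {b, d} + replicate_mset (m {c, d}) {c, d}"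
    using ends_mset_expand[OF fin(2) S] by (simp add: n add_ac)
qed

definition "unit = (\<lambda>e\<in>edges H. 1 :: real)"

lemma edge_data_unit: "edge_data (H, unit, q) = image_mset (\<lambda>s. (s, 1)) (image_mset (ends H) (mset_set (edges H)))"
  unfolding edge_data_def prod.case image_mset.compositionality
  using fin(2) by (intro image_mset_cong) (simp add: unit_def)

lemma replicate_mset_2: "replicate_mset 2 z = {#z, z#}" "replicate_mset 3 z = {#z, z, z#}"
  by (simp_all add: numeral_2_eq_2 numeral_3_eq_3)

text \<open>Branch vertices and marks are the only vertices, so there are at most four. For each pattern of
  coincidences among them, linear arithmetic on the multiplicities determines the edges, and these
  are recognised as a contraction of one of the two models. Length 1 on all edges is an arbitrary
  choice of a nondegenerate curve on the graph.\<close>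

lemma bridgeless_model:
  "\<exists>u v l. l \<in> cell_A \<and> fits_A (H, unit, q) u v l \<or> l \<in> cell_B \<and> fits_B (H, unit, q) u v l"
proof -
  obtain u v where "u \<in> verts H" "v \<in> verts H" and K: "\<forall>w\<in>verts H. int (valency H w) - 2 = of_bool (u = w) + of_bool (v = w)"
    and V: "verts H = {u, v, q 1, q 2}"
    by (rule branch_vertices)
  define x where "x = q 1"
  define y where "y = q 2"
  have V: "verts H = {u, v, x, y}"
    using V by (simp add: x_def y_def)
  have val: "valency H w = 2 + of_bool (u = w) + of_bool (v = w)" if "w \<in> {u, v, x, y}" for w
    using bspec[OF K, of w] that V by (auto simp: of_bool_def split: if_splits)
  have A: ?thesis if "(a1, a2, a3, b, c) \<in> cell_A" "a1 = 0 \<longrightarrow> s = x" "a2 = 0 \<longrightarrow> x = y" "a3 = 0 \<longrightarrow> y = t" "b = 0 \<longrightarrow> s = t" "c = 0 \<longrightarrow> s = t"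
    "verts H = {s, t, x, y}" "image_mset (\<lambda>s. (s, 1)) (image_mset (ends H) (mset_set (edges H))) = A_data s t x y (a1, a2, a3, b, c)"
    for a1 a2 a3 b c s t
    using that by (intro exI[of _ s] exI[of _ t] exI[of _ "(a1, a2, a3, b, c)"] disjI1 conjI)
      (simp_all add: fits_A_def edge_data_unit x_def y_def)
  have B: ?thesis if "(a1, a2, b1, b2, c) \<in> cell_B" "a1 = 0 \<longrightarrow> s = x" "a2 = 0 \<longrightarrow> x = t" "b1 = 0 \<longrightarrow> s = y" "b2 = 0 \<longrightarrow> y = t" "c = 0 \<longrightarrow> s = t"
    "verts H = {s, t, x, y}" "image_mset (\<lambda>s. (s, 1)) (image_mset (ends H) (mset_set (edges H))) = B_data s t x y (a1, a2, b1, b2, c)"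
    for a1 a2 b1 b2 c s t
    using that by (intro exI[of _ s] exI[of _ t] exI[of _ "(a1, a2, b1, b2, c)"] disjI2 conjI)
      (simp_all add: fits_B_def edge_data_unit x_def y_def)
  note d = A_data_def B_data_def cell_A_def cell_B_def replicate_mset_2 insert_commute add_mset_commute
  show ?thesis
  proof (cases "u = v")
    case uv: False
    have vuv: "valency H u = 3" "valency H v = 3"
      using val[of u] val[of v] uv by simp_all
    consider (none) "x \<notin> {u, v}" "y \<notin> {u, v, x}" | (eq) "x \<notin> {u, v}" "y = x" | (yu) "x \<notin> {u, v}" "y = u"
      | (yv) "x \<notin> {u, v}" "y = v" | (xu) "x = u" "y \<notin> {u, v}" | (xv) "x = v" "y \<notin> {u, v}"
      | (uu) "x = u" "y = u" | (uv) "x = u" "y = v" | (vu) "x = v" "y = u" | (vv) "x = v" "y = v"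
      by blast
    then show ?thesis
    proof cases
      case none
      have vxy: "valency H x = 2" "valency H y = 2"
        using val[of x] val[of y] none by auto
      have ne: "u \<noteq> v" "u \<noteq> x" "u \<noteq> y" "v \<noteq> x" "v \<noteq> y" "x \<noteq> y"
        using none uv by auto
      note M = multiplicities_4[OF V ne, unfolded vuv vxy]
      have loops: "m {u} = 0" "m {v} = 0" "m {x} = 0" "m {y} = 0"
        using M(1-8) by linarith+
      have xy: "m {x, y} = 0 \<or> m {x, y} = 1"
        using M(3,4,9) loops by linarith
      have "m {x, y} = 0 \<and> m {u, x} = 1 \<and> m {v, x} = 1 \<and> m {u, y} = 1 \<and> m {v, y} = 1 \<and> m {u, v} = 1 \<or>
          m {x, y} = 1 \<and> m {u, x} = 1 \<and> m {v, x} = 0 \<and> m {u, y} = 0 \<and> m {v, y} = 1 \<and> m {u, v} = 2 \<or>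
          m {x, y} = 1 \<and> m {u, x} = 0 \<and> m {v, x} = 1 \<and> m {u, y} = 1 \<and> m {v, y} = 0 \<and> m {u, v} = 2"
        using xy
      proof
        assume xy: "m {x, y} = 0"
        have "m {u, v} = 1"
          using M(1-4) loops xy by linarith
        moreover then have "2 * m {u, x} \<le> 3" "2 * m {u, x} \<ge> 1"
          using M(1-4,10,11) loops xy by linarith+
        then have "m {u, x} = 1" by presburger
        ultimately show ?thesis
          using M(1-4) loops xy by linarith
      next
        assume xy: "m {x, y} = 1"
        have "m {u, v} = 2"
          using M(1-4) loops xy by linarith
        moreover have "m {u, x} = 0 \<or> m {u, x} = 1"
          using M(3) loops xy by linarith
        ultimately show ?thesis
          using M(1-4) loops xy by linarith
      qed
      then show ?thesis
      proof (elim disjE conjE)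
        assume "m {x, y} = 0" "m {u, x} = 1" "m {v, x} = 1" "m {u, y} = 1" "m {v, y} = 1" "m {u, v} = 1"
        then show ?thesis
          using V M(12) loops by (intro B[of 1 1 1 1 1 u v]) (simp_all add: d)
      next
        assume "m {x, y} = 1" "m {u, x} = 1" "m {v, x} = 0" "m {u, y} = 0" "m {v, y} = 1" "m {u, v} = 2"
        then show ?thesis
          using V M(12) loops by (intro A[of 1 1 1 1 1 u v]) (simp_all add: d)
      next
        assume "m {x, y} = 1" "m {u, x} = 0" "m {v, x} = 1" "m {u, y} = 1" "m {v, y} = 0" "m {u, v} = 2"
        then show ?thesis
          using V M(12) loops by (intro A[of 1 1 1 1 1 v u]) (simp_all add: d)
      qed
    next
      case eq
      have V3: "verts H = {u, v, x}" and vx: "valency H x = 2" and ne: "u \<noteq> v" "u \<noteq> x" "v \<noteq> x"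
        using V eq uv val[of x] by auto
      note M = multiplicities_3[OF V3 ne, unfolded vuv vx]
      have loops: "m {u} = 0" "m {v} = 0" "m {x} = 0"
        using M(1-6) by linarith+
      have "m {u, x} = 1" "m {v, x} = 1" "m {u, v} = 2"
        using M(1-3) unfolding loops by linarith+
      with loops show ?thesis
        using V M(7) eq by (intro A[of 1 0 1 1 1 u v]) (simp_all add: d)
    next
      case yu
      have V3: "verts H = {u, v, x}" and vx: "valency H x = 2" and ne: "u \<noteq> v" "u \<noteq> x" "v \<noteq> x"
        using V yu uv val[of x] by auto
      note M = multiplicities_3[OF V3 ne, unfolded vuv vx]
      have loops: "m {u} = 0" "m {v} = 0" "m {x} = 0"
        using M(1-6) by linarith+
      have "m {u, x} = 1" "m {v, x} = 1" "m {u, v} = 2"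
        using M(1-3) unfolding loops by linarith+
      with loops show ?thesis
        using V M(7) yu by (intro B[of 1 1 0 1 1 u v]) (simp_all add: d)
    next
      case yv
      have V3: "verts H = {u, v, x}" and vx: "valency H x = 2" and ne: "u \<noteq> v" "u \<noteq> x" "v \<noteq> x"
        using V yv uv val[of x] by auto
      note M = multiplicities_3[OF V3 ne, unfolded vuv vx]
      have loops: "m {u} = 0" "m {v} = 0" "m {x} = 0"
        using M(1-6) by linarith+
      have "m {u, x} = 1" "m {v, x} = 1" "m {u, v} = 2"
        using M(1-3) unfolding loops by linarith+
      with loops show ?thesis
        using V M(7) yv by (intro B[of 1 1 1 0 1 u v]) (simp_all add: d)
    next
      case xu
      have V3: "verts H = {u, v, y}" and vy: "valency H y = 2" and ne: "u \<noteq> v" "u \<noteq> y" "v \<noteq> y"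
        using V xu uv val[of y] by auto
      note M = multiplicities_3[OF V3 ne, unfolded vuv vy]
      have loops: "m {u} = 0" "m {v} = 0" "m {y} = 0"
        using M(1-6) by linarith+
      have "m {u, y} = 1" "m {v, y} = 1" "m {u, v} = 2"
        using M(1-3) unfolding loops by linarith+
      with loops show ?thesis
        using V M(7) xu by (intro B[of 0 1 1 1 1 u v]) (simp_all add: d)
    next
      case xv
      have V3: "verts H = {u, v, y}" and vy: "valency H y = 2" and ne: "u \<noteq> v" "u \<noteq> y" "v \<noteq> y"
        using V xv uv val[of y] by auto
      note M = multiplicities_3[OF V3 ne, unfolded vuv vy]
      have loops: "m {u} = 0" "m {v} = 0" "m {y} = 0"
        using M(1-6) by linarith+
      have "m {u, y} = 1" "m {v, y} = 1" "m {u, v} = 2"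
        using M(1-3) unfolding loops by linarith+
      with loops show ?thesis
        using V M(7) xv by (intro B[of 1 0 1 1 1 u v]) (simp_all add: d)
    next
      case uu
      have V2: "verts H = {u, v}"
        using V uu by auto
      note M = multiplicities_2[OF V2 uv, unfolded vuv]
      have loops: "m {u} = 0" "m {v} = 0"
        using M(1-3) by linarith+
      moreover have "m {u, v} = 3"
        using M(1) unfolding loops by linarith
      ultimately show ?thesis
        using V M(4) uu by (intro B[of 0 1 0 1 1 u v]) (simp_all add: d)
    next
      case uv': uv
      have V2: "verts H = {u, v}"
        using V uv' by auto
      note M = multiplicities_2[OF V2 uv, unfolded vuv]
      have loops: "m {u} = 0" "m {v} = 0"
        using M(1-3) by linarith+
      moreover have "m {u, v} = 3"
        using M(1) unfolding loops by linarith
      ultimately show ?thesis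
        using V M(4) uv' by (intro B[of 0 1 1 0 1 u v]) (simp_all add: d)
    next
      case vu
      have V2: "verts H = {u, v}"
        using V vu by auto
      note M = multiplicities_2[OF V2 uv, unfolded vuv]
      have loops: "m {u} = 0" "m {v} = 0"
        using M(1-3) by linarith+
      moreover have "m {u, v} = 3"
        using M(1) unfolding loops by linarith
      ultimately show ?thesis
        using V M(4) vu by (intro B[of 1 0 0 1 1 u v]) (simp_all add: d)
    next
      case vv
      have V2: "verts H = {u, v}"
        using V vv by auto
      note M = multiplicities_2[OF V2 uv, unfolded vuv]
      have loops: "m {u} = 0" "m {v} = 0"
        using M(1-3) by linarith+
      moreover have "m {u, v} = 3"
        using M(1) unfolding loops by linarith
      ultimately show ?thesis
        using V M(4) vv by (intro B[of 1 0 1 0 1 u v]) (simp_all add: d)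
    qed
  next
    case uv: True
    have vu: "valency H u = 4"
      using val[of u] uv by simp
    consider (none) "x \<noteq> u" "y \<noteq> u" "y \<noteq> x" | (eq) "x \<noteq> u" "y = x" | (yu) "x \<noteq> u" "y = u" | (xu) "x = u" "y \<noteq> u" | (uu) "x = u" "y = u"
      by blast
    then show ?thesis
    proof cases
      case none
      have V3: "verts H = {u, x, y}" and vxy: "valency H x = 2" "valency H y = 2" and ne: "u \<noteq> x" "u \<noteq> y" "x \<noteq> y"
        using V none uv val[of x] val[of y] by auto
      note M = multiplicities_3[OF V3 ne, unfolded vu vxy]
      have loops: "m {x} = 0" "m {y} = 0"
        using M(2,3,5,6) by linarith+
      have xy: "m {x, y} = 0 \<or> m {x, y} = 1"
        using M(2-4) loops by linarith
      then show ?thesis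
      proof
        assume "m {x, y} = 0"
        moreover then have "m {u, x} = 2" "m {u, y} = 2" "m {u} = 0"
          using M(1-3) loops by linarith+
        ultimately show ?thesis
          using V M(7) uv loops by (intro B[of 1 1 1 1 0 u u]) (simp_all add: d)
      next
        assume "m {x, y} = 1"
        moreover then have "m {u, x} = 1" "m {u, y} = 1" "m {u} = 1"
          using M(1-3) loops by linarith+
        ultimately show ?thesis
          using V M(7) uv loops by (intro A[of 1 1 1 1 0 u u]) (simp_all add: d)
      qed
    next
      case eq
      have V2: "verts H = {u, x}" and vx: "valency H x = 2" and ne: "u \<noteq> x"
        using V eq uv val[of x] by auto
      note M = multiplicities_2[OF V2 ne, unfolded vu vx]
      have loops: "m {x} = 0"
        using M(1-3) by linarith
      moreover have "m {u, x} = 2"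
        using M(2) unfolding loops by linarith
      moreover then have "m {u} = 1"
        using M(1) by linarith
      ultimately show ?thesis
        using V M(4) eq uv by (intro A[of 1 0 1 1 0 u u]) (simp_all add: d)
    next
      case yu
      have V2: "verts H = {u, x}" and vx: "valency H x = 2" and ne: "u \<noteq> x"
        using V yu uv val[of x] by auto
      note M = multiplicities_2[OF V2 ne, unfolded vu vx]
      have loops: "m {x} = 0"
        using M(1-3) by linarith
      moreover have "m {u, x} = 2"
        using M(2) unfolding loops by linarith
      moreover then have "m {u} = 1"
        using M(1) by linarith
      ultimately show ?thesis
        using V M(4) yu uv by (intro B[of 1 1 0 1 0 u u]) (simp_all add: d)
    next
      case xu
      have V2: "verts H = {u, y}" and vy: "valency H y = 2" and ne: "u \<noteq> y"
        using V xu uv val[of y] by auto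
      note M = multiplicities_2[OF V2 ne, unfolded vu vy]
      have loops: "m {y} = 0"
        using M(1-3) by linarith
      moreover have "m {u, y} = 2"
        using M(2) unfolding loops by linarith
      moreover then have "m {u} = 1"
        using M(1) by linarith
      ultimately show ?thesis
        using V M(4) xu uv by (intro B[of 0 1 1 1 0 u u]) (simp_all add: d)
    next
      case uu
      have V1: "verts H = {u}"
        using V uu uv by auto
      have "m {u} = 2"
        using multiplicities_1(1)[OF V1] vu by simp
      then show ?thesis
        using V multiplicities_1(2)[OF V1] uu uv by (intro B[of 0 1 0 1 0 u u]) (simp_all add: d)
    qed
  qed
qed

end

section \<open>Every type is modelled, up to bridges, by one of the two maximal types\<close>

lemma lens_coordinates: "f \<in> extensional {0,1,2,3,4} \<Longrightarrow> lens (f 0, f (Suc 0), f 2, f 3, f 4) = f"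
  by (rule ext) (auto simp: lens_def extensional_def)

lemma continuous_map_cell_coordinate:
  "e \<in> edges G \<Longrightarrow> continuous_map (cell G) euclideanreal (\<lambda>l. l e)"
  unfolding cell_def by (intro continuous_map_from_subtopology continuous_map_product_projection)

lemma continuous_map_euclidean_Pair:
  assumes "continuous_map X euclidean f" "continuous_map X euclidean g"
  shows "continuous_map X euclidean (\<lambda>x. (f x, g x))"
  using continuous_map_pairedI[OF assms] by (simp add: euclidean_product_topology)

lemma topspace_cell_iff:
  "combinatorial_type g n G p \<Longrightarrow> l \<in> topspace (cell G) \<longleftrightarrow> degenerate_curve g n (G, l, p)"
  using degenerate_curve_iff_cell by blast

text \<open>A type \<open>G\<close> with its bridges contracted is the graph \<open>H\<close>, and a model \<open>M\<close> with some edges contracted is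
  \<open>H\<close> too. Hence lengths on \<open>G\<close> give lengths on \<open>M\<close>: corresponding edges get the same length and the
  contracted edges of \<open>M\<close> get length zero. This map is continuous because every coordinate is either
  zero or a coordinate.\<close>

lemma lift_to_model:
  fixes H :: "(nat, nat) multigraph"
  assumes ct: "combinatorial_type 2 2 G p"
    and t: "tropical_curve 2 2 (H, m, q)"
    and h: "contraction_map 2 (G, shrink_bridges G 1 (\<lambda>e\<in>edges G. 1), p) (H, m, q) h \<epsilon>"
    and M: "degenerate_curve 2 2 (M, lens lM, model_marking)" "edges M = {0,1,2,3,4}"
    and k: "contraction_map 2 (M, lens lM, model_marking) (H, \<lambda>e\<in>edges H. 1, q) k \<delta>"
  shows "\<exists>L. continuous_map (cell G) euclidean L \<and> (\<forall>l\<in>topspace (cell G).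
    degenerate_curve 2 2 (M, lens (L l), model_marking) \<and>
    TM_map 2 2 ((G, p), shrink_bridges G 1 l) = TM_map 2 2 ((M, model_marking), lens (L l)))"
proof -
  define l0 where "l0 = shrink_bridges G 1 (\<lambda>e\<in>edges G. 1)"
  let ?Z = "zero_edges G l0" and ?Y = "zero_edges M (lens lM)"
  have ctH: "combinatorial_type 2 2 H q"
    using t by (simp add: tropical_curve_def)
  have Z: "?Z = bridges G"
    by (auto simp: zero_edges_def l0_def shrink_bridges_def bridges_def)
  have "tropical_curve 2 2 (G, \<lambda>e\<in>edges G. 1, p)"
    using ct by (simp add: tropical_curve_def)
  then have C: "degenerate_curve 2 2 (G, l0, p)"
    unfolding l0_def by (intro degenerate_shrink_bridges tropical_imp_degenerate(1)) auto
  have tu: "tropical_curve 2 2 (H, \<lambda>e\<in>edges H. 1, q)"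
    using ctH by (simp add: tropical_curve_def)
  have h: "contraction_map 2 (G, l0, p) (H, m, q) h \<epsilon>"
    using h by (simp add: l0_def)
  interpret h: contraction_of G H ?Z h \<epsilon>
    by (rule contraction_map_contraction_of[OF C ctH h])
  interpret k: contraction_of M H ?Y k \<delta>
    by (rule contraction_map_contraction_of[OF M(1) ctH k])
  define inv where "inv = the_inv_into (edges G - ?Z) \<epsilon>"
  have inv1: "inv (\<epsilon> e) = e" if "e \<in> edges G - ?Z" for e
    using that h.bij by (simp add: inv_def bij_betw_def the_inv_into_f_f)
  have inv2: "inv f \<in> edges G" if "f \<in> edges H" for f
  proof -
    obtain e where "e \<in> edges G - ?Z" "f = \<epsilon> e"
      using \<open>f \<in> edges H\<close> h.image_edges by blast
    then show ?thesis using inv1 by auto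
  qed
  define co where "co l = (\<lambda>e\<in>{0,1,2,3,4}. if e \<in> ?Y then 0 else l (inv (\<delta> e)))" for l :: "nat \<Rightarrow> real"
  define L where "L l = (co l 0, co l (Suc 0), co l 2, co l 3, co l 4)" for l
  have lens: "lens (L l) = co l" for l
    unfolding L_def by (rule lens_coordinates) (simp only: co_def restrict_extensional)
  have cont: "continuous_map (cell G) euclideanreal (\<lambda>l. co l e)" if e: "e \<in> {0,1,2,3,4}" for e
  proof (cases "e \<in> ?Y")
    case True
    then show ?thesis using e by (simp add: co_def)
  next
    case False
    then have "inv (\<delta> e) \<in> edges G"
      using e k.image_edges M(2) by (intro inv2) blast
    then have "continuous_map (cell G) euclideanreal (\<lambda>l. l (inv (\<delta> e)))"
      by (rule continuous_map_cell_coordinate)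
    then show ?thesis
      by (rule continuous_map_eq) (use e False in \<open>simp add: co_def\<close>)
  qed
  have "continuous_map (cell G) euclidean L"
    unfolding L_def by (intro continuous_map_euclidean_Pair cont) auto
  moreover have "degenerate_curve 2 2 (M, co l, model_marking) \<and>
      TM_map 2 2 ((G, p), shrink_bridges G 1 l) = TM_map 2 2 ((M, model_marking), co l)" if l: "l \<in> topspace (cell G)" for l
  proof -
    have dl: "degenerate_curve 2 2 (G, l, p)"
      using l topspace_cell_iff[OF ct] by simp
    then have l0: "l e \<ge> 0" if "e \<in> edges G" for e
      using that by (auto simp: degenerate_curve_def)
    define m' where "m' = (\<lambda>f\<in>edges H. l (inv f))"
    have m': "m' \<in> edges H \<rightarrow>\<^sub>E {0..}"
      using l0 inv2 by (auto simp: m'_def)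
    let ?l = "shrink_bridges G 1 l"
    have d: "degenerate_curve 2 2 (G, ?l, p)"
      by (rule degenerate_shrink_bridges[OF dl]) simp
    have G1: "?l \<in> edges G \<rightarrow>\<^sub>E {0..}"
      using d by (simp add: degenerate_curve_def)
    have G2: "?l e = 0" if "e \<in> ?Z" for e
      using that unfolding Z by (simp add: shrink_bridges_def bridges_def)
    have G3: "m' (\<epsilon> e) = ?l e" if e: "e \<in> edges G - ?Z" for e
    proof -
      have "\<epsilon> e \<in> edges H"
        using e h.image_edges by blast
      then show ?thesis
        using e inv1[OF e] unfolding Z by (simp add: m'_def shrink_bridges_def)
    qed
    note 1 = TM_map_pullback[OF C t h G1 G2 m' G3]
    have co: "co l \<in> edges M \<rightarrow>\<^sub>E {0..}"
    proof (rule PiE_I)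
      fix e assume e: "e \<in> edges M"
      show "co l e \<in> {0..}"
      proof (cases "e \<in> ?Y")
        case False
        then have "\<delta> e \<in> edges H" using e k.image_edges by blast
        then show ?thesis using e False l0 inv2 by (simp add: co_def M(2))
      qed (use e in \<open>simp add: co_def M(2)\<close>)
    qed (simp add: co_def M(2))
    have M2: "co l e = 0" if "e \<in> ?Y" for e
      using that by (auto simp: co_def M(2) zero_edges_def)
    have M3: "m' (\<delta> e) = co l e" if e: "e \<in> edges M - ?Y" for e
    proof -
      have "\<delta> e \<in> edges H" using e k.image_edges by blast
      then show ?thesis using e by (simp add: m'_def co_def M(2))
    qed
    note 2 = TM_map_pullback[OF M(1) tu k co M2 m' M3]
    show ?thesis
      using 1 2 d by simp
  qed
  ultimately show ?thesis
    unfolding lens[symmetric] by (intro exI[of _ L]) auto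
qed

text \<open>The bridgeless part of any cell factors continuously through one of the two models.\<close>

theorem model_of_type:
  assumes ct: "combinatorial_type 2 2 G p"
  shows "(\<exists>L. continuous_map (cell G) (top_of_set cell_A) L \<and>
      (\<forall>l\<in>topspace (cell G). TM_map 2 2 ((G, p), shrink_bridges G 1 l) = curve_A (L l))) \<or>
    (\<exists>L. continuous_map (cell G) (top_of_set cell_B) L \<and>
      (\<forall>l\<in>topspace (cell G). TM_map 2 2 ((G, p), shrink_bridges G 1 l) = curve_B (L l)))"
proof -
  let ?l0 = "shrink_bridges G 1 (\<lambda>e\<in>edges G. 1)"
  have "tropical_curve 2 2 (G, \<lambda>e\<in>edges G. 1, p)"
    using ct by (simp add: tropical_curve_def)
  then have C: "degenerate_curve 2 2 (G, ?l0, p)"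
    by (intro degenerate_shrink_bridges tropical_imp_degenerate(1)) auto
  have Z: "zero_edges G ?l0 = bridges G"
    by (auto simp: zero_edges_def shrink_bridges_def bridges_def)
  obtain D where D: "D \<in> TM_map 2 2 ((G, p), ?l0)"
    using TM_map_nonempty[OF C] by blast
  obtain H m q where Dd: "D = (H, m, q)" by (cases D)
  obtain h \<epsilon> where t: "tropical_curve 2 2 (H, m, q)" and h: "contraction_map 2 (G, ?l0, p) (H, m, q) h \<epsilon>"
    using D unfolding Dd mem_TM_map[OF C] by blast
  have ctH: "combinatorial_type 2 2 H q"
    using t by (simp add: tropical_curve_def)
  interpret h: contraction_of G H "zero_edges G ?l0" h \<epsilon>
    by (rule contraction_map_contraction_of[OF C ctH h])
  have "bridges H = {}"
  proof -
    have "f \<notin> bridges H" if f: "f \<in> edges H" for f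
    proof -
      obtain e where "e \<in> edges G - zero_edges G ?l0" "f = \<epsilon> e"
        using f h.image_edges by blast
      then show ?thesis
        using h.bridges_image_iff[of e] Z by simp
    qed
    then show ?thesis by (auto simp: bridges_def)
  qed
  then interpret H: bridgeless_type H q
    by unfold_locales (rule ctH)
  have tu: "tropical_curve 2 2 (H, \<lambda>e\<in>edges H. 1, q)"
    using ctH by (simp add: tropical_curve_def)
  obtain u v l where "l \<in> cell_A \<and> fits_A (H, H.unit, q) u v l \<or> l \<in> cell_B \<and> fits_B (H, H.unit, q) u v l"
    using H.bridgeless_model by blast
  then show ?thesis
  proof (elim disjE conjE)
    assume l: "l \<in> cell_A" and f: "fits_A (H, H.unit, q) u v l"
    note M = degenerate_curve_graph_A[THEN iffD2, OF l]
    have "(H, \<lambda>e\<in>edges H. 1, q) \<in> curve_A l"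
      unfolding mem_curve_A[OF l] using tu f unfolding H.unit_def by blast
    then obtain k \<delta> where "contraction_map 2 (graph_A, lens l, model_marking) (H, \<lambda>e\<in>edges H. 1, q) k \<delta>"
      unfolding curve_A_def mem_TM_map[OF M] by blast
    from lift_to_model[OF ct t h M edges_graph_AB(1) this]
    show ?thesis
      unfolding degenerate_curve_graph_A curve_A_def by (auto simp: continuous_map_in_subtopology)
  next
    assume l: "l \<in> cell_B" and f: "fits_B (H, H.unit, q) u v l"
    note M = degenerate_curve_graph_B[THEN iffD2, OF l]
    have "(H, \<lambda>e\<in>edges H. 1, q) \<in> curve_B l"
      unfolding mem_curve_B[OF l] using tu f unfolding H.unit_def by blast
    then obtain k \<delta> where "contraction_map 2 (graph_B, lens l, model_marking) (H, \<lambda>e\<in>edges H. 1, q) k \<delta>"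
      unfolding curve_B_def mem_TM_map[OF M] by blast
    from lift_to_model[OF ct t h M edges_graph_AB(2) this]
    show ?thesis
      unfolding degenerate_curve_graph_B curve_B_def by (auto simp: continuous_map_in_subtopology)
  qed
qed

section \<open>Maps out of the moduli space\<close>

lemma topspace_cells: "((G, p), l) \<in> topspace (cells g n) \<longleftrightarrow> degenerate_curve g n (G, l, p)"
  unfolding cells_def by (simp add: degenerate_curve_iff_cell)

lemma TM_eq_final_topology: "TM g n = final_topology (cells g n) (TM_map g n)"
proof -
  have "TM_points g n = TM_map g n ` topspace (cells g n)"
    unfolding TM_points_eq using topspace_cells by (force simp: image_iff)
  then show ?thesis
    unfolding topology_eq openin_TM openin_final_topology by simp
qed

lemma topspace_TM: "topspace (TM g n) = TM_points g n"
  unfolding TM_eq_final_topology topspace_final_topology TM_points_eq using topspace_cells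
  by (force simp: image_iff)

lemma continuous_map_TM_map:
  assumes "combinatorial_type g n G p"
  shows "continuous_map (cell G) (TM g n) (\<lambda>l. TM_map g n ((G, p), l))"
proof -
  have "continuous_map ((\<lambda>(G, p). cell G) (G, p)) (cells g n) (Pair (G, p))"
    unfolding cells_def by (rule continuous_map_sum_topology_inj) (use assms in simp)
  then have "continuous_map (cell G) (TM g n) (TM_map g n \<circ> Pair (G, p))"
    unfolding TM_eq_final_topology
    using quotient_imp_continuous_map[OF quotient_map_final_topology] by (auto intro: continuous_map_compose)
  then show ?thesis by (simp add: o_def)
qed

lemma continuous_map_prod_from_TM:
  assumes "\<And>G p. combinatorial_type g n G p \<Longrightarrow>
    continuous_map (prod_topology (top_of_set {0..1::real}) (cell G)) Y (\<lambda>(t, l). F (t, TM_map g n ((G, p), l)))"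
  shows "continuous_map (prod_topology (top_of_set {0..1}) (TM g n)) Y F"
  unfolding TM_eq_final_topology
proof (rule continuous_map_prod_from_final_topology)
  show "continuous_map (prod_topology (top_of_set {0..1}) (cells g n)) Y (\<lambda>(t, x). F (t, TM_map g n x))"
    unfolding cells_def
  proof (rule continuous_map_prod_sum_topology)
    fix i :: "(nat, nat) multigraph \<times> (nat \<Rightarrow> nat)"
    assume "i \<in> {(G, p). combinatorial_type g n G p}"
    then obtain G p where i: "i = (G, p)" and ct: "combinatorial_type g n G p" by auto
    from assms[OF ct]
    show "continuous_map (prod_topology (top_of_set {0..1}) ((\<lambda>(G, p). cell G) i)) Y
        (\<lambda>(t, x). (\<lambda>(t, x). F (t, TM_map g n x)) (t, i, x))"
      by (simp add: i)
  qed
qed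

text \<open>The value does not depend on the representative chosen from the class, by
  \<open>TM_map_shrink_bridges\<close>.\<close>

definition bridge_homotopy :: "nat \<Rightarrow> nat \<Rightarrow> real \<times> (nat, nat) curve set \<Rightarrow> (nat, nat) curve set" where
  "bridge_homotopy g n = (\<lambda>(t, \<tau>). case SOME D. D \<in> \<tau> of (H, m, q) \<Rightarrow> TM_map g n ((H, q), shrink_bridges H t m))"

lemma bridge_homotopy_TM_map:
  assumes C: "degenerate_curve g n (G, l, p)" and t: "t \<in> {0..1}"
  shows "bridge_homotopy g n (t, TM_map g n ((G, p), l)) = TM_map g n ((G, p), shrink_bridges G t l)"
proof -
  have "(SOME D. D \<in> TM_map g n ((G, p), l)) \<in> TM_map g n ((G, p), l)"
    using TM_map_nonempty[OF C] by (rule someI_ex)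
  moreover obtain H m q where D: "(SOME D. D \<in> TM_map g n ((G, p), l)) = (H, m, q)"
    by (cases "SOME D. D \<in> TM_map g n ((G, p), l)")
  ultimately show ?thesis
    using TM_map_shrink_bridges[OF C _ t] by (simp add: bridge_homotopy_def)
qed

lemma continuous_map_shrink_bridges:
  assumes ct: "combinatorial_type g n G p"
  shows "continuous_map (prod_topology (top_of_set {0..1}) (cell G)) (cell G) (\<lambda>(t, l). shrink_bridges G t l)"
proof -
  have "continuous_map (prod_topology (top_of_set {0..1}) (cell G)) (product_topology (\<lambda>_. euclideanreal) (edges G)) (\<lambda>(t, l). shrink_bridges G t l)"
    unfolding continuous_map_componentwise
  proof (intro conjI ballI)
    fix e assume e: "e \<in> edges G"
    have l: "continuous_map (prod_topology (top_of_set {0..1::real}) (cell G)) euclideanreal (\<lambda>x. snd x e)"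
      using continuous_map_compose[OF continuous_map_snd continuous_map_cell_coordinate[OF e]] by (simp add: o_def)
    have t: "continuous_map (prod_topology (top_of_set {0..1::real}) (cell G)) euclideanreal (\<lambda>x. 1 - fst x)"
      by (intro continuous_intros continuous_map_into_fulltopology[OF continuous_map_fst])
    show "continuous_map (prod_topology (top_of_set {0..1}) (cell G)) euclideanreal (\<lambda>x. (case x of (t, l) \<Rightarrow> shrink_bridges G t l) e)"
      using e l continuous_map_real_mult[OF t l]
      by (cases "e \<in> bridges G") (simp_all add: shrink_bridges_def case_prod_beta')
  qed (auto simp: shrink_bridges_def)
  moreover have "shrink_bridges G t l \<in> topspace (cell G)" if "t \<in> {0..1}" "l \<in> topspace (cell G)" for t l
    using that degenerate_shrink_bridges[of g n G l p t] ct unfolding topspace_cell_iff[OF ct] by blast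
  ultimately have "continuous_map (prod_topology (top_of_set {0..1}) (cell G))
      (subtopology (product_topology (\<lambda>_. euclideanreal) (edges G)) (topspace (cell G))) (\<lambda>(t, l). shrink_bridges G t l)"
    by (intro continuous_map_into_subtopology) auto
  then show ?thesis
    unfolding cell_def topspace_subtopology subtopology_restrict .
qed

lemma continuous_map_bridge_homotopy:
  "continuous_map (prod_topology (top_of_set {0..1}) (TM g n)) (TM g n) (bridge_homotopy g n)"
proof (rule continuous_map_prod_from_TM)
  fix G :: "(nat, nat) multigraph" and p assume ct: "combinatorial_type g n G p"
  have "continuous_map (prod_topology (top_of_set {0..1}) (cell G)) (TM g n)
      ((\<lambda>l. TM_map g n ((G, p), l)) \<circ> (\<lambda>(t, l). shrink_bridges G t l))"
    by (rule continuous_map_compose[OF continuous_map_shrink_bridges[OF ct] continuous_map_TM_map[OF ct]])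
  then show "continuous_map (prod_topology (top_of_set {0..1}) (cell G)) (TM g n)
      (\<lambda>(t, l). bridge_homotopy g n (t, TM_map g n ((G, p), l)))"
    by (rule continuous_map_eq) (auto simp: topspace_cell_iff[OF ct] bridge_homotopy_TM_map)
qed

lemma bridge_homotopy_0:
  assumes "\<tau> \<in> TM_points g n"
  shows "bridge_homotopy g n (0, \<tau>) = \<tau>"
proof -
  obtain G p l where \<tau>: "\<tau> = TM_map g n ((G, p), l)" and C: "degenerate_curve g n (G, l, p)"
    using assms unfolding TM_points_eq by blast
  have "shrink_bridges G 0 l = l"
    using C by (auto simp: shrink_bridges_def degenerate_curve_def PiE_def extensional_def fun_eq_iff)
  then show ?thesis
    using bridge_homotopy_TM_map[OF C, of 0] by (simp add: \<tau>)
qed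

section \<open>The spaces of lengths modulo equality of curves\<close>

text \<open>Invariance under the moves of the model B on a set of lengths that is closed under the moves.\<close>

definition invariant_on :: "lengths set \<Rightarrow> (lengths \<Rightarrow> 'z) \<Rightarrow> bool" where
  "invariant_on Q \<Phi> \<longleftrightarrow> Q \<subseteq> cell_B \<and>
    (\<forall>a1 a2 b1 b2 c. (a1, a2, b1, b2, c) \<in> Q \<longrightarrow> (a2, a1, b2, b1, c) \<in> Q \<and> \<Phi> (a2, a1, b2, b1, c) = \<Phi> (a1, a2, b1, b2, c)) \<and>
    (\<forall>a1 a2 b1 b2. (a1, a2, b1, b2, 0) \<in> Q \<longrightarrow> (a2, a1, b1, b2, 0) \<in> Q \<and> \<Phi> (a2, a1, b1, b2, 0) = \<Phi> (a1, a2, b1, b2, 0)) \<and>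
    (\<forall>a2 b1 b2 c. (0, a2, b1, b2, c) \<in> Q \<longrightarrow> (0, c, b1, b2, a2) \<in> Q \<and> \<Phi> (0, c, b1, b2, a2) = \<Phi> (0, a2, b1, b2, c)) \<and>
    (\<forall>a1 a2 b2 c. (a1, a2, 0, b2, c) \<in> Q \<longrightarrow> (a1, a2, 0, c, b2) \<in> Q \<and> \<Phi> (a1, a2, 0, c, b2) = \<Phi> (a1, a2, 0, b2, c))"

lemma invariant_onD:
  assumes inv: "invariant_on Q \<Phi>" and l: "l \<in> Q" "l' \<in> cell_B" and eq: "curve_B l = curve_B l'"
  shows "l' \<in> Q" "\<Phi> l = \<Phi> l'"
proof -
  let ?\<Phi> = "\<lambda>l. if l \<in> Q then Some (\<Phi> l) else None"
  have 1: "?\<Phi> (a1, a2, b1, b2, c) = ?\<Phi> (a2, a1, b2, b1, c)" for a1 a2 b1 b2 c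
    using inv unfolding invariant_on_def by metis
  have 2: "?\<Phi> (a1, a2, b1, b2, 0) = ?\<Phi> (a2, a1, b1, b2, 0)" for a1 a2 b1 b2
    using inv unfolding invariant_on_def by metis
  have 3: "?\<Phi> (0, a2, b1, b2, c) = ?\<Phi> (0, c, b1, b2, a2)" for a2 b1 b2 c
    using inv unfolding invariant_on_def by metis
  have 4: "?\<Phi> (a1, a2, 0, b2, c) = ?\<Phi> (a1, a2, 0, c, b2)" for a1 a2 b2 c
    using inv unfolding invariant_on_def by metis
  have "l \<in> cell_B"
    using inv l unfolding invariant_on_def by blast
  then have "?\<Phi> l = ?\<Phi> l'"
    using curve_B_invariance[where \<Phi> = ?\<Phi>, OF 1 2 3 4 _ l(2) eq] by blast
  then show "l' \<in> Q" "\<Phi> l = \<Phi> l'"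
    using l by (auto split: if_splits)
qed

text \<open>The set of curves given by lengths in \<open>Q\<close>, with the quotient topology from \<open>Q\<close>. It is finer
  than or equal to the subspace topology, and maps out of it are given by formulas in the lengths.\<close>

definition B_space :: "lengths set \<Rightarrow> (nat, nat) curve set topology" where
  "B_space Q = final_topology (top_of_set Q) curve_B"

lemma topspace_B_space: "topspace (B_space Q) = curve_B ` Q"
  by (simp add: B_space_def topspace_final_topology)

lemma continuous_map_curve_B: "continuous_map (top_of_set Q) (B_space Q) curve_B"
  unfolding B_space_def by (rule quotient_imp_continuous_map[OF quotient_map_final_topology])

lemma continuous_map_curve_B_compose:
  assumes "continuous_map X (top_of_set Q) f"
  shows "continuous_map X (B_space Q) (\<lambda>x. curve_B (f x))"
  using continuous_map_compose[OF assms continuous_map_curve_B] by (simp add: o_def)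

text \<open>Invariant homotopies of lengths descend to homotopies of curves.\<close>

lemma B_space_lift:
  fixes \<Psi> :: "real \<times> lengths \<Rightarrow> 'z"
  assumes inv: "\<And>t. t \<in> {0..1} \<Longrightarrow> invariant_on Q (\<lambda>l. \<Psi> (t, l))"
    and cont: "continuous_map (prod_topology (top_of_set {0..1}) (top_of_set Q)) Y \<Psi>"
  shows "\<exists>F. continuous_map (prod_topology (top_of_set {0..1::real}) (B_space Q)) Y F \<and>
    (\<forall>t\<in>{0..1}. \<forall>l\<in>Q. F (t, curve_B l) = \<Psi> (t, l))"
proof -
  define F where "F = (\<lambda>(t, \<tau>). \<Psi> (t, SOME l. l \<in> Q \<and> curve_B l = \<tau>))"
  have F: "F (t, curve_B l) = \<Psi> (t, l)" if "t \<in> {0..1}" "l \<in> Q" for t l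
  proof -
    let ?k = "SOME k. k \<in> Q \<and> curve_B k = curve_B l"
    have k: "?k \<in> Q \<and> curve_B ?k = curve_B l"
      by (rule someI[of _ l]) (use that in auto)
    moreover have "l \<in> cell_B"
      using inv[OF that(1)] that(2) unfolding invariant_on_def by blast
    ultimately have "\<Psi> (t, ?k) = \<Psi> (t, l)"
      using invariant_onD(2)[OF inv[OF that(1)], of ?k l] by simp
    then show ?thesis by (simp add: F_def)
  qed
  have "continuous_map (prod_topology (top_of_set {0..1}) (B_space Q)) Y F"
    unfolding B_space_def
    by (rule continuous_map_prod_from_final_topology, rule continuous_map_eq[OF cont]) (auto simp: F)
  then show ?thesis using F by blast
qed

text \<open>A homotopy that starts at the identity and ends in the smaller space reduces contractibility to the
  smaller space. The end map has to be continuous for the quotient topology of \<open>Q'\<close>.\<close>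

lemma B_space_deformation:
  fixes \<Psi> :: "real \<times> lengths \<Rightarrow> (nat, nat) curve set"
  assumes Q: "Q' \<subseteq> Q" and con: "contractible_space (B_space Q')"
    and inv: "\<And>t. t \<in> {0..1} \<Longrightarrow> invariant_on Q (\<lambda>l. \<Psi> (t, l))"
    and cont: "continuous_map (prod_topology (top_of_set {0..1}) (top_of_set Q)) (B_space Q) \<Psi>"
    and cont1: "continuous_map (top_of_set Q) (B_space Q') (\<lambda>l. \<Psi> (1, l))"
    and start: "\<And>l. l \<in> Q \<Longrightarrow> \<Psi> (0, l) = curve_B l"
  shows "contractible_space (B_space Q)"
proof -
  obtain F where F: "continuous_map (prod_topology (top_of_set {0..1::real}) (B_space Q)) (B_space Q) F"
    "\<forall>t\<in>{0..1}. \<forall>l\<in>Q. F (t, curve_B l) = \<Psi> (t, l)"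
    using B_space_lift[OF inv cont] by blast
  have r: "continuous_map (B_space Q) (B_space Q') (\<lambda>\<tau>. F (1, \<tau>))"
    unfolding B_space_def[of Q]
    by (rule continuous_map_from_final_topology, rule continuous_map_eq[OF cont1]) (use F(2) in auto)
  have i: "continuous_map (B_space Q') (B_space Q) id"
    unfolding B_space_def[of Q']
  proof (rule continuous_map_from_final_topology)
    show "continuous_map (top_of_set Q') (B_space Q) (id \<circ> curve_B)"
      using continuous_map_from_subtopology_mono[OF continuous_map_curve_B Q] by simp
  qed
  show ?thesis
    by (rule contractible_space_deformation[OF r i con F(1)])
      (use F(2) start in \<open>auto simp: topspace_B_space\<close>)
qed

lemma prod_top_of_set: "prod_topology (top_of_set S) (top_of_set T) = top_of_set (S \<times> T)"
  by simp

lemma continuous_map_top_of_setI: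
  "continuous_on S f \<Longrightarrow> f ` S \<subseteq> T \<Longrightarrow> continuous_map (top_of_set S) (top_of_set T) f"
  by (auto simp: continuous_map_in_subtopology)

text \<open>The formulas on the closed pieces agree on overlaps only as curves, not as lengths.\<close>

lemma B_space_pieces:
  fixes S :: "'a :: topological_space set"
  assumes "finite I" "\<And>i. i \<in> I \<Longrightarrow> closed (T i)"
    and "\<And>i. i \<in> I \<Longrightarrow> continuous_on (S \<inter> T i) (f i)" "\<And>i. i \<in> I \<Longrightarrow> f i ` (S \<inter> T i) \<subseteq> Q"
    and "\<And>i x. i \<in> I \<Longrightarrow> x \<in> S \<Longrightarrow> x \<in> T i \<Longrightarrow> curve_B (f i x) = g x"
    and "S \<subseteq> (\<Union>i\<in>I. T i)"
  shows "continuous_map (top_of_set S) (B_space Q) g"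
proof (rule continuous_map_closed_pieces[where I = I and T = "\<lambda>i. S \<inter> T i" and f = "\<lambda>i x. curve_B (f i x)"])
  fix i assume i: "i \<in> I"
  show "closedin (top_of_set S) (S \<inter> T i)"
    using assms(2)[OF i] by (rule closedin_closed_Int)
  have "subtopology (top_of_set S) (S \<inter> T i) = top_of_set (S \<inter> T i)"
    by (simp add: subtopology_subtopology)
  then show "continuous_map (subtopology (top_of_set S) (S \<inter> T i)) (B_space Q) (\<lambda>x. curve_B (f i x))"
    using continuous_map_curve_B_compose[OF continuous_map_top_of_setI[OF assms(3,4)[OF i]]] by simp
qed (use assms in auto)

section \<open>Pushing two points on the same arc apart\<close>

text \<open>The same with the moves required on the cells only: outside, the functions are replaced by a constant.\<close>

lemma curve_invariance_on_cells:
  fixes \<Phi> \<Psi> :: "lengths \<Rightarrow> 'z"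
  assumes iota: "\<And>a1 a2 b1 b2 c. (a1, a2, b1, b2, c) \<in> cell_B \<Longrightarrow> \<Phi> (a1, a2, b1, b2, c) = \<Phi> (a2, a1, b2, b1, c)"
    and flip: "\<And>a1 a2 b1 b2. (a1, a2, b1, b2, 0) \<in> cell_B \<Longrightarrow> \<Phi> (a1, a2, b1, b2, 0) = \<Phi> (a2, a1, b1, b2, 0)"
    and swapa: "\<And>a2 b1 b2 c. (0, a2, b1, b2, c) \<in> cell_B \<Longrightarrow> \<Phi> (0, a2, b1, b2, c) = \<Phi> (0, c, b1, b2, a2)"
    and swapb: "\<And>a1 a2 b2 c. (a1, a2, 0, b2, c) \<in> cell_B \<Longrightarrow> \<Phi> (a1, a2, 0, b2, c) = \<Phi> (a1, a2, 0, c, b2)"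
    and swap: "\<And>a1 a2 a3 b c. (a1, a2, a3, b, c) \<in> cell_A \<Longrightarrow> \<Psi> (a1, a2, a3, b, c) = \<Psi> (a1, a2, a3, c, b)"
    and fold: "\<And>a1 a3 b c. (a1, 0, a3, b, c) \<in> cell_A \<Longrightarrow> \<Psi> (a1, 0, a3, b, c) = \<Psi> (a3, 0, a1, b, c)"
    and first: "\<And>a2 a3 b c. (0, a2, a3, b, c) \<in> cell_A \<Longrightarrow> \<Psi> (0, a2, a3, b, c) = \<Phi> (0, b, a2, a3, c)"
    and last: "\<And>a1 a2 b c. (a1, a2, 0, b, c) \<in> cell_A \<Longrightarrow> \<Psi> (a1, a2, 0, b, c) = \<Phi> (a1, a2, b, 0, c)"
  shows "l \<in> cell_B \<Longrightarrow> l' \<in> cell_B \<Longrightarrow> curve_B l = curve_B l' \<Longrightarrow> \<Phi> l = \<Phi> l'"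
    and "l \<in> cell_A \<Longrightarrow> l' \<in> cell_B \<Longrightarrow> curve_A l = curve_B l' \<Longrightarrow> \<Psi> l = \<Phi> l'"
    and "l \<in> cell_A \<Longrightarrow> l' \<in> cell_A \<Longrightarrow> curve_A l = curve_A l' \<Longrightarrow> \<Psi> l = \<Psi> l'"
proof -
  let ?\<Phi> = "\<lambda>l. if l \<in> cell_B then Some (\<Phi> l) else None" and ?\<Psi> = "\<lambda>l. if l \<in> cell_A then Some (\<Psi> l) else None"
  have B1: "(a2, a1, b2, b1, c) \<in> cell_B \<longleftrightarrow> (a1, a2, b1, b2, c) \<in> cell_B" "(a2, a1, b1, b2, c) \<in> cell_B \<longleftrightarrow> (a1, a2, b1, b2, c) \<in> cell_B"
    "(0, c, b1, b2, a2) \<in> cell_B \<longleftrightarrow> (0, a2, b1, b2, c) \<in> cell_B" "(a1, a2, 0, c, b2) \<in> cell_B \<longleftrightarrow> (a1, a2, 0, b2, c) \<in> cell_B"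
    "(a1, a2, a3, c, b) \<in> cell_A \<longleftrightarrow> (a1, a2, a3, b, c) \<in> cell_A" "(a3, 0, a1, b, c) \<in> cell_A \<longleftrightarrow> (a1, 0, a3, b, c) \<in> cell_A"
    "(0, b, a2, a3, c) \<in> cell_B \<longleftrightarrow> (0, a2, a3, b, c) \<in> cell_A" "(a1, a2, b, 0, c) \<in> cell_B \<longleftrightarrow> (a1, a2, 0, b, c) \<in> cell_A"
    for a1 a2 a3 b1 b2 b c
    unfolding cell_A_def cell_B_def by (auto simp: add.commute)
  have 1: "?\<Phi> (a1, a2, b1, b2, c) = ?\<Phi> (a2, a1, b2, b1, c)" for a1 a2 b1 b2 c
    using iota[of a1 a2 b1 b2 c] B1(1) by simp
  have 2: "?\<Phi> (a1, a2, b1, b2, 0) = ?\<Phi> (a2, a1, b1, b2, 0)" for a1 a2 b1 b2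
    using flip[of a1 a2 b1 b2] B1(2) by simp
  have 3: "?\<Phi> (0, a2, b1, b2, c) = ?\<Phi> (0, c, b1, b2, a2)" for a2 b1 b2 c
    using swapa[of a2 b1 b2 c] B1(3) by simp
  have 4: "?\<Phi> (a1, a2, 0, b2, c) = ?\<Phi> (a1, a2, 0, c, b2)" for a1 a2 b2 c
    using swapb[of a1 a2 b2 c] B1(4) by simp
  have 5: "?\<Psi> (a1, a2, a3, b, c) = ?\<Psi> (a1, a2, a3, c, b)" for a1 a2 a3 b c
    using swap[of a1 a2 a3 b c] B1(5) by simp
  have 6: "?\<Psi> (a1, 0, a3, b, c) = ?\<Psi> (a3, 0, a1, b, c)" for a1 a3 b c
    using fold[of a1 a3 b c] B1(6) by simp
  have 7: "?\<Psi> (0, a2, a3, b, c) = ?\<Phi> (0, b, a2, a3, c)" for a2 a3 b c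
    using first[of a2 a3 b c] B1(7) by simp
  have 8: "?\<Psi> (a1, a2, 0, b, c) = ?\<Phi> (a1, a2, b, 0, c)" for a1 a2 b c
    using last[of a1 a2 b c] B1(8) by simp
  note * = curve_invariance[where \<Phi> = ?\<Phi> and \<Psi> = ?\<Psi>, OF 1 2 3 4 5 6 7 8]
  show "\<Phi> l = \<Phi> l'" if "l \<in> cell_B" "l' \<in> cell_B" "curve_B l = curve_B l'"
    using *(1)[OF that] that by simp
  show "\<Psi> l = \<Phi> l'" if "l \<in> cell_A" "l' \<in> cell_B" "curve_A l = curve_B l'"
    using *(2)[OF that] that by simp
  show "\<Psi> l = \<Psi> l'" if "l \<in> cell_A" "l' \<in> cell_A" "curve_A l = curve_A l'"
    using *(3)[OF that] that by simp
qed

text \<open>Bridges are shrunk first, and then formulas on the two models define a map on the moduli space.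
  Continuity is checked on each cell, where it follows from the continuous factorisation through a model.\<close>

lemma TM_lift:
  fixes \<Phi> \<Psi> :: "real \<times> lengths \<Rightarrow> 'z"
  assumes BB: "\<And>t l l'. t \<in> {0..1} \<Longrightarrow> l \<in> cell_B \<Longrightarrow> l' \<in> cell_B \<Longrightarrow> curve_B l = curve_B l' \<Longrightarrow> \<Phi> (t, l) = \<Phi> (t, l')"
    and AB: "\<And>t l l'. t \<in> {0..1} \<Longrightarrow> l \<in> cell_A \<Longrightarrow> l' \<in> cell_B \<Longrightarrow> curve_A l = curve_B l' \<Longrightarrow> \<Psi> (t, l) = \<Phi> (t, l')"
    and AA: "\<And>t l l'. t \<in> {0..1} \<Longrightarrow> l \<in> cell_A \<Longrightarrow> l' \<in> cell_A \<Longrightarrow> curve_A l = curve_A l' \<Longrightarrow> \<Psi> (t, l) = \<Psi> (t, l')"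
    and cB: "continuous_map (prod_topology (top_of_set {0..1}) (top_of_set cell_B)) Y \<Phi>"
    and cA: "continuous_map (prod_topology (top_of_set {0..1}) (top_of_set cell_A)) Y \<Psi>"
  shows "\<exists>F. continuous_map (prod_topology (top_of_set {0..1}) (TM 2 2)) Y F \<and>
    (\<forall>t\<in>{0..1}. \<forall>\<tau>\<in>TM_points 2 2.
      (\<forall>l\<in>cell_A. curve_A l = bridge_homotopy 2 2 (1, \<tau>) \<longrightarrow> F (t, \<tau>) = \<Psi> (t, l)) \<and>
      (\<forall>l\<in>cell_B. curve_B l = bridge_homotopy 2 2 (1, \<tau>) \<longrightarrow> F (t, \<tau>) = \<Phi> (t, l)))"
proof -
  let ?A = "\<lambda>\<tau> l. l \<in> cell_A \<and> curve_A l = bridge_homotopy 2 2 (1, \<tau>)"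
  let ?B = "\<lambda>\<tau> l. l \<in> cell_B \<and> curve_B l = bridge_homotopy 2 2 (1, \<tau>)"
  define F where "F = (\<lambda>(t, \<tau>). if \<exists>l. ?A \<tau> l then \<Psi> (t, SOME l. ?A \<tau> l) else \<Phi> (t, SOME l. ?B \<tau> l))"
  have FA: "F (t, \<tau>) = \<Psi> (t, l)" if "t \<in> {0..1}" "?A \<tau> l" for t \<tau> l
  proof -
    have "?A \<tau> (SOME l. ?A \<tau> l)"
      by (rule someI[of "?A \<tau>"]) (rule that(2))
    then have "\<Psi> (t, SOME l. ?A \<tau> l) = \<Psi> (t, l)"
      using AA[OF that(1)] that(2) by simp
    moreover have "\<exists>l. ?A \<tau> l"
      using that(2) by blast
    ultimately show ?thesis
      unfolding F_def prod.case by (simp only: if_True simp_thms)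
  qed
  have FB: "F (t, \<tau>) = \<Phi> (t, l)" if "t \<in> {0..1}" "?B \<tau> l" for t \<tau> l
  proof (cases "\<exists>l. ?A \<tau> l")
    case True
    then obtain k where k: "?A \<tau> k" by blast
    then show ?thesis
      using FA[OF that(1) k] AB[OF that(1), of k l] that(2) by simp
  next
    case False
    have "?B \<tau> (SOME l. ?B \<tau> l)"
      by (rule someI[of "?B \<tau>"]) (rule that(2))
    then have "\<Phi> (t, SOME l. ?B \<tau> l) = \<Phi> (t, l)"
      using BB[OF that(1)] that(2) by simp
    then show ?thesis
      unfolding F_def prod.case by (simp only: False if_False)
  qed
  have "continuous_map (prod_topology (top_of_set {0..1}) (TM 2 2)) Y F"
  proof (rule continuous_map_prod_from_TM)
    fix G :: "(nat, nat) multigraph" and p assume ct: "combinatorial_type 2 2 G p"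
    have b: "bridge_homotopy 2 2 (1, TM_map 2 2 ((G, p), l)) = TM_map 2 2 ((G, p), shrink_bridges G 1 l)"
      if "l \<in> topspace (cell G)" for l
      using that by (intro bridge_homotopy_TM_map) (simp_all add: topspace_cell_iff[OF ct])
    have comp: "continuous_map (prod_topology (top_of_set {0..1}) (cell G)) (prod_topology (top_of_set {0..1}) (top_of_set S)) (\<lambda>(t, l). (t, L l))"
      if "continuous_map (cell G) (top_of_set S) L" for S :: "lengths set" and L
      unfolding case_prod_unfold continuous_map_pairwise o_def fst_conv snd_conv
      using continuous_map_fst continuous_map_compose[OF continuous_map_snd that, unfolded o_def] by blast
    from model_of_type[OF ct] show "continuous_map (prod_topology (top_of_set {0..1}) (cell G)) Y (\<lambda>(t, l). F (t, TM_map 2 2 ((G, p), l)))"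
    proof (elim disjE exE conjE)
      fix L assume L: "continuous_map (cell G) (top_of_set cell_A) L"
        "\<forall>l\<in>topspace (cell G). TM_map 2 2 ((G, p), shrink_bridges G 1 l) = curve_A (L l)"
      have "L l \<in> cell_A" if "l \<in> topspace (cell G)" for l
        using continuous_map_funspace[OF L(1)] that by auto
      then show ?thesis
        using L(2) b by (intro continuous_map_eq[OF continuous_map_compose[OF comp[OF L(1)] cA]]) (auto intro!: FA[symmetric])
    next
      fix L assume L: "continuous_map (cell G) (top_of_set cell_B) L"
        "\<forall>l\<in>topspace (cell G). TM_map 2 2 ((G, p), shrink_bridges G 1 l) = curve_B (L l)"
      have "L l \<in> cell_B" if "l \<in> topspace (cell G)" for l
        using continuous_map_funspace[OF L(1)] that by auto
      then show ?thesis
        using L(2) b by (intro continuous_map_eq[OF continuous_map_compose[OF comp[OF L(1)] cB]]) (auto intro!: FB[symmetric])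
    qed
  qed
  then show ?thesis
    using FA FB by blast
qed

text \<open>Both marks move outwards at equal speed until the first of them reaches a branch vertex. If the
  marks coincide, this may shrink the whole arc to length zero. To keep the zero edges free of cycles, the
  shorter of the other two arcs grows meanwhile, unless these have equal length and are both
  positive. The formula for the growth is symmetric in \<open>b\<close> and \<open>c\<close> as the moves demand.\<close>

definition push_apart :: "real \<times> lengths \<Rightarrow> lengths" where
  "push_apart = (\<lambda>(t, a1, a2, a3, b, c). let d = min a1 a3 in
     (a1 - t * d, a2, a3 - t * d, b + t * min d (max 0 (c - b)), c + t * min d (max 0 (b - c))))"

lemma push_apart_in_cell:
  assumes t: "t \<in> {0..1}" and l: "l \<in> cell_A"
  shows "push_apart (t, l) \<in> cell_A"
proof -
  obtain a1 a2 a3 b c where l': "l = (a1, a2, a3, b, c)" by (cases l)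
  have l0: "a1 \<ge> 0" "a2 \<ge> 0" "a3 \<ge> 0" "b \<ge> 0" "c \<ge> 0" "\<not> (a1 + a2 + a3 = 0 \<and> b = 0)" "\<not> (a1 + a2 + a3 = 0 \<and> c = 0)" "\<not> (b = 0 \<and> c = 0)"
    using l by (auto simp: l' cell_A_def)
  define d where "d = min a1 a3"
  have d: "d \<ge> 0" "d \<le> a1" "d \<le> a3" using l0 by (auto simp: d_def)
  have td: "0 \<le> t * d" "t * d \<le> d" using t d by (auto intro: mult_left_le_one_le)
  have nn: "t * min d (max 0 x) \<ge> 0" for x using t d by simp
  have z: "t * d = 0" if "t * min d (max 0 x) = 0" "x > 0" for x
    using that d by (auto simp: min_def max_def split: if_splits)
  have "t * min d (max 0 x) = 0" if "t * d = 0" for x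
    using that d by (auto simp: min_def max_def)
  note z' = this
  have bz: "t * d = 0 \<and> b = 0" if "b + t * min d (max 0 (c - b)) = 0"
    using that nn[of "c - b"] l0 z[of "c - b"] by (metis add_nonneg_eq_0_iff diff_gt_0_iff_gt less_eq_real_def)
  have cz: "t * d = 0 \<and> c = 0" if "c + t * min d (max 0 (b - c)) = 0"
    using that nn[of "b - c"] l0 z[of "b - c"] by (metis add_nonneg_eq_0_iff diff_gt_0_iff_gt less_eq_real_def)
  have "\<not> (b + t * min d (max 0 (c - b)) = 0 \<and> c + t * min d (max 0 (b - c)) = 0)"
    using bz cz l0 by blast
  moreover have "\<not> ((a1 - t * d) + a2 + (a3 - t * d) = 0 \<and> b + t * min d (max 0 (c - b)) = 0)"
    using bz l0 by auto
  moreover have "\<not> ((a1 - t * d) + a2 + (a3 - t * d) = 0 \<and> c + t * min d (max 0 (b - c)) = 0)"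
    using cz l0 by auto
  moreover have "a1 - t * d \<ge> 0" "a3 - t * d \<ge> 0" "b + t * min d (max 0 (c - b)) \<ge> 0" "c + t * min d (max 0 (b - c)) \<ge> 0"
    using td d nn[of "c - b"] nn[of "b - c"] l0 by linarith+
  ultimately show ?thesis
    using l0 unfolding l' push_apart_def prod.case Let_def d_def[symmetric] cell_A_def by simp
qed

lemma continuous_on_push_apart: "continuous_on S push_apart"
  unfolding push_apart_def case_prod_unfold Let_def by (intro continuous_intros)

lemma push_apart_0: "push_apart (0, l) = l"
  by (cases l) (simp add: push_apart_def)

text \<open>Nothing moves where the models A and B overlap, so the homotopy extends by the identity to curves with marks
  on different arcs.\<close>

lemma push_apart_fixes: "a3 \<ge> 0 \<Longrightarrow> b \<ge> 0 \<Longrightarrow> push_apart (t, 0, a2, a3, b, c) = (0, a2, a3, b, c)"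
    "a1 \<ge> 0 \<Longrightarrow> push_apart (t, a1, a2, 0, b, c) = (a1, a2, 0, b, c)"
  by (simp_all add: push_apart_def)

lemma push_apart_invariance:
  assumes t: "t \<in> {0..1}"
  shows "l \<in> cell_B \<Longrightarrow> l' \<in> cell_B \<Longrightarrow> curve_B l = curve_B l' \<Longrightarrow> curve_B l = curve_B l'"
    and "l \<in> cell_A \<Longrightarrow> l' \<in> cell_B \<Longrightarrow> curve_A l = curve_B l' \<Longrightarrow> curve_A (push_apart (t, l)) = curve_B l'"
    and "l \<in> cell_A \<Longrightarrow> l' \<in> cell_A \<Longrightarrow> curve_A l = curve_A l' \<Longrightarrow> curve_A (push_apart (t, l)) = curve_A (push_apart (t, l'))"
proof -
  note * = curve_invariance_on_cells[where \<Phi> = curve_B and \<Psi> = "\<lambda>l. curve_A (push_apart (t, l))"]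
  have 5: "curve_A (push_apart (t, a1, a2, a3, b, c)) = curve_A (push_apart (t, a1, a2, a3, c, b))"
    if "(a1, a2, a3, b, c) \<in> cell_A" for a1 a2 a3 b c
    using push_apart_in_cell[OF t that] unfolding push_apart_def prod.case Let_def by (rule curve_A_swap)
  have 6: "curve_A (push_apart (t, a1, 0, a3, b, c)) = curve_A (push_apart (t, a3, 0, a1, b, c))"
    if "(a1, 0, a3, b, c) \<in> cell_A" for a1 a3 b c
    using push_apart_in_cell[OF t that] unfolding push_apart_def prod.case Let_def min.commute[of a3 a1] by (rule curve_A_fold)
  have 7: "curve_A (push_apart (t, 0, a2, a3, b, c)) = curve_B (0, b, a2, a3, c)"
    if "(0, a2, a3, b, c) \<in> cell_A" for a2 a3 b c
    using that curve_A_B_first[OF that] by (simp add: cell_A_def push_apart_fixes)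
  have 8: "curve_A (push_apart (t, a1, a2, 0, b, c)) = curve_B (a1, a2, b, 0, c)"
    if "(a1, a2, 0, b, c) \<in> cell_A" for a1 a2 b c
    using that curve_A_B_last[OF that] by (simp add: cell_A_def push_apart_fixes)
  note ** = *[OF curve_B_iota curve_B_flip curve_B_swap_a curve_B_swap_b 5 6 7 8]
  show "curve_A (push_apart (t, l)) = curve_B l'" if "l \<in> cell_A" "l' \<in> cell_B" "curve_A l = curve_B l'"
    using **(2)[OF _ _ _ _ _ _ _ _ that] by blast
  show "curve_A (push_apart (t, l)) = curve_A (push_apart (t, l'))" if "l \<in> cell_A" "l' \<in> cell_A" "curve_A l = curve_A l'"
    using **(3)[OF _ _ _ _ _ _ _ _ that] by blast
qed

lemma continuous_map_lens:
  assumes "\<And>l. l \<in> S \<Longrightarrow> degenerate_curve 2 2 (G, lens l, model_marking)" "edges G = {0,1,2,3,4}"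
  shows "continuous_map (top_of_set S) (cell G) lens"
proof -
  have "continuous_map (top_of_set S) (product_topology (\<lambda>_. euclideanreal) (edges G)) lens"
    unfolding continuous_map_componentwise
  proof (intro conjI ballI)
    show "lens ` topspace (top_of_set S) \<subseteq> extensional (edges G)"
      by (auto simp: assms(2) lens_def)
    fix e assume "e \<in> edges G"
    then consider "e = 0" | "e = Suc 0" | "e = 2" | "e = 3" | "e = 4"
      using assms(2) by auto
    then have "continuous_on S (\<lambda>l. lens l e)"
      by cases (simp_all add: lens_def case_prod_unfold, (intro continuous_intros)+)
    then show "continuous_map (top_of_set S) euclideanreal (\<lambda>l. lens l e)"
      by simp
  qed
  moreover have "lens l \<in> topspace (cell G)" if "l \<in> S" for l
    using assms(1)[OF that] degenerate_curve_iff_cell by blast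
  ultimately have "continuous_map (top_of_set S) (subtopology (product_topology (\<lambda>_. euclideanreal) (edges G)) (topspace (cell G))) lens"
    by (intro continuous_map_into_subtopology) auto
  then show ?thesis
    unfolding cell_def topspace_subtopology subtopology_restrict .
qed

lemma continuous_map_curve_A_TM: "continuous_map (top_of_set cell_A) (TM 2 2) curve_A"
  using continuous_map_compose[OF continuous_map_lens[OF degenerate_curve_graph_A[THEN iffD2] edges_graph_AB(1)]
      continuous_map_TM_map[OF combinatorial_type_graph_A]]
  by (simp add: o_def curve_A_def[abs_def])

lemma continuous_map_curve_B_TM: "continuous_map (top_of_set cell_B) (TM 2 2) curve_B"
  using continuous_map_compose[OF continuous_map_lens[OF degenerate_curve_graph_B[THEN iffD2] edges_graph_AB(2)]
      continuous_map_TM_map[OF combinatorial_type_graph_B]]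
  by (simp add: o_def curve_B_def[abs_def])

text \<open>At time 1 the mark that was nearer to its end has reached it, and the lengths can be rewritten in
  the model B.\<close>

lemma push_apart_end_continuous:
  "continuous_map (top_of_set ({0..1::real} \<times> cell_A)) (B_space cell_B) (\<lambda>x. curve_A (push_apart (1, snd x)))"
proof -
  define T where "T i = (if i then {x :: real \<times> lengths. fst (snd x) \<le> fst (snd (snd (snd x)))} else {x. fst (snd (snd (snd x))) \<le> fst (snd x)})" for i
  define f where "f i x = (case push_apart (1, snd x) of (a1, a2, a3, b, c) \<Rightarrow> if i then (0, b, a2, a3, c) else (a1, a2, b, 0, c))"
    for i and x :: "real \<times> lengths"
  have f: "f i x \<in> cell_B \<and> curve_B (f i x) = curve_A (push_apart (1, snd x))" if x: "x \<in> ({0..1} \<times> cell_A) \<inter> T i" for i x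
  proof -
    obtain t a1 a2 a3 b c where x': "x = (t, a1, a2, a3, b, c)" by (cases x)
    have l: "(a1, a2, a3, b, c) \<in> cell_A" using x by (simp add: x')
    have p: "push_apart (1, a1, a2, a3, b, c) \<in> cell_A"
      by (rule push_apart_in_cell[OF _ l]) simp
    obtain a1' a2' a3' b' c' where p': "push_apart (1, a1, a2, a3, b, c) = (a1', a2', a3', b', c')"
      by (cases "push_apart (1, a1, a2, a3, b, c)")
    show ?thesis
    proof (cases i)
      case True
      then have "a1' = 0"
        using x p' by (simp add: x' T_def push_apart_def Let_def min_def)
      then show ?thesis
        using True p curve_A_B_first[of a2' a3' b' c'] unfolding f_def x' snd_conv p'
        by (auto simp: cell_A_def cell_B_def)
    next
      case False
      then have "a3' = 0"
        using x p' by (simp add: x' T_def push_apart_def Let_def min_def split: if_splits)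
      then show ?thesis
        using False p curve_A_B_last[of a1' a2' b' c'] unfolding f_def x' snd_conv p'
        by (auto simp: cell_A_def cell_B_def)
    qed
  qed
  show ?thesis
  proof (rule B_space_pieces[where I = UNIV and T = T and f = f])
    show "closed (T i)" for i
      unfolding T_def by (auto intro!: closed_Collect_le continuous_intros)
    show "continuous_on (({0..1} \<times> cell_A) \<inter> T i) (f i)" for i
      unfolding f_def push_apart_def case_prod_unfold Let_def by (cases i; simp; intro continuous_intros)
    show "({0..1} \<times> cell_A) \<subseteq> (\<Union>i\<in>UNIV. T i)"
      by (auto simp: T_def)
  qed (use f in auto)
qed

text \<open>Two homotopies are composed: the first shrinks the bridges and the second pushes the marks apart. The
  end of the second factors through the space of the model B by the map \<open>E\<close>, evaluated at time 1
  (its time parameter is a dummy, so that \<open>TM_lift\<close> applies).\<close>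

theorem contractible_TM_if_B_space:
  assumes "contractible_space (B_space cell_B)"
  shows "contractible_space (TM 2 2)"
proof -
  let ?I = "top_of_set {0..1::real}"
  let ?\<rho> = "\<lambda>\<tau>. bridge_homotopy 2 2 (1, \<tau>)"
  have cA: "continuous_map (prod_topology ?I (top_of_set cell_A)) (TM 2 2) (\<lambda>x. curve_A (push_apart x))"
  proof -
    have "continuous_map (top_of_set ({0..1} \<times> cell_A)) (top_of_set cell_A) push_apart"
      using push_apart_in_cell by (intro continuous_map_top_of_setI continuous_on_push_apart) auto
    from continuous_map_compose[OF this continuous_map_curve_A_TM] show ?thesis
      by (simp add: prod_top_of_set o_def)
  qed
  have cB: "continuous_map (prod_topology ?I (top_of_set cell_B)) (TM 2 2) (\<lambda>x. curve_B (snd x))"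
    using continuous_map_compose[OF continuous_map_snd[of ?I "top_of_set cell_B"] continuous_map_curve_B_TM]
    unfolding o_def .
  have inv: "curve_A (push_apart (t, l)) = curve_B l'" if "t \<in> {0..1}" "l \<in> cell_A" "l' \<in> cell_B" "curve_A l = curve_B l'" for t l l'
    using push_apart_invariance(2) that by blast
  have inv': "curve_A (push_apart (t, l)) = curve_A (push_apart (t, l'))" if "t \<in> {0..1}" "l \<in> cell_A" "l' \<in> cell_A" "curve_A l = curve_A l'" for t l l'
    using push_apart_invariance(3) that by blast
  have inv1: "curve_A (push_apart (1, l)) = curve_B l'" if "t \<in> {0..1}" "l \<in> cell_A" "l' \<in> cell_B" "curve_A l = curve_B l'" for t :: real and l l'
    using inv[OF _ that(2-4), of 1] by simp
  have inv1': "curve_A (push_apart (1, l)) = curve_A (push_apart (1, l'))" if "t \<in> {0..1}" "l \<in> cell_A" "l' \<in> cell_A" "curve_A l = curve_A l'" for t :: real and l l'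
    using inv'[OF _ that(2-4), of 1] by simp
  have lift: "\<exists>F. continuous_map (prod_topology ?I (TM 2 2)) Y F \<and>
    (\<forall>t\<in>{0..1}. \<forall>\<tau>\<in>TM_points 2 2.
      (\<forall>l\<in>cell_A. curve_A l = ?\<rho> \<tau> \<longrightarrow> F (t, \<tau>) = \<Psi> (t, l)) \<and>
      (\<forall>l\<in>cell_B. curve_B l = ?\<rho> \<tau> \<longrightarrow> F (t, \<tau>) = curve_B l))"
    if "\<And>t l l'. t \<in> {0..1} \<Longrightarrow> l \<in> cell_A \<Longrightarrow> l' \<in> cell_B \<Longrightarrow> curve_A l = curve_B l' \<Longrightarrow> \<Psi> (t, l) = curve_B l'"
      "\<And>t l l'. t \<in> {0..1} \<Longrightarrow> l \<in> cell_A \<Longrightarrow> l' \<in> cell_A \<Longrightarrow> curve_A l = curve_A l' \<Longrightarrow> \<Psi> (t, l) = \<Psi> (t, l')"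
      "continuous_map (prod_topology ?I (top_of_set cell_B)) Y (\<lambda>x. curve_B (snd x))"
      "continuous_map (prod_topology ?I (top_of_set cell_A)) Y \<Psi>"
    for Y and \<Psi> :: "real \<times> lengths \<Rightarrow> (nat, nat) curve set"
    using TM_lift[where \<Phi> = "\<lambda>x. curve_B (snd x)" and \<Psi> = \<Psi>, unfolded snd_conv, OF _ that] by blast
  obtain F where F: "continuous_map (prod_topology ?I (TM 2 2)) (TM 2 2) F"
    and FA: "\<And>t \<tau> l. t \<in> {0..1} \<Longrightarrow> \<tau> \<in> TM_points 2 2 \<Longrightarrow> l \<in> cell_A \<Longrightarrow> curve_A l = ?\<rho> \<tau> \<Longrightarrow> F (t, \<tau>) = curve_A (push_apart (t, l))"
    and FB: "\<And>t \<tau> l. t \<in> {0..1} \<Longrightarrow> \<tau> \<in> TM_points 2 2 \<Longrightarrow> l \<in> cell_B \<Longrightarrow> curve_B l = ?\<rho> \<tau> \<Longrightarrow> F (t, \<tau>) = curve_B l"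
    using lift[of "\<lambda>x. curve_A (push_apart x)", OF inv inv' cB cA] by blast
  have cA': "continuous_map (prod_topology ?I (top_of_set cell_A)) (B_space cell_B) (\<lambda>x. curve_A (push_apart (1, snd x)))"
    using push_apart_end_continuous by (simp add: prod_top_of_set)
  have cB': "continuous_map (prod_topology ?I (top_of_set cell_B)) (B_space cell_B) (\<lambda>x. curve_B (snd x))"
    using continuous_map_compose[OF continuous_map_snd[of ?I "top_of_set cell_B"] continuous_map_curve_B]
    unfolding o_def .
  obtain E where EE: "continuous_map (prod_topology ?I (TM 2 2)) (B_space cell_B) E \<and> (\<forall>t\<in>{0..1}. \<forall>\<tau>\<in>TM_points 2 2.
      (\<forall>l\<in>cell_A. curve_A l = ?\<rho> \<tau> \<longrightarrow> E (t, \<tau>) = curve_A (push_apart (1, l))) \<and>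
      (\<forall>l\<in>cell_B. curve_B l = ?\<rho> \<tau> \<longrightarrow> E (t, \<tau>) = curve_B l))"
    using lift[of "\<lambda>x. curve_A (push_apart (1, snd x))", unfolded snd_conv, OF inv1 inv1' cB' cA'] by (rule exE)
  note E = EE[THEN conjunct1] and E' = EE[THEN conjunct2]
  have EA: "E (t, \<tau>) = curve_A (push_apart (1, l))" if "t \<in> {0..1}" "\<tau> \<in> TM_points 2 2" "l \<in> cell_A" "curve_A l = ?\<rho> \<tau>" for t \<tau> l
    using E' that by blast
  have EB: "E (t, \<tau>) = curve_B l" if "t \<in> {0..1}" "\<tau> \<in> TM_points 2 2" "l \<in> cell_B" "curve_B l = ?\<rho> \<tau>" for t \<tau> l
    using E' that by blast
  have model: "(\<exists>l\<in>cell_A. curve_A l = ?\<rho> \<tau>) \<or> (\<exists>l\<in>cell_B. curve_B l = ?\<rho> \<tau>)" if \<tau>: "\<tau> \<in> TM_points 2 2" for \<tau>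
  proof -
    obtain G p l where \<tau>': "\<tau> = TM_map 2 2 ((G, p), l)" and C: "degenerate_curve 2 2 (G, l, p)"
      using \<tau> unfolding TM_points_eq by blast
    have ct: "combinatorial_type 2 2 G p" using C by (simp add: degenerate_curve_def)
    have l: "l \<in> topspace (cell G)" using C topspace_cell_iff[OF ct] by simp
    have b: "?\<rho> \<tau> = TM_map 2 2 ((G, p), shrink_bridges G 1 l)"
      unfolding \<tau>' by (rule bridge_homotopy_TM_map[OF C]) simp
    from model_of_type[OF ct] show ?thesis
    proof (elim disjE exE conjE)
      fix L assume L: "continuous_map (cell G) (top_of_set cell_A) L"
        "\<forall>l\<in>topspace (cell G). TM_map 2 2 ((G, p), shrink_bridges G 1 l) = curve_A (L l)"
      have "L l \<in> cell_A" using continuous_map_funspace[OF L(1)] l by auto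
      then show ?thesis using L(2) l b by auto
    next
      fix L assume L: "continuous_map (cell G) (top_of_set cell_B) L"
        "\<forall>l\<in>topspace (cell G). TM_map 2 2 ((G, p), shrink_bridges G 1 l) = curve_B (L l)"
      have "L l \<in> cell_B" using continuous_map_funspace[OF L(1)] l by auto
      then show ?thesis using L(2) l b by auto
    qed
  qed
  have at: "continuous_map (TM 2 2) (prod_topology ?I (TM 2 2)) (\<lambda>\<tau>. (1, \<tau>))"
    by (simp add: continuous_map_pairwise o_def)
  have r: "continuous_map (TM 2 2) (B_space cell_B) (\<lambda>\<tau>. E (1, \<tau>))"
    using continuous_map_compose[OF at E] by (simp add: o_def)
  have i: "continuous_map (B_space cell_B) (TM 2 2) id"
    unfolding B_space_def by (rule continuous_map_from_final_topology) (simp add: continuous_map_curve_B_TM)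
  have "homotopic_with (\<lambda>_. True) (TM 2 2) (TM 2 2) id ?\<rho>"
    by (rule homotopic_with_topspaceI[OF continuous_map_bridge_homotopy]) (simp_all add: bridge_homotopy_0 topspace_TM)
  moreover have "homotopic_with (\<lambda>_. True) (TM 2 2) (TM 2 2) ?\<rho> (id \<circ> (\<lambda>\<tau>. E (1, \<tau>)))"
  proof (rule homotopic_with_topspaceI[OF F])
    fix \<tau> assume "\<tau> \<in> topspace (TM 2 2)"
    then have \<tau>: "\<tau> \<in> TM_points 2 2" by (simp add: topspace_TM)
    show "F (0, \<tau>) = ?\<rho> \<tau>"
      using model[OF \<tau>] FA[of 0, OF _ \<tau>] FB[of 0, OF _ \<tau>] by (auto simp: push_apart_0)
    show "F (1, \<tau>) = (id \<circ> (\<lambda>\<tau>. E (1, \<tau>))) \<tau>"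
      using model[OF \<tau>] FA[of 1, OF _ \<tau>] FB[of 1, OF _ \<tau>] EA[of 1, OF _ \<tau>] EB[of 1, OF _ \<tau>] by auto
  qed
  ultimately have "homotopic_with (\<lambda>_. True) (TM 2 2) (TM 2 2) id (id \<circ> (\<lambda>\<tau>. E (1, \<tau>)))"
    by (rule homotopic_with_trans)
  then show ?thesis
    by (intro homotopy_dominated_contractibility[OF i r homotopic_with_symD assms])
qed

section \<open>Making the two longest arcs equal\<close>

text \<open>The median of three numbers, which is positive for the lengths of the arcs since at most one
  of them vanishes.\<close>

definition med :: "real \<Rightarrow> real \<Rightarrow> real \<Rightarrow> real" where
  "med a b c = max (min a b) (max (min b c) (min a c))"

lemma med_commute: "med a b c = med b a c" "med a b c = med a c b"
  by (auto simp: med_def min_def max_def)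

text \<open>At time 1 the two arcs that are at least as long as the median \<open>m\<close> get length 1, and the
  shortest arc \<open>e\<close> gets length \<open>e / m\<close>. The positions of the marks are scaled along.\<close>

definition equalize :: "real \<times> lengths \<Rightarrow> lengths" where
  "equalize = (\<lambda>(t, a1, a2, b1, b2, c). let m = med (a1 + a2) (b1 + b2) c; f = \<lambda>e. (1 - t) + t / max m e in
     (a1 * f (a1 + a2), a2 * f (a1 + a2), b1 * f (b1 + b2), b2 * f (b1 + b2), c * f c))"

definition spine :: "lengths set" where
  "spine = {(a1, a2, b1, b2, c). a1 \<ge> 0 \<and> a2 \<ge> 0 \<and> b1 \<ge> 0 \<and> b2 \<ge> 0 \<and> c \<ge> 0 \<and>
     (a1 + a2 = 1 \<and> b1 + b2 = 1 \<and> c \<le> 1 \<or> a1 + a2 = 1 \<and> c = 1 \<and> b1 + b2 \<le> 1 \<or> b1 + b2 = 1 \<and> c = 1 \<and> a1 + a2 \<le> 1)}"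

lemma spine_subset: "spine \<subseteq> cell_B"
  by (auto simp: spine_def cell_B_def)

lemma med_pos: "(a1, a2, b1, b2, c) \<in> cell_B \<Longrightarrow> med (a1 + a2) (b1 + b2) c > 0"
  by (auto simp: cell_B_def med_def min_def max_def)

lemma equalize_in_cell:
  assumes t: "t \<in> {0..1}" and l: "l \<in> cell_B"
  shows "equalize (t, l) \<in> cell_B"
proof -
  obtain a1 a2 b1 b2 c where l': "l = (a1, a2, b1, b2, c)" by (cases l)
  define m where "m = med (a1 + a2) (b1 + b2) c"
  define f where "f e = (1 - t) + t / max m e" for e
  have m: "m > 0" using med_pos l by (simp add: m_def l')
  have f: "f e > 0" for e
  proof (cases "t = 1")
    case False
    then have "1 - t > 0" using t by simp
    moreover have "t / max m e \<ge> 0" using t m by simp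
    ultimately show ?thesis by (simp add: f_def add_pos_nonneg)
  qed (use m in \<open>simp add: f_def less_max_iff_disj\<close>)
  have nz: "f e \<noteq> 0" for e
    using f[of e] by simp
  have eq: "equalize (t, l) = (a1 * f (a1 + a2), a2 * f (a1 + a2), b1 * f (b1 + b2), b2 * f (b1 + b2), c * f c)"
    by (simp add: equalize_def l' m_def f_def Let_def)
  have z: "x * f e + y * f e = 0 \<longleftrightarrow> x + y = 0" "x * f e = 0 \<longleftrightarrow> x = 0" for x y e
    using f[of e] by (simp_all add: distrib_right[symmetric])
  have "(a1 * f (a1 + a2), a2 * f (a1 + a2), b1 * f (b1 + b2), b2 * f (b1 + b2), c * f c) \<in> cell_B"
    using l f unfolding cell_B_def l' by (simp add: z nz less_imp_le)
  then show ?thesis by (simp only: eq)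
qed

lemma continuous_on_equalize: "continuous_on ({0..1} \<times> cell_B) equalize"
proof -
  have nz: "max (med (fst (snd x) + fst (snd (snd x))) (fst (snd (snd (snd x))) + fst (snd (snd (snd (snd x))))) (snd (snd (snd (snd (snd x)))))) e \<noteq> 0"
    if "x \<in> {0..1} \<times> cell_B" for x :: "real \<times> lengths" and e
    using that med_pos by (cases x) fastforce
  show ?thesis
    unfolding equalize_def case_prod_unfold Let_def
    using nz unfolding med_def by (intro continuous_intros ballI) auto
qed

lemma equalize_1_spine:
  assumes l: "l \<in> cell_B"
  shows "equalize (1, l) \<in> spine"
proof -
  obtain a1 a2 b1 b2 c where l': "l = (a1, a2, b1, b2, c)" by (cases l)
  define m where "m = med (a1 + a2) (b1 + b2) c"
  have m: "m > 0" using med_pos l by (simp add: m_def l')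
  have eq: "equalize (1, l) = (a1 / max m (a1 + a2), a2 / max m (a1 + a2), b1 / max m (b1 + b2), b2 / max m (b1 + b2), c / max m c)"
    by (simp add: equalize_def l' m_def Let_def)
  have s: "x / max m (x + y) + y / max m (x + y) = (x + y) / max m (x + y)" for x y
    by (simp add: add_divide_distrib)
  have le: "e / max m e \<le> 1" for e
    using m by (simp add: divide_le_eq_1 max_def)
  have one: "e / max m e = 1" if "m \<le> e" for e
    using m that by (simp add: max_def)
  have "m \<le> a1 + a2 \<and> m \<le> b1 + b2 \<or> m \<le> a1 + a2 \<and> m \<le> c \<or> m \<le> b1 + b2 \<and> m \<le> c"
    by (auto simp: m_def med_def min_def max_def)
  moreover have "a1 \<ge> 0" "a2 \<ge> 0" "b1 \<ge> 0" "b2 \<ge> 0" "c \<ge> 0"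
    using l by (auto simp: l' cell_B_def)
  ultimately show ?thesis
    unfolding eq spine_def using m le one by (auto simp: s intro!: divide_nonneg_pos simp: less_max_iff_disj)
qed

lemma invariant_equalize:
  assumes t: "t \<in> {0..1}"
  shows "invariant_on cell_B (\<lambda>l. curve_B (equalize (t, l)))"
  unfolding invariant_on_def
proof (intro conjI allI impI order_refl)
  fix a1 a2 b1 b2 c assume l: "(a1, a2, b1, b2, c) \<in> cell_B"
  then show "(a2, a1, b2, b1, c) \<in> cell_B"
    by (auto simp: cell_B_def add.commute)
  show "curve_B (equalize (t, a2, a1, b2, b1, c)) = curve_B (equalize (t, a1, a2, b1, b2, c))"
    using equalize_in_cell[OF t l] unfolding equalize_def prod.case Let_def
    by (subst curve_B_iota[symmetric]) (simp_all add: add.commute)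
next
  fix a1 a2 b1 b2 assume l: "(a1, a2, b1, b2, 0) \<in> cell_B"
  then show "(a2, a1, b1, b2, 0) \<in> cell_B"
    by (auto simp: cell_B_def add.commute)
  show "curve_B (equalize (t, a2, a1, b1, b2, 0)) = curve_B (equalize (t, a1, a2, b1, b2, 0))"
    using equalize_in_cell[OF t l] unfolding equalize_def prod.case Let_def mult_zero_left
    by (subst curve_B_flip[symmetric]) (simp_all add: add.commute)
next
  fix a2 b1 b2 c assume l: "(0, a2, b1, b2, c) \<in> cell_B"
  then show "(0, c, b1, b2, a2) \<in> cell_B"
    by (auto simp: cell_B_def)
  have "med c (b1 + b2) a2 = med a2 (b1 + b2) c"
    using med_commute by metis
  then show "curve_B (equalize (t, 0, c, b1, b2, a2)) = curve_B (equalize (t, 0, a2, b1, b2, c))"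
    using equalize_in_cell[OF t l] unfolding equalize_def prod.case Let_def mult_zero_left add_0_left
    by (subst curve_B_swap_a[symmetric]) simp_all
next
  fix a1 a2 b2 c assume l: "(a1, a2, 0, b2, c) \<in> cell_B"
  then show "(a1, a2, 0, c, b2) \<in> cell_B"
    by (auto simp: cell_B_def)
  have "med (a1 + a2) c b2 = med (a1 + a2) b2 c"
    by (rule med_commute)
  then show "curve_B (equalize (t, a1, a2, 0, c, b2)) = curve_B (equalize (t, a1, a2, 0, b2, c))"
    using equalize_in_cell[OF t l] unfolding equalize_def prod.case Let_def mult_zero_left add_0_left
    by (subst curve_B_swap_b[symmetric]) simp_all
qed

lemma contractible_B_space_cell:
  assumes "contractible_space (B_space spine)"
  shows "contractible_space (B_space cell_B)"
proof (rule B_space_deformation[OF spine_subset assms, where \<Psi> = "\<lambda>x. curve_B (equalize x)"])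
  show "continuous_map (prod_topology (top_of_set {0..1}) (top_of_set cell_B)) (B_space cell_B) (\<lambda>x. curve_B (equalize x))"
    unfolding prod_top_of_set using equalize_in_cell
    by (intro continuous_map_curve_B_compose continuous_map_top_of_setI continuous_on_equalize) auto
  have "continuous_on cell_B (equalize \<circ> Pair 1)"
    by (rule continuous_on_compose[OF _ continuous_on_subset[OF continuous_on_equalize]]) (auto intro!: continuous_intros)
  then show "continuous_map (top_of_set cell_B) (B_space spine) (\<lambda>l. curve_B (equalize (1, l)))"
    using equalize_1_spine by (intro continuous_map_curve_B_compose continuous_map_top_of_setI) (auto simp: o_def)
  show "curve_B (equalize (0, l)) = curve_B l" for l
    by (cases l) (simp add: equalize_def Let_def)
qed (use invariant_equalize in auto)

section \<open>Homotopies of the spine\<close>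

text \<open>Exchange of the branch vertices.\<close>

definition turn :: "lengths \<Rightarrow> lengths" where
  "turn = (\<lambda>(a1, a2, b1, b2, c). (a2, a1, b2, b1, c))"

text \<open>Exchange of the two marks. It is not a move, since the marks are distinguished, but the formulas for a short arc \<open>a\<close>
  are the formulas for a short arc \<open>b\<close> conjugated by it.\<close>

definition relabel :: "lengths \<Rightarrow> lengths" where
  "relabel = (\<lambda>(a1, a2, b1, b2, c). (b1, b2, a1, a2, c))"

text \<open>The unmarked arc is the short one.\<close>

definition theta_c :: "lengths set" where
  "theta_c = {(a1, a2, b1, b2, c). a1 \<ge> 0 \<and> a2 \<ge> 0 \<and> b1 \<ge> 0 \<and> b2 \<ge> 0 \<and> c \<ge> 0 \<and> a1 + a2 = 1 \<and> b1 + b2 = 1 \<and> c \<le> 1}"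

text \<open>The arc of \<open>y\<close> is the short one, and \<open>y\<close> is at least as near to \<open>u\<close> as to \<open>v\<close>.\<close>

definition theta_b :: "lengths set" where
  "theta_b = {(a1, a2, b1, b2, c). a1 \<ge> 0 \<and> a2 \<ge> 0 \<and> b1 \<ge> 0 \<and> b2 \<ge> 0 \<and> c \<ge> 0 \<and> a1 + a2 = 1 \<and> c = 1 \<and> b1 + b2 \<le> 1 \<and> b1 \<le> b2}"

lemma turn_turn [simp]: "turn (turn l) = l" and relabel_relabel [simp]: "relabel (relabel l) = l"
  and turn_relabel: "turn (relabel l) = relabel (turn l)"
  by (cases l; simp add: turn_def relabel_def)+

lemma curve_B_turn: "l \<in> cell_B \<Longrightarrow> curve_B (turn l) = curve_B l"
  by (cases l) (simp add: turn_def curve_B_iota[symmetric])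

text \<open>A piece of the spine with a short marked arc is described by its part \<open>P\<close> with \<open>y\<close> on the short arc
  and near \<open>u\<close>; the rest follows by symmetry.\<close>

definition saturate :: "lengths set \<Rightarrow> lengths set" where
  "saturate P = theta_c \<union> P \<union> turn -` P \<union> relabel -` P \<union> (\<lambda>l. turn (relabel l)) -` P"

lemma turn_theta_c: "turn l \<in> theta_c \<longleftrightarrow> l \<in> theta_c" and relabel_theta_c: "relabel l \<in> theta_c \<longleftrightarrow> l \<in> theta_c"
  by (cases l; auto simp: turn_def relabel_def theta_c_def add.commute)+

lemma saturate_closed: "turn l \<in> saturate P \<longleftrightarrow> l \<in> saturate P" "relabel l \<in> saturate P \<longleftrightarrow> l \<in> saturate P"
  unfolding saturate_def by (auto simp: turn_theta_c relabel_theta_c turn_relabel)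

lemma spine_eq_saturate: "spine = saturate theta_b"
proof (intro set_eqI)
  fix l :: lengths
  obtain a1 a2 b1 b2 c where l: "l = (a1, a2, b1, b2, c)" by (cases l)
  show "l \<in> spine \<longleftrightarrow> l \<in> saturate theta_b"
    unfolding l saturate_def spine_def theta_c_def theta_b_def turn_def relabel_def vimage_def by (simp add: add.commute) linarith
qed

lemma saturate_mono: "P \<subseteq> P' \<Longrightarrow> saturate P \<subseteq> saturate P'"
  by (auto simp: saturate_def)

definition shorten :: "(real \<Rightarrow> real \<Rightarrow> real) \<Rightarrow> real \<times> lengths \<Rightarrow> lengths" where
  "shorten r = (\<lambda>(t, a1, a2, b1, b2, c). (a1, a2, b1, b2, r t c * c))"

lemma continuous_on_turn: "continuous_on S turn" and continuous_on_relabel: "continuous_on S relabel"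
  unfolding turn_def relabel_def case_prod_unfold by (intro continuous_intros)+

lemma closed_theta: "closed theta_c" "closed theta_b"
  unfolding theta_c_def theta_b_def case_prod_unfold
  by (auto intro!: closed_Collect_conj closed_Collect_le closed_Collect_eq continuous_intros)

text \<open>If arc \<open>b\<close> and arc \<open>a\<close> both count as the short one, then all arcs have length 1.\<close>

lemma theta_bb: "l \<in> theta_b \<or> turn l \<in> theta_b \<Longrightarrow> relabel l \<in> theta_b \<or> turn (relabel l) \<in> theta_b \<Longrightarrow> l \<in> theta_c"
  by (cases l) (auto simp: theta_c_def theta_b_def turn_def relabel_def)

text \<open>A homotopy of the spine in which short unmarked arcs are rescaled by a factor \<open>r t c\<close> and short marked
  arcs are treated by \<open>move\<close>. The conditions \<open>move_turn\<close>, \<open>move_end\<close> and \<open>move_full\<close> make the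
  pieces fit together: where \<open>y\<close> is equally far from \<open>u\<close> and \<open>v\<close>; where \<open>y\<close> sits at a branch vertex, so that arc \<open>b\<close> can be exchanged with
  the unmarked arc; and where all arcs have length 1.\<close>

locale spine_homotopy =
  fixes P :: "lengths set" and r :: "real \<Rightarrow> real \<Rightarrow> real" and move :: "real \<times> lengths \<Rightarrow> lengths"
  assumes P_subset: "P \<subseteq> theta_b" and closed_P: "closed P"
    and P_zero: "\<And>x y c. x \<ge> 0 \<Longrightarrow> y \<ge> 0 \<Longrightarrow> x + y = 1 \<Longrightarrow> c \<in> {0..1} \<Longrightarrow> (x, y, 0, c, 1) \<in> P"
    and r_bounds: "\<And>t c. t \<in> {0..1} \<Longrightarrow> c \<in> {0..1} \<Longrightarrow> r t c * c \<in> {0..1}"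
    and r_0: "\<And>c. r 0 c = 1"
    and continuous_r: "continuous_on UNIV (\<lambda>x. r (fst x) (snd x))"
    and continuous_move: "\<And>S. continuous_on S move"
    and move_in: "\<And>t l. t \<in> {0..1} \<Longrightarrow> l \<in> P \<Longrightarrow> move (t, l) \<in> saturate P"
    and move_0: "\<And>l. l \<in> P \<Longrightarrow> move (0, l) = l"
    and move_turn: "\<And>t l. t \<in> {0..1} \<Longrightarrow> l \<in> P \<Longrightarrow> turn l \<in> P \<Longrightarrow> move (t, turn l) = turn (move (t, l)) \<or> move (t, turn l) = move (t, l)"
    and move_end: "\<And>t a1 a2 b. (a1, a2, 0, b, 1) \<in> P \<Longrightarrow> move (t, a1, a2, 0, b, 1) = (a1, a2, 0, r t b * b, 1)"
    and move_full: "\<And>t l. t \<in> {0..1} \<Longrightarrow> l \<in> theta_c \<Longrightarrow> l \<in> P \<Longrightarrow> curve_B (move (t, l)) = curve_B (shorten r (t, l))"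
      "\<And>t l. t \<in> {0..1} \<Longrightarrow> l \<in> theta_c \<Longrightarrow> relabel l \<in> P \<Longrightarrow> curve_B (relabel (move (t, relabel l))) = curve_B (shorten r (t, l))"
begin

abbreviation "Q \<equiv> saturate P"

lemma Q_spine: "Q \<subseteq> spine"
  unfolding spine_eq_saturate by (rule saturate_mono[OF P_subset])

lemma P_Q: "P \<subseteq> Q" "theta_c \<subseteq> Q"
  by (auto simp: saturate_def)

lemma in_cell: "l \<in> Q \<Longrightarrow> l \<in> cell_B" "l \<in> theta_c \<Longrightarrow> l \<in> cell_B"
  using spine_subset Q_spine P_Q by auto

lemma shorten_in:
  assumes "t \<in> {0..1}" "l \<in> theta_c"
  shows "shorten r (t, l) \<in> theta_c"
proof -
  obtain a1 a2 b1 b2 c where l: "l = (a1, a2, b1, b2, c)" by (cases l)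
  then show ?thesis
    using assms(2) r_bounds[OF assms(1), of c] by (simp add: theta_c_def shorten_def)
qed

lemma shorten_turn: "shorten r (t, turn l) = turn (shorten r (t, l))"
  by (cases l) (simp add: shorten_def turn_def)

lemma shorten_0: "shorten r (0, l) = l"
  by (cases l) (simp add: shorten_def r_0)

lemma continuous_on_shorten: "continuous_on S (shorten r)"
proof -
  have "continuous_on S (\<lambda>x. r (fst x) (snd (snd (snd (snd (snd x))))))" for S :: "(real \<times> lengths) set"
    by (rule continuous_on_compose2[OF continuous_r, of S "\<lambda>x. (fst x, snd (snd (snd (snd (snd x)))))", unfolded fst_conv snd_conv])
      (auto intro!: continuous_intros)
  then show ?thesis
    unfolding shorten_def case_prod_unfold by (intro continuous_intros)
qed

definition homotopy :: "real \<times> lengths \<Rightarrow> (nat, nat) curve set" where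
  "homotopy = (\<lambda>(t, l). curve_B (if l \<in> theta_c then shorten r (t, l) else if l \<in> P then move (t, l)
     else if turn l \<in> P then move (t, turn l) else if relabel l \<in> P then relabel (move (t, relabel l))
     else relabel (move (t, turn (relabel l)))))"

lemma P_theta_c: "l \<in> P \<or> turn l \<in> P \<Longrightarrow> relabel l \<in> P \<or> turn (relabel l) \<in> P \<Longrightarrow> l \<in> theta_c"
  using P_subset by (intro theta_bb) auto

text \<open>The five formulas agree, as curves, on the overlaps of the five pieces: the two formulas for the same short
  arc by \<open>move_turn\<close>, the others by \<open>move_full\<close>, since two different short arcs have length 1.\<close>

lemma homotopy_eq:
  assumes t: "t \<in> {0..1}"
  shows "l \<in> theta_c \<Longrightarrow> homotopy (t, l) = curve_B (shorten r (t, l))"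
    and "l \<in> P \<Longrightarrow> homotopy (t, l) = curve_B (move (t, l))"
    and "turn l \<in> P \<Longrightarrow> homotopy (t, l) = curve_B (move (t, turn l))"
    and "relabel l \<in> P \<Longrightarrow> homotopy (t, l) = curve_B (relabel (move (t, relabel l)))"
    and "turn (relabel l) \<in> P \<Longrightarrow> homotopy (t, l) = curve_B (relabel (move (t, turn (relabel l))))"
proof -
  show c: "homotopy (t, l) = curve_B (shorten r (t, l))" if "l \<in> theta_c" for l
    using that by (simp add: homotopy_def)
  have ct: "curve_B (shorten r (t, turn l)) = curve_B (shorten r (t, l))" if "l \<in> theta_c" for l
    unfolding shorten_turn by (rule curve_B_turn[OF in_cell(2)[OF shorten_in[OF t that]]])
  show b: "homotopy (t, l) = curve_B (move (t, l))" if l: "l \<in> P" for l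
    using c[of l] move_full(1)[OF t _ l] l by (cases "l \<in> theta_c") (simp_all add: homotopy_def)
  show "homotopy (t, l) = curve_B (move (t, turn l))" if l: "turn l \<in> P" for l
  proof -
    consider "l \<in> theta_c" | "l \<notin> theta_c" "l \<in> P" | "l \<notin> theta_c" "l \<notin> P" by blast
    then show ?thesis
    proof cases
      case 1
      then show ?thesis
        using move_full(1)[OF t, of "turn l"] l by (simp only: c ct turn_theta_c)
    next
      case 2
      have "curve_B (move (t, turn l)) = curve_B (move (t, l))"
        using move_turn[OF t 2(2) l] curve_B_turn[OF in_cell(1)[OF move_in[OF t 2(2)]]]
        by (elim disjE) simp_all
      then show ?thesis using b[OF 2(2)] by simp
    qed (simp add: l homotopy_def)
  qed
  show a: "homotopy (t, l) = curve_B (relabel (move (t, relabel l)))" if l: "relabel l \<in> P" for l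
  proof (cases "l \<in> theta_c")
    case True
    then show ?thesis using c[OF True] move_full(2)[OF t True l] by simp
  next
    case False
    then have "l \<notin> P" "turn l \<notin> P" using P_theta_c l by blast+
    then show ?thesis using False l by (simp add: homotopy_def)
  qed
  show "homotopy (t, l) = curve_B (relabel (move (t, turn (relabel l))))" if l: "turn (relabel l) \<in> P" for l
  proof -
    consider "l \<in> theta_c" | "l \<notin> theta_c" "relabel l \<in> P" | "l \<notin> theta_c" "relabel l \<notin> P" by blast
    then show ?thesis
    proof cases
      case 1
      then show ?thesis
        using move_full(2)[OF t, of "turn l"] l by (simp only: c ct turn_theta_c turn_relabel)
    next
      case 2
      have "relabel (move (t, relabel l)) \<in> Q"
        using move_in[OF t 2(2)] saturate_closed by simp
      then have "curve_B (relabel (turn (move (t, relabel l)))) = curve_B (relabel (move (t, relabel l)))"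
        using curve_B_turn[OF in_cell(1)] by (simp add: turn_relabel[symmetric])
      then show ?thesis
        using move_turn[OF t 2(2) l] a[OF 2(2)] by auto
    next
      case 3
      then have "l \<notin> P" "turn l \<notin> P" using P_theta_c l by blast+
      then show ?thesis using 3 by (simp add: homotopy_def)
    qed
  qed
qed

text \<open>Exchanging arcs leads from a piece with a short marked arc to the piece with a short unmarked arc.\<close>

lemma homotopy_swap:
  assumes t: "t \<in> {0..1}" and c: "c \<in> {0..1}" and x: "x \<ge> 0" "y \<ge> 0" "x + y = 1"
  shows "homotopy (t, 0, c, x, y, 1) = homotopy (t, 0, 1, x, y, c)"
    and "homotopy (t, x, y, 0, c, 1) = homotopy (t, x, y, 0, 1, c)"
proof -
  have s: "r t c * c \<in> {0..1}" using r_bounds[OF t c] c by simp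
  have "relabel (0, c, x, y, 1) \<in> P" "(0, 1, x, y, c) \<in> theta_c"
    using c x P_zero[OF x c] by (auto simp: theta_c_def relabel_def)
  then have "homotopy (t, 0, c, x, y, 1) = curve_B (0, r t c * c, x, y, 1)" "homotopy (t, 0, 1, x, y, c) = curve_B (0, 1, x, y, r t c * c)"
    using homotopy_eq[OF t] by (auto simp: relabel_def move_end shorten_def)
  moreover have "(0, 1, x, y, r t c * c) \<in> cell_B"
    using s x by (auto simp: cell_B_def)
  ultimately show "homotopy (t, 0, c, x, y, 1) = homotopy (t, 0, 1, x, y, c)"
    by (metis curve_B_swap_a)
  have "(x, y, 0, c, 1) \<in> P" "(x, y, 0, 1, c) \<in> theta_c"
    using c x P_zero[OF x c] by (auto simp: theta_c_def)
  then have "homotopy (t, x, y, 0, c, 1) = curve_B (x, y, 0, r t c * c, 1)" "homotopy (t, x, y, 0, 1, c) = curve_B (x, y, 0, 1, r t c * c)"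
    using homotopy_eq[OF t] by (auto simp: move_end shorten_def)
  moreover have "(x, y, 0, 1, r t c * c) \<in> cell_B"
    using s x by (auto simp: cell_B_def)
  ultimately show "homotopy (t, x, y, 0, c, 1) = homotopy (t, x, y, 0, 1, c)"
    by (metis curve_B_swap_b)
qed

lemma swap_in:
  assumes "c \<in> {0..1}" "x \<ge> 0" "y \<ge> 0" "x + y = 1"
  shows "(0, c, x, y, 1) \<in> Q \<and> (0, 1, x, y, c) \<in> Q" and "(x, y, 0, c, 1) \<in> Q \<and> (x, y, 0, 1, c) \<in> Q"
proof -
  have "relabel (0, c, x, y, 1) \<in> P" "(0, 1, x, y, c) \<in> theta_c" "(x, y, 0, c, 1) \<in> P" "(x, y, 0, 1, c) \<in> theta_c"
    using assms P_zero by (auto simp: theta_c_def relabel_def)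
  then show "(0, c, x, y, 1) \<in> Q \<and> (0, 1, x, y, c) \<in> Q" "(x, y, 0, c, 1) \<in> Q \<and> (x, y, 0, 1, c) \<in> Q"
    by (simp_all add: saturate_def)
qed

lemma homotopy_turn:
  assumes t: "t \<in> {0..1}" and l: "l \<in> Q"
  shows "homotopy (t, turn l) = homotopy (t, l)"
proof -
  have "l \<in> theta_c \<or> l \<in> P \<or> turn l \<in> P \<or> relabel l \<in> P \<or> turn (relabel l) \<in> P"
    using l unfolding saturate_def by auto
  then show ?thesis
  proof (elim disjE)
    assume l: "l \<in> theta_c"
    then show ?thesis
      using homotopy_eq(1)[OF t] curve_B_turn[OF in_cell(2)[OF shorten_in[OF t l]]]
      by (simp add: turn_theta_c shorten_turn)
  next
    assume "l \<in> P"
    then show ?thesis using homotopy_eq(2)[OF t, of l] homotopy_eq(3)[OF t, of "turn l"] by simp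
  next
    assume "turn l \<in> P"
    then show ?thesis using homotopy_eq(3)[OF t, of l] homotopy_eq(2)[OF t, of "turn l"] by simp
  next
    assume "relabel l \<in> P"
    then show ?thesis using homotopy_eq(4)[OF t, of l] homotopy_eq(5)[OF t, of "turn l"] by (simp add: turn_relabel[symmetric])
  next
    assume "turn (relabel l) \<in> P"
    then show ?thesis using homotopy_eq(5)[OF t, of l] homotopy_eq(4)[OF t, of "turn l"] by (simp add: turn_relabel[symmetric])
  qed
qed

lemma invariant_homotopy:
  assumes t: "t \<in> {0..1}"
  shows "invariant_on Q (\<lambda>l. homotopy (t, l))"
  unfolding invariant_on_def
proof (intro conjI allI impI subset_trans[OF Q_spine spine_subset])
  fix a1 a2 b1 b2 c assume l: "(a1, a2, b1, b2, c) \<in> Q"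
  then show "(a2, a1, b2, b1, c) \<in> Q" "homotopy (t, a2, a1, b2, b1, c) = homotopy (t, a1, a2, b1, b2, c)"
    using saturate_closed(1)[of "(a1, a2, b1, b2, c)"] homotopy_turn[OF t l] by (simp_all add: turn_def)
next
  fix a1 a2 b1 b2 assume l: "(a1, a2, b1, b2, 0) \<in> Q"
  then have *: "(a1, a2, b1, b2, 0) \<in> theta_c" "(a2, a1, b1, b2, 0) \<in> theta_c"
    using Q_spine by (auto simp: spine_def theta_c_def)
  then show "(a2, a1, b1, b2, 0) \<in> Q" using P_Q by auto
  show "homotopy (t, a2, a1, b1, b2, 0) = homotopy (t, a1, a2, b1, b2, 0)"
    using homotopy_eq(1)[OF t] * curve_B_flip[OF in_cell(2)[OF *(1)]] by (simp add: shorten_def)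
next
  fix a2 b1 b2 c assume l: "(0, a2, b1, b2, c) \<in> Q"
  then have *: "a2 = 1 \<and> c = 1 \<or> b1 \<ge> 0 \<and> b2 \<ge> 0 \<and> b1 + b2 = 1 \<and> (a2 = 1 \<and> c \<in> {0..1} \<or> c = 1 \<and> a2 \<in> {0..1})"
    using Q_spine by (auto simp: spine_def)
  show "(0, c, b1, b2, a2) \<in> Q"
    using * l swap_in(1) by (elim disjE conjE) simp_all
  from * show "homotopy (t, 0, c, b1, b2, a2) = homotopy (t, 0, a2, b1, b2, c)"
    using homotopy_swap(1)[OF t] by metis
next
  fix a1 a2 b2 c assume l: "(a1, a2, 0, b2, c) \<in> Q"
  then have *: "b2 = 1 \<and> c = 1 \<or> a1 \<ge> 0 \<and> a2 \<ge> 0 \<and> a1 + a2 = 1 \<and> (b2 = 1 \<and> c \<in> {0..1} \<or> c = 1 \<and> b2 \<in> {0..1})"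
    using Q_spine by (auto simp: spine_def)
  show "(a1, a2, 0, c, b2) \<in> Q"
    using * l swap_in(2) by (elim disjE conjE) simp_all
  from * show "homotopy (t, a1, a2, 0, c, b2) = homotopy (t, a1, a2, 0, b2, c)"
    using homotopy_swap(2)[OF t] by metis
qed

definition pieces :: "(lengths set \<times> (real \<times> lengths \<Rightarrow> lengths)) set" where
  "pieces = {(theta_c, shorten r), (P, move), (turn -` P, \<lambda>x. move (fst x, turn (snd x))),
     (relabel -` P, \<lambda>x. relabel (move (fst x, relabel (snd x)))),
     ((\<lambda>l. turn (relabel l)) -` P, \<lambda>x. relabel (move (fst x, turn (relabel (snd x)))))}"

lemma piece:
  assumes i: "i \<in> pieces"
  shows "closed (fst i)" "continuous_on S (snd i)"
    and "t \<in> {0..1} \<Longrightarrow> l \<in> fst i \<Longrightarrow> snd i (t, l) \<in> Q \<and> curve_B (snd i (t, l)) = homotopy (t, l)"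
    and "(\<And>l. l \<in> P \<Longrightarrow> move (1, l) \<in> saturate P') \<Longrightarrow> l \<in> fst i \<Longrightarrow> snd i (1, l) \<in> saturate P'"
    and "l \<in> fst i \<Longrightarrow> curve_B (snd i (0, l)) = curve_B l"
proof -
  have tr: "continuous_on S (\<lambda>l. turn (relabel l))" for S
    by (intro continuous_on_compose2[OF continuous_on_turn continuous_on_relabel]) auto
  show "closed (fst i)"
    using i unfolding pieces_def
    by (auto intro!: closed_theta closed_P closed_vimage continuous_on_turn continuous_on_relabel tr)
  have c: "continuous_on S (\<lambda>x. move (fst x, m (snd x)))" if "\<And>S. continuous_on S m" for m and S :: "(real \<times> lengths) set"
    by (rule continuous_on_compose2[OF continuous_move[of UNIV]])
      (auto intro!: continuous_intros continuous_on_compose2[OF that])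
  show "continuous_on S (snd i)"
    using i unfolding pieces_def
    by (auto intro!: continuous_on_shorten continuous_move c tr continuous_on_turn continuous_on_relabel
        continuous_on_compose2[OF continuous_on_relabel[of UNIV] c])
  show "snd i (t, l) \<in> Q \<and> curve_B (snd i (t, l)) = homotopy (t, l)" if t: "t \<in> {0..1}" and l: "l \<in> fst i"
    using i l unfolding pieces_def
    by (elim insertE emptyE; simp add: saturate_closed homotopy_eq[OF t] move_in[OF t] subsetD[OF P_Q(2) shorten_in[OF t]])
  show "snd i (1, l) \<in> saturate P'" if "\<And>l. l \<in> P \<Longrightarrow> move (1, l) \<in> saturate P'" and l: "l \<in> fst i" for P'
    using i l that(1) shorten_in[of 1] unfolding pieces_def
    by (elim insertE emptyE) (simp_all add: saturate_closed, simp add: saturate_def)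
  show "curve_B (snd i (0, l)) = curve_B l" if l: "l \<in> fst i"
  proof -
    have Q: "l \<in> Q" if "turn l \<in> P \<or> turn (relabel l) \<in> P"
      using that by (auto simp: saturate_def)
    have "curve_B (turn l) = curve_B l" if "turn l \<in> P"
      using curve_B_turn[OF in_cell(1)[OF Q]] that by blast
    moreover have "curve_B (relabel (turn (relabel l))) = curve_B l" if "turn (relabel l) \<in> P"
      using curve_B_turn[OF in_cell(1)[OF Q]] that by (simp add: turn_relabel)
    ultimately show ?thesis
      using i l unfolding pieces_def
      by (elim insertE emptyE; simp add: shorten_0 move_0)
  qed
qed

lemma Q_pieces: "Q = (\<Union>i\<in>pieces. fst i)"
  unfolding pieces_def saturate_def by (simp add: Un_assoc)

lemma finite_pieces: "finite pieces"
  by (simp add: pieces_def)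

lemma continuous_map_homotopy:
  "continuous_map (prod_topology (top_of_set {0..1}) (top_of_set Q)) (B_space Q) homotopy"
proof -
  have "\<exists>i\<in>pieces. x \<in> snd -` fst i" if "x \<in> {0..1} \<times> Q" for x :: "real \<times> lengths"
  proof -
    have "snd x \<in> (\<Union>i\<in>pieces. fst i)"
      using that unfolding Q_pieces by (simp only: mem_Times_iff)
    then show ?thesis by (simp only: UN_iff vimage_eq)
  qed
  then show ?thesis
    unfolding prod_top_of_set
    by (intro B_space_pieces[where T = "\<lambda>i. snd -` fst i" and f = snd, OF finite_pieces])
      (use piece in \<open>auto intro!: closed_vimage continuous_on_snd continuous_on_id\<close>)
qed

lemma continuous_map_homotopy_1:
  assumes "\<And>l. l \<in> P \<Longrightarrow> move (1, l) \<in> saturate P'"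
  shows "continuous_map (top_of_set Q) (B_space (saturate P')) (\<lambda>l. homotopy (1, l))"
proof -
  have "continuous_on S (\<lambda>l. snd i (1, l))" if "i \<in> pieces" for S i
    by (rule continuous_on_compose2[OF piece(2)[OF that, of UNIV]]) (auto intro!: continuous_intros)
  then show ?thesis
    by (intro B_space_pieces[where T = fst and f = "\<lambda>i l. snd i (1, l)", OF finite_pieces])
      (use Q_pieces piece(1,3) piece(4)[OF _ assms] in auto)
qed

lemma homotopy_0:
  assumes "l \<in> Q"
  shows "homotopy (0, l) = curve_B l"
proof -
  obtain i where "i \<in> pieces" "l \<in> fst i" using assms unfolding Q_pieces by (rule UN_E)
  then show ?thesis using piece(3,5)[of i] by (metis atLeastAtMost_iff order_refl zero_le_one)
qed

end

section \<open>Sliding the mark off the short arc\<close>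

text \<open>At time 1 the length \<open>b\<close> of the short arc becomes \<open>3 * b - 1\<close>, cut off to the interval from 0
  to 1: arcs shorter than 1/3 are contracted and arcs longer than 2/3 are stretched to length 1. The lower bound 1/3 in the denominator
  only avoids a division by zero, as the numerator vanishes there.\<close>

definition scale :: "real \<Rightarrow> real \<Rightarrow> real" where
  "scale t b = (1 - t) + t * max 0 (min 1 (3 * b - 1)) / max b (1/3)"

text \<open>Speed 2 completes both phases of \<open>slide\<close> at time 1 for short arcs of medium length; there is no motion at all for length 1, where the short
  arc is not unique, and for length 0.\<close>

definition speed :: "real \<Rightarrow> real" where
  "speed b = min 2 (min (6 * b) (6 * (1 - b)))"

text \<open>The motion, with progress \<open>k\<close> between 0 and 2, has two phases. In the second phase, \<open>k \<ge> 1\<close>, the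
  mark \<open>y\<close> moves along the short arc into \<open>u\<close>, the nearer end. There is a conflict if \<open>y\<close> is in the
  middle of the arc, since \<open>v\<close> is equally near. The two choices differ by the exchange of \<open>u\<close> and \<open>v\<close>,
  so they give the same curve if \<open>x\<close> is in the middle of its arc. Therefore \<open>x\<close> is moved towards the middle
  in the first phase, completely if \<open>y\<close> is in the middle (\<open>w = 0\<close>) and not at all if \<open>y\<close> is at an
  end (\<open>w = 1\<close>). The lower bound 1/6 in the denominator keeps the formula continuous at
  \<open>b = 0\<close>; the second phase is reached only for \<open>6 * b > 1\<close>, where it has no effect.

  Motions that remain incomplete at time 1 do no harm: they happen for \<open>b < 1/3\<close>, where the short arc is
  contracted, or for \<open>b > 2/3\<close>, where it is stretched to length 1.\<close>

definition slide :: "real \<times> lengths \<Rightarrow> lengths" where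
  "slide = (\<lambda>(t, a1, a2, b1, b2, c). let b = b1 + b2; k = t * speed b;
     w = 1 - 2 * b1 * (min 1 k / max b (1/6)); v = max 0 (k - 1) in
     (1/2 + (a1 - 1/2) * w, 1/2 + (a2 - 1/2) * w, scale t b * (b1 * (1 - v)), scale t b * (b2 + b1 * v), c))"

text \<open>The arc of \<open>y\<close> is the short one and \<open>y\<close> sits at \<open>u\<close>.\<close>

definition end_piece :: "lengths set" where
  "end_piece = {(a1, a2, b1, b2, c). a1 \<ge> 0 \<and> a2 \<ge> 0 \<and> a1 + a2 = 1 \<and> b1 = 0 \<and> b2 \<in> {0..1} \<and> c = 1}"

abbreviation "square_spine \<equiv> saturate end_piece"

lemma end_piece_subset: "end_piece \<subseteq> theta_b"
  by (auto simp: end_piece_def theta_b_def)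

lemma scale_bounds:
  assumes "t \<in> {0..1}" "b \<in> {0..1}"
  shows "scale t b \<ge> 0" "scale t b * b \<le> 1"
proof -
  define h where "h = max 0 (min 1 (3 * b - 1)) / max b (1/3)"
  have h: "scale t b = (1 - t) + t * h" by (simp add: scale_def h_def)
  have h0: "h \<ge> 0" unfolding h_def by (intro divide_nonneg_nonneg) auto
  then show "scale t b \<ge> 0" using assms h by simp
  have "max 0 (min 1 (3 * b - 1)) * b \<le> 1 * max b (1/3)"
    using assms by (intro mult_mono) auto
  then have "h * b \<le> 1"
    using assms by (simp add: h_def divide_le_eq max_def)
  then have "(1 - t) * b + t * (h * b) \<le> (1 - t) * 1 + t * 1"
    using assms by (intro add_mono mult_left_mono) auto
  then show "scale t b * b \<le> 1" by (simp add: h algebra_simps)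
qed

lemma scale_end: "b \<le> 1/3 \<Longrightarrow> scale 1 b = 0" "b \<ge> 2/3 \<Longrightarrow> scale 1 b * b = 1"
  "scale t 1 = 1" "scale 0 b = 1"
  by (auto simp: scale_def min_def max_def field_simps)

lemma speed_bounds: "b \<in> {0..1} \<Longrightarrow> speed b \<in> {0..2}"
  by (auto simp: speed_def)

lemma speed_values: "speed 1 = 0" "b \<in> {1/3..2/3} \<Longrightarrow> speed b = 2"
  by (auto simp: speed_def)

text \<open>The new positions are convex combinations: \<open>x\<close> moves between its old place and the middle, \<open>y\<close>
  between its old place and \<open>u\<close>. At time 1 the three ranges of \<open>b\<close> give, in this order, a contracted
  arc, a mark at \<open>u\<close>, and an arc of length 1.\<close>

lemma slide_in:
  assumes t: "t \<in> {0..1}" and l: "l \<in> theta_b"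
  shows "slide (t, l) \<in> theta_b" "t = 1 \<Longrightarrow> slide (t, l) \<in> square_spine"
proof -
  obtain a1 a2 b1 b2 c where l': "l = (a1, a2, b1, b2, c)" by (cases l)
  have l0: "a1 \<ge> 0" "a2 \<ge> 0" "b1 \<ge> 0" "b2 \<ge> 0" "a1 + a2 = 1" "c = 1" "b1 + b2 \<le> 1" "b1 \<le> b2"
    using l by (auto simp: l' theta_b_def)
  define b where "b = b1 + b2"
  define k where "k = t * speed b"
  define w where "w = 1 - 2 * b1 * (min 1 k / max b (1/6))"
  define v where "v = max 0 (k - 1)"
  have b: "b \<in> {0..1}" using l0 by (simp add: b_def)
  have eq: "slide (t, l) = (1/2 + (a1 - 1/2) * w, 1/2 + (a2 - 1/2) * w, scale t b * (b1 * (1 - v)), scale t b * (b2 + b1 * v), 1)"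
    unfolding l' slide_def prod.case Let_def b_def[symmetric] k_def[symmetric] w_def[symmetric] v_def[symmetric] by (simp add: l0)
  have k: "0 \<le> k" "k \<le> 2"
  proof -
    show "0 \<le> k" using t speed_bounds[OF b] by (simp add: k_def)
    have "t * speed b \<le> 1 * 2" using t speed_bounds[OF b] by (intro mult_mono) auto
    then show "k \<le> 2" by (simp add: k_def)
  qed
  then have v: "0 \<le> v" "v \<le> 1" by (auto simp: v_def)
  have "2 * b1 * min 1 k \<le> b * 1"
    using l0 k by (intro mult_mono) (auto simp: b_def)
  then have "2 * b1 * min 1 k \<le> max b (1/6)" by simp
  then have "2 * b1 * (min 1 k / max b (1/6)) \<le> 1" by (simp add: divide_le_eq_1 max_def split: if_splits)
  moreover have "2 * b1 * (min 1 k / max b (1/6)) \<ge> 0"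
    using l0 k by (intro mult_nonneg_nonneg divide_nonneg_nonneg) auto
  ultimately have w: "0 \<le> w" "w \<le> 1" by (auto simp: w_def)
  have a: "1/2 + (a - 1/2) * w \<ge> 0" if "a \<ge> 0" for a
  proof -
    have "(a - 1/2) * w \<ge> (- 1/2) * w" using w that by (intro mult_right_mono) auto
    then show ?thesis using w by simp
  qed
  have a': "(1/2 + (a1 - 1/2) * w) + (1/2 + (a2 - 1/2) * w) = 1"
  proof -
    have "(1/2 + (a1 - 1/2) * w) + (1/2 + (a2 - 1/2) * w) = 1 + (a1 + a2 - 1) * w" by (simp add: algebra_simps)
    then show ?thesis by (simp add: l0)
  qed
  have b': "scale t b * (b1 * (1 - v)) + scale t b * (b2 + b1 * v) = scale t b * b"
    by (simp add: b_def algebra_simps)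
  have bb: "scale t b * (b1 * (1 - v)) \<ge> 0" "scale t b * (b2 + b1 * v) \<ge> 0"
    using scale_bounds[OF t b] l0 v by simp_all
  have "scale t b * (b1 * (1 - v)) \<le> scale t b * (b2 + b1 * v)"
  proof -
    have "b1 * (1 - v) \<le> b1" "b1 * v \<ge> 0" using l0 v by (auto intro: mult_left_le)
    then have "b1 * (1 - v) \<le> b2 + b1 * v" using l0 by linarith
    then show ?thesis by (rule mult_left_mono) (rule scale_bounds(1)[OF t b])
  qed
  then show S: "slide (t, l) \<in> theta_b"
    unfolding eq theta_b_def using a[OF l0(1)] a[OF l0(2)] a' bb b' scale_bounds(2)[OF t b] by simp
  show "slide (t, l) \<in> square_spine" if t1: "t = 1"
  proof -
    consider "b \<le> 1/3" | "b \<in> {1/3..2/3}" | "b \<ge> 2/3" by fastforce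
    then have "scale t b * (b1 * (1 - v)) = 0 \<or> scale t b * (b1 * (1 - v)) + scale t b * (b2 + b1 * v) = 1"
    proof cases
      case 1
      then show ?thesis using scale_end(1) t1 by simp
    next
      case 2
      then have "v = 1" using speed_values(2) t1 by (simp add: v_def k_def)
      then show ?thesis by simp
    next
      case 3
      then show ?thesis unfolding b' using scale_end(2) t1 by simp
    qed
    then have "slide (t, l) \<in> end_piece \<or> slide (t, l) \<in> theta_c"
      using S unfolding eq theta_b_def end_piece_def theta_c_def by auto
    then show ?thesis by (auto simp: saturate_def)
  qed
qed

lemma slide_end: "b1 + b2 = 1 \<Longrightarrow> slide (t, a1, a2, b1, b2, c) = (a1, a2, b1, b2, c)" "slide (0, l) = l"
  by (cases l; simp add: slide_def scale_end Let_def speed_values)+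

lemma slide_at_0: "slide (t, a1, a2, 0, b, c) = (a1, a2, 0, scale t b * b, c)"
  by (simp add: slide_def Let_def)

text \<open>For \<open>y\<close> in the middle: either only the first phase has happened, which commutes with the exchange
  of \<open>u\<close> and \<open>v\<close>, or \<open>x\<close> has arrived in the middle.\<close>

lemma slide_symmetric:
  assumes t: "t \<in> {0..1}" and b: "b \<ge> 0"
  shows "slide (t, a2, a1, b, b, c) = turn (slide (t, a1, a2, b, b, c)) \<or> slide (t, a2, a1, b, b, c) = slide (t, a1, a2, b, b, c)"
proof (cases "t * speed (b + b) \<le> 1")
  case True
  then show ?thesis by (simp add: slide_def Let_def turn_def)
next
  case False
  have "t * speed (b + b) \<le> t * (6 * (b + b))"
    using t by (intro mult_left_mono) (auto simp: speed_def)
  also have "\<dots> \<le> 1 * (6 * (b + b))"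
    using t b by (intro mult_right_mono) auto
  finally have "1 < 1 * (6 * (b + b))" using False by (meson not_le less_le_trans)
  then have "b + b > 1/6" by simp
  then have "1 - 2 * b * (min 1 (t * speed (b + b)) / max (b + b) (1/6)) = 0"
    using False by (simp add: max_def)
  then show ?thesis unfolding slide_def prod.case Let_def by (simp only: mult_zero_right) simp
qed

lemma continuous_on_slide: "continuous_on S slide"
  unfolding slide_def scale_def speed_def case_prod_unfold Let_def by (intro continuous_intros ballI) auto

lemma scale_0: "scale 0 b = 1"
  by (simp add: scale_def)

lemma slide_full:
  assumes "l \<in> theta_c"
  shows "l \<in> theta_b \<Longrightarrow> slide (t, l) = l" "relabel l \<in> theta_b \<Longrightarrow> slide (t, relabel l) = relabel l"
    "l \<in> theta_b \<or> relabel l \<in> theta_b \<Longrightarrow> shorten scale (t, l) = l"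
  using assms by (cases l; auto simp: theta_c_def theta_b_def relabel_def shorten_def slide_end scale_end)+

lemma slide_turn:
  assumes t: "t \<in> {0..1}" and l: "l \<in> theta_b" "turn l \<in> theta_b"
  shows "slide (t, turn l) = turn (slide (t, l)) \<or> slide (t, turn l) = slide (t, l)"
proof -
  obtain a1 a2 b1 b2 c where l': "l = (a1, a2, b1, b2, c)" by (cases l)
  have "b1 = b2" "b1 \<ge> 0" using l by (auto simp: l' theta_b_def turn_def)
  then show ?thesis
    using slide_symmetric[OF t, of b1 a2 a1 c] unfolding l' turn_def prod.case by simp
qed

text \<open>Where all arcs have length 1, the speed is zero and the scaling factor is 1, so nothing moves.\<close>

interpretation slide: spine_homotopy theta_b scale slide
proof
  show "(x, y, 0, c, 1) \<in> theta_b" if "x \<ge> 0" "y \<ge> 0" "x + y = 1" "c \<in> {0..1}" for x y c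
    using that by (simp add: theta_b_def)
  show "scale t c * c \<in> {0..1}" if "t \<in> {0..1}" "c \<in> {0..1}" for t c
    using scale_bounds[OF that] that by simp
  show "continuous_on UNIV (\<lambda>x. scale (fst x) (snd x))"
    unfolding scale_def by (intro continuous_intros ballI) auto
  show "slide (t, l) \<in> saturate theta_b" if "t \<in> {0..1}" "l \<in> theta_b" for t l
    using slide_in(1)[OF that] by (auto simp: saturate_def)
qed (use slide_turn in \<open>auto simp: slide_end slide_at_0 slide_full closed_theta continuous_on_slide scale_0\<close>)

lemma contractible_B_space_spine:
  assumes "contractible_space (B_space square_spine)"
  shows "contractible_space (B_space spine)"
  unfolding spine_eq_saturate
proof (rule B_space_deformation[OF saturate_mono[OF end_piece_subset] assms])
  show "continuous_map (top_of_set (saturate theta_b)) (B_space square_spine) (\<lambda>l. slide.homotopy (1, l))"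
    by (rule slide.continuous_map_homotopy_1) (use slide_in(2)[of 1] in simp)
qed (use slide.invariant_homotopy slide.continuous_map_homotopy slide.homotopy_0 in auto)

section \<open>Contracting the remaining square\<close>

text \<open>On the remaining piece with \<open>y\<close> at \<open>u\<close>, the short arc of \<open>y\<close> is just an unmarked arc.\<close>

definition shrink_end :: "real \<times> lengths \<Rightarrow> lengths" where
  "shrink_end = (\<lambda>(t, a1, a2, b1, b2, c). (a1, a2, b1, (1 - t) * b2, c))"

lemma closed_end_piece: "closed end_piece"
  unfolding end_piece_def case_prod_unfold atLeastAtMost_iff
  by (auto intro!: closed_Collect_conj closed_Collect_le closed_Collect_eq continuous_intros)

text \<open>Where all arcs have length 1, a mark sits at a branch vertex and the arc that carries it is
  exchanged with the unmarked arc; so shrinking either of them gives the same curve.\<close>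

interpretation shrink: spine_homotopy end_piece "\<lambda>t _. 1 - t" shrink_end
proof
  have b: "(1 - t) * b \<in> {0..1}" if "t \<in> {0..1}" "b \<in> {0..1}" for t b :: real
    using that mult_mono[of "1 - t" 1 b 1] by simp
  then show "(1 - t) * c \<in> {0..1}" if "t \<in> {0..1}" "c \<in> {0..1}" for t c :: real
    using that by simp
  show "shrink_end (t, l) \<in> square_spine" if "t \<in> {0..1}" "l \<in> end_piece" for t l
  proof -
    have "shrink_end (t, l) \<in> end_piece"
      using that b by (cases l) (simp add: end_piece_def shrink_end_def)
    then show ?thesis by (simp add: saturate_def)
  qed
  show "continuous_on S shrink_end" for S
    unfolding shrink_end_def case_prod_unfold by (intro continuous_intros)
  show "shrink_end (t, turn l) = turn (shrink_end (t, l)) \<or> shrink_end (t, turn l) = shrink_end (t, l)"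
    if "t \<in> {0..1}" "l \<in> end_piece" "turn l \<in> end_piece" for t l
    using that by (cases l) (simp add: end_piece_def turn_def shrink_end_def)
  show "curve_B (shrink_end (t, l)) = curve_B (shorten (\<lambda>t _. 1 - t) (t, l))"
    if t: "t \<in> {0..1}" and l: "l \<in> theta_c" "l \<in> end_piece" for t l
  proof -
    obtain a1 a2 where l': "l = (a1, a2, 0, 1, 1)" and a: "a1 \<ge> 0" "a2 \<ge> 0" "a1 + a2 = 1"
      using l by (cases l) (auto simp: theta_c_def end_piece_def)
    then have "(a1, a2, 0, 1, 1 - t) \<in> cell_B" using t by (auto simp: cell_B_def)
    from curve_B_swap_b[OF this] show ?thesis by (simp add: l' shrink_end_def shorten_def)
  qed
  show "curve_B (relabel (shrink_end (t, relabel l))) = curve_B (shorten (\<lambda>t _. 1 - t) (t, l))"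
    if t: "t \<in> {0..1}" and l: "l \<in> theta_c" "relabel l \<in> end_piece" for t l
  proof -
    obtain b1 b2 where l': "l = (0, 1, b1, b2, 1)" and b: "b1 \<ge> 0" "b2 \<ge> 0" "b1 + b2 = 1"
      using l by (cases l) (auto simp: theta_c_def end_piece_def relabel_def)
    then have "(0, 1, b1, b2, 1 - t) \<in> cell_B" using t by (auto simp: cell_B_def)
    from curve_B_swap_a[OF this] show ?thesis by (simp add: l' shrink_end_def shorten_def relabel_def)
  qed
  show "continuous_on UNIV (\<lambda>x :: real \<times> real. 1 - fst x)"
    by (intro continuous_intros)
qed (use end_piece_subset closed_end_piece in \<open>auto simp: end_piece_def shrink_end_def\<close>)

text \<open>The distances of the marks from the nearer branch vertices, along arcs of length 1.\<close>

definition position :: "lengths \<Rightarrow> real \<times> real" where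
  "position = (\<lambda>(a1, a2, b1, b2, c). (min a1 a2, min b1 b2))"

text \<open>Two loops of length 1 with a common vertex, with marks at distance \<open>s\<close> and \<open>r\<close> from it.\<close>

definition two_loops :: "real \<times> real \<Rightarrow> lengths" where
  "two_loops = (\<lambda>(s, r). (s, 1 - s, r, 1 - r, 0))"

lemma continuous_on_position: "continuous_on S position" and continuous_on_two_loops: "continuous_on T two_loops"
  unfolding position_def two_loops_def case_prod_unfold by (intro continuous_intros)+

text \<open>When \<open>u = v\<close>, each loop can be reflected, so that the nearer side comes first.\<close>

lemma two_loops_position:
  assumes "(a1, a2, b1, b2, c) \<in> theta_c"
  shows "curve_B (two_loops (position (a1, a2, b1, b2, c))) = curve_B (a1, a2, b1, b2, 0)"
proof -
  have l: "a1 \<ge> 0" "a2 \<ge> 0" "b1 \<ge> 0" "b2 \<ge> 0" "a2 = 1 - a1" "b2 = 1 - b1"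
    using assms by (auto simp: theta_c_def)
  have B: "(x, 1 - x, y, 1 - y, 0) \<in> cell_B" if "x \<in> {0..1}" "y \<in> {0..1}" for x y
    using that by (simp add: cell_B_def)
  have a: "curve_B (1 - x, x, y, 1 - y, 0) = curve_B (x, 1 - x, y, 1 - y, 0)" if "x \<in> {0..1}" "y \<in> {0..1}" for x y
    using curve_B_flip[OF B[OF that]] by simp
  have b: "curve_B (x, 1 - x, 1 - y, y, 0) = curve_B (x, 1 - x, y, 1 - y, 0)" if "x \<in> {0..1}" "y \<in> {0..1}" for x y
    using curve_B_iota[OF B[OF that]] a[of x "1 - y"] that by simp
  consider "a1 \<le> a2" "b1 \<le> b2" | "a1 \<le> a2" "b2 \<le> b1" | "a2 \<le> a1" "b1 \<le> b2" | "a2 \<le> a1" "b2 \<le> b1"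
    by linarith
  then show ?thesis
    by cases (use l a[of a1 b1] b[of a1 b1] a[of a1 "1 - b1"] in \<open>auto simp: position_def two_loops_def min_def\<close>)
qed

lemma position_square: "l \<in> square_spine \<Longrightarrow> position l \<in> {0..1/2} \<times> {0..1/2}"
  using shrink.Q_spine by (cases l) (auto simp: position_def spine_def min_def)

lemma two_loops_in: "x \<in> {0..1/2} \<times> {0..1/2} \<Longrightarrow> two_loops x \<in> square_spine"
  by (cases x) (auto simp: two_loops_def saturate_def theta_c_def)

lemma invariant_position: "invariant_on square_spine position"
proof -
  have inv: "invariant_on square_spine (\<lambda>l. shrink.homotopy (0, l))"
    by (rule shrink.invariant_homotopy) simp
  show ?thesis
    unfolding invariant_on_def
  proof (intro conjI allI impI)
    show "square_spine \<subseteq> cell_B"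
      using shrink.in_cell by blast
  next
    fix a1 a2 b1 b2 c assume "(a1, a2, b1, b2, c) \<in> square_spine"
    then show "(a2, a1, b2, b1, c) \<in> square_spine" using inv unfolding invariant_on_def by metis
    show "position (a2, a1, b2, b1, c) = position (a1, a2, b1, b2, c)" by (simp add: position_def min.commute)
  next
    fix a1 a2 b1 b2 assume "(a1, a2, b1, b2, 0) \<in> square_spine"
    then show "(a2, a1, b1, b2, 0) \<in> square_spine" using inv unfolding invariant_on_def by metis
    show "position (a2, a1, b1, b2, 0) = position (a1, a2, b1, b2, 0)" by (simp add: position_def min.commute)
  next
    fix a2 b1 b2 c assume l: "(0, a2, b1, b2, c) \<in> square_spine"
    then show "(0, c, b1, b2, a2) \<in> square_spine" using inv unfolding invariant_on_def by metis
    have "a2 \<ge> 0" "c \<ge> 0" using subsetD[OF shrink.Q_spine l] by (auto simp: spine_def)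
    then show "position (0, c, b1, b2, a2) = position (0, a2, b1, b2, c)" by (simp add: position_def)
  next
    fix a1 a2 b2 c assume l: "(a1, a2, 0, b2, c) \<in> square_spine"
    then show "(a1, a2, 0, c, b2) \<in> square_spine" using inv unfolding invariant_on_def by metis
    have "b2 \<ge> 0" "c \<ge> 0" using subsetD[OF shrink.Q_spine l] by (auto simp: spine_def)
    then show "position (a1, a2, 0, c, b2) = position (a1, a2, 0, b2, c)" by (simp add: position_def)
  qed
qed

text \<open>A short marked arc with the mark at an end can be exchanged with the unmarked arc, so it suffices to
  compare the end maps on curves with a short unmarked arc.\<close>

lemma square_spine_theta_c:
  assumes l: "l \<in> square_spine"
  shows "\<exists>l'\<in>theta_c. curve_B l = curve_B l'"
proof -
  have e: "\<exists>l'\<in>theta_c. curve_B l = curve_B l'" if k: "l \<in> end_piece" for l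
  proof -
    obtain a1 a2 b where l': "l = (a1, a2, 0, b, 1)" and a: "a1 \<ge> 0" "a2 \<ge> 0" "a1 + a2 = 1" "b \<in> {0..1}"
      using k by (cases l) (auto simp: end_piece_def)
    then have "(a1, a2, 0, b, 1) \<in> cell_B" "(a1, a2, 0, 1, b) \<in> theta_c" by (auto simp: cell_B_def theta_c_def)
    then show ?thesis using curve_B_swap_b unfolding l' by blast
  qed
  have r: "\<exists>l'\<in>theta_c. curve_B l = curve_B l'" if k: "relabel l \<in> end_piece" for l
  proof -
    obtain b1 b2 a where l': "l = (0, a, b1, b2, 1)" and a: "b1 \<ge> 0" "b2 \<ge> 0" "b1 + b2 = 1" "a \<in> {0..1}"
      using k by (cases l) (auto simp: end_piece_def relabel_def)
    then have "(0, a, b1, b2, 1) \<in> cell_B" "(0, 1, b1, b2, a) \<in> theta_c" by (auto simp: cell_B_def theta_c_def)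
    then show ?thesis using curve_B_swap_a unfolding l' by blast
  qed
  have t: "curve_B (turn l) = curve_B l"
    using l by (intro curve_B_turn shrink.in_cell)
  show ?thesis
    using l e[of l] e[of "turn l"] r[of l] r[of "turn l"] unfolding saturate_def t by (auto simp: turn_relabel)
qed

text \<open>Shrinking the short arc ends in \<open>two_loops\<close> at the given positions, and positions do not
  depend on the chosen lengths; so the square is a deformation retract up to homotopy.\<close>

lemma contractible_B_space_square_spine: "contractible_space (B_space square_spine)"
proof -
  let ?S = "{0..1/2} \<times> {0..1/2} :: (real \<times> real) set"
  obtain F where F: "continuous_map (prod_topology (top_of_set {0..1::real}) (B_space square_spine)) (B_space square_spine) F"
    "\<forall>t\<in>{0..1}. \<forall>l\<in>square_spine. F (t, curve_B l) = shrink.homotopy (t, l)"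
    using B_space_lift[OF shrink.invariant_homotopy shrink.continuous_map_homotopy] by blast
  define f where "f = (\<lambda>\<tau>. position (SOME l. l \<in> square_spine \<and> curve_B l = \<tau>))"
  have f: "f (curve_B l) = position l" if "l \<in> square_spine" for l
  proof -
    have "(SOME k. k \<in> square_spine \<and> curve_B k = curve_B l) \<in> square_spine \<and> curve_B (SOME k. k \<in> square_spine \<and> curve_B k = curve_B l) = curve_B l"
      by (rule someI[of _ l]) (use that in auto)
    then show ?thesis
      unfolding f_def using invariant_onD(2)[OF invariant_position] shrink.in_cell(1)[OF that] by blast
  qed
  have cf: "continuous_map (B_space square_spine) (top_of_set ?S) f"
    unfolding B_space_def
  proof (rule continuous_map_from_final_topology)
    have "continuous_map (top_of_set square_spine) (top_of_set ?S) position"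
      by (intro continuous_map_top_of_setI continuous_on_position image_subsetI position_square)
    then show "continuous_map (top_of_set square_spine) (top_of_set ?S) (f \<circ> curve_B)"
      by (rule continuous_map_eq) (simp add: f)
  qed
  have cg: "continuous_map (top_of_set ?S) (B_space square_spine) (\<lambda>x. curve_B (two_loops x))"
    by (intro continuous_map_curve_B_compose continuous_map_top_of_setI continuous_on_two_loops image_subsetI two_loops_in)
  have "convex ?S" by (intro convex_Times convex_real_interval)
  then have con: "contractible_space (top_of_set ?S)"
    using convex_imp_contractible contractible_space_top_of_set by metis
  show ?thesis
  proof (rule contractible_space_deformation[OF cf cg con F(1)])
    fix \<tau> assume "\<tau> \<in> topspace (B_space square_spine)"
    then obtain l where l: "l \<in> square_spine" "\<tau> = curve_B l" by (auto simp: topspace_B_space)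
    show "F (0, \<tau>) = \<tau>"
      using F(2) l shrink.homotopy_0 by simp
    obtain l' where l': "l' \<in> theta_c" "curve_B l = curve_B l'"
      using square_spine_theta_c[OF l(1)] by blast
    obtain a1 a2 b1 b2 c where l'': "l' = (a1, a2, b1, b2, c)" by (cases l')
    have "l' \<in> square_spine" using l' by (simp add: saturate_def)
    then have "F (1, \<tau>) = shrink.homotopy (1, l')" "f \<tau> = position l'"
      using F(2) f by (simp_all add: l(2) l'(2))
    then show "F (1, \<tau>) = curve_B (two_loops (f \<tau>))"
      using two_loops_position l'(1) shrink.homotopy_eq(1)[of 1, OF _ l'(1)] by (simp add: l'' shorten_def)
  qed
qed

theorem theorem5p1: shows "contractible_space (TM 2 2)"
  by (intro contractible_TM_if_B_space contractible_B_space_cell contractible_B_space_spine contractible_B_space_square_spine)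

end
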